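(* Let $X$ be a compact connected Riemann surface, $S\subset X$ a nonempty finite subset, $(V,\phi)$ a Lie algebroid on $X$, and $E_*$ a (nonzero) parabolic vector bundle on $X$ with parabolic structure over $S$, with underlying holomorphic vector bundle $E$ and quasi-parabolic filtrations $E_x=E_x^1\supsetneq E_x^2\supsetneq\cdots\supsetneq E_x^{\ell_x}\supsetneq E_x^{\ell_x+1}=0$, $x\in S$. A Lie algebroid connection $D: E\to E\otimes V^*$ on $E$ gives a quasi-parabolic Lie algebroid connection on $E_*$ if and only if the following two statements hold: (1) For every $x\in S$, the homomorphism $\mathcal S_x: E_x\to E_x\otimes\mathcal Q_x$ associated to $D$ preserves the quasi-parabolic filtration of $E_*$ over $x$, i.e. $\mathcal S_x(E_x^i)\subset E_x^i\otimes\mathcal Q_x$ for all $1\le i\le \ell_x+1$. (2) For all $x\in S$, the homomorphism of fibers $\phi_x^*:(K_X)_x\to V_x^*$ is the zero map.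
   Context: $TX$ and $K_X$ are the holomorphic tangent and cotangent bundles of $X$; $W_y$ is the fiber at $y$ of a vector bundle $W$. Lie algebroid: a pair $(V,\phi)$ where $V$ is a holomorphic vector bundle on $X$ with a $\mathbb C$-bilinear sheaf pairing $[-,-]:V\otimes_{\mathbb C}V\to V$ (given by an $\mathcal O_X$-linear homomorphism $J^1(V)\otimes J^1(V)\to V$ of holomorphic vector bundles, $J^1$ being the first jet bundle) which is antisymmetric and satisfies the Jacobi identity, and $\phi:V\to TX$ is an $\mathcal O_X$-linear homomorphism (the anchor map) with $\phi([s,t])=[\phi(s),\phi(t)]$ and $[s,ft]=f[s,t]+\phi(s)(f)\,t$ for local holomorphic sections $s,t$ of $V$ and local holomorphic functions $f$. Let $\phi^*:K_X\to V^*$ be the dual of $\phi$, $\mathcal Q:=V^*/\phi^*(K_X)$, $q:V^*\to\mathcal Q$ the quotient map, and $\mathcal Q_x:=\mathcal Q/\mathbf m_x\mathcal Q$ for $x\in X$, where $\mathbf m_x$ is the maximal ideal at $x$. Lie algebroid connection on a holomorphic vector bundle $E$: a first order holomorphic differential operator $D:E\to E\otimes V^*$ with $D(fs)=fD(s)+s\otimes\phi^*(df)$ for local holomorphic sections $s$ of $E$ and local holomorphic functions $f$. The map $\mathcal S_x$: for $x\in X$, $\mathcal S_x:E_x\to E_x\otimes\mathcal Q_x$ is the $\mathbb C$-linear map sending $v\in E_x$ to $((\mathrm{Id}_E\otimes q)(D(s)))(x)$, where $s$ is any holomorphic section of $E$ defined near $x$ with $s(x)=v$; this is independent of the choice of $s$.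 Parabolic vector bundle $E_*$ with parabolic structure over $S$: a holomorphic vector bundle $E$ together with, for each $x\in S$, a strictly decreasing filtration $E_x=E_x^1\supsetneq\cdots\supsetneq E_x^{\ell_x}\supsetneq E_x^{\ell_x+1}=0$ by subspaces and real numbers (weights) $0\le\alpha_1^x<\cdots<\alpha_{\ell_x}^x<1$. For $x\in S$ and $1\le i\le\ell_x+1$, $\mathcal E_{x,i}\subset E$ denotes the kernel of the natural map $E\to E_x/E_x^i$ (so $\mathcal E_{x,1}=E$ and $\mathcal E_{x,\ell_x+1}=E\otimes\mathcal O_X(-x)$). Quasi-parabolic Lie algebroid connection on $E_*$: a Lie algebroid connection $D:E\to E\otimes V^*$ on $E$ such that $D(\mathcal E_{x,i})\subset\mathcal E_{x,i}\otimes V^*$ for all $x\in S$ and all $1\le i\le\ell_x+1$. *)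

theory Defs
  imports
    "HOL-Complex_Analysis.Complex_Analysis"
    "HOL-Algebra.Algebraic_Closure_Type"
    "HOL-Library.Poly_Mapping"
begin

section \<open>Complex vector spaces, quotients, duals and tensor products\<close>

text \<open>Complex vector spaces are modules over the field of complex numbers in the sense of
  HOL-Algebra.  The components \<open>mult\<close> and \<open>one\<close>, which the record type of
  modules inherits from rings, carry no information.\<close>

abbreviation CC :: "complex ring"
  where "CC \<equiv> ring_of_type_algebra"

definition linear_maps :: "(complex, 'a) module \<Rightarrow> (complex, 'b) module \<Rightarrow> ('a \<Rightarrow> 'b) set"
  where "linear_maps M N = {h \<in> carrier M \<rightarrow> carrier N.
    (\<forall>u\<in>carrier M. \<forall>v\<in>carrier M. h (u \<oplus>\<^bsub>M\<^esub> v) = h u \<oplus>\<^bsub>N\<^esub> h v) \<and>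
    (\<forall>c. \<forall>u\<in>carrier M. h (c \<odot>\<^bsub>M\<^esub> u) = c \<odot>\<^bsub>N\<^esub> h u)}"

definition is_basis :: "(complex, 'a) module \<Rightarrow> nat \<Rightarrow> (nat \<Rightarrow> 'a) \<Rightarrow> bool"
  where "is_basis M n b \<longleftrightarrow> b \<in> {..<n} \<rightarrow> carrier M \<and>
    (\<forall>v\<in>carrier M. \<exists>!c. c \<in> extensional {..<n} \<and>
        v = finsum M (\<lambda>i. c i \<odot>\<^bsub>M\<^esub> b i) {..<n})"

definition mod_span :: "(complex, 'a) module \<Rightarrow> 'a set \<Rightarrow> 'a set"
  where "mod_span M G = \<Inter>{H. submodule H CC M \<and> G \<subseteq> H}"

definition quot_module :: "(complex, 'a) module \<Rightarrow> 'a set \<Rightarrow> (complex, 'a set) module"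
  where "quot_module M N =
    \<lparr>carrier = a_rcosets\<^bsub>M\<^esub> N, mult = undefined, one = undefined,
     ring.zero = N, add = set_add M,
     smult = (\<lambda>c A. \<Union>a\<in>A. N +>\<^bsub>M\<^esub> (c \<odot>\<^bsub>M\<^esub> a))\<rparr>"

text \<open>A functional on \<open>M\<close> is extended by 0 outside the carrier, so that equality of
  functionals is equality of functions.\<close>

definition dual :: "(complex, 'a) module \<Rightarrow> (complex, 'a \<Rightarrow> complex) module"
  where "dual M =
    \<lparr>carrier = {l. (\<forall>u. u \<notin> carrier M \<longrightarrow> l u = 0) \<and>
        (\<forall>u\<in>carrier M. \<forall>v\<in>carrier M. l (u \<oplus>\<^bsub>M\<^esub> v) = l u + l v) \<and>
        (\<forall>c. \<forall>u\<in>carrier M. l (c \<odot>\<^bsub>M\<^esub> u) = c * l u)},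
     mult = undefined, one = undefined,
     ring.zero = (\<lambda>_. 0), add = (\<lambda>l m u. l u + m u), smult = (\<lambda>c l u. c * l u)\<rparr>"

definition free_module :: "'a set \<Rightarrow> (complex, 'a \<Rightarrow>\<^sub>0 complex) module"
  where "free_module B =
    \<lparr>carrier = {p. Poly_Mapping.keys p \<subseteq> B}, mult = undefined, one = undefined,
     ring.zero = 0, add = (+), smult = (\<lambda>c. Poly_Mapping.map ((*) c))\<rparr>"

abbreviation gen :: "'a \<Rightarrow> 'b \<Rightarrow> ('a \<times> 'b) \<Rightarrow>\<^sub>0 complex"
  where "gen m n \<equiv> Poly_Mapping.single (m, n) 1"

text \<open>The tensor product over the complex numbers: the free vector space on pairs modulo the
  subspace generated by the bilinearity relations.\<close>

definition tensor_rels ::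
  "(complex, 'a) module \<Rightarrow> (complex, 'b) module \<Rightarrow> (('a \<times> 'b) \<Rightarrow>\<^sub>0 complex) set"
  where "tensor_rels M N = mod_span (free_module (carrier M \<times> carrier N))
    ({gen (m \<oplus>\<^bsub>M\<^esub> m') n - gen m n - gen m' n | m m' n.
        m \<in> carrier M \<and> m' \<in> carrier M \<and> n \<in> carrier N} \<union>
     {gen m (n \<oplus>\<^bsub>N\<^esub> n') - gen m n - gen m n' | m n n'.
        m \<in> carrier M \<and> n \<in> carrier N \<and> n' \<in> carrier N} \<union>
     {gen (c \<odot>\<^bsub>M\<^esub> m) n - Poly_Mapping.single (m, n) c | c m n.
        m \<in> carrier M \<and> n \<in> carrier N} \<union>
     {gen m (c \<odot>\<^bsub>N\<^esub> n) - Poly_Mapping.single (m, n) c | c m n.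
        m \<in> carrier M \<and> n \<in> carrier N})"

type_synonym ('a, 'b) tens = "(('a \<times> 'b) \<Rightarrow>\<^sub>0 complex) set"

definition tensor ::
  "(complex, 'a) module \<Rightarrow> (complex, 'b) module \<Rightarrow> (complex, ('a, 'b) tens) module"
  where "tensor M N = quot_module (free_module (carrier M \<times> carrier N)) (tensor_rels M N)"

definition pure ::
  "(complex, 'a) module \<Rightarrow> (complex, 'b) module \<Rightarrow> 'a \<Rightarrow> 'b \<Rightarrow> ('a, 'b) tens"
  where "pure M N m n =
    tensor_rels M N +>\<^bsub>free_module (carrier M \<times> carrier N)\<^esub> gen m n"

text \<open>For linear maps \<open>f\<close> and \<open>g\<close>, the map of tensor products induced by
  them, with values in the tensor product of \<open>M'\<close> and \<open>N'\<close>; for such maps the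
  result does not depend on the chosen representative \<open>u\<close>.\<close>

definition tensor_map ::
  "(complex, 'c) module \<Rightarrow> (complex, 'd) module \<Rightarrow> ('a \<Rightarrow> 'c) \<Rightarrow> ('b \<Rightarrow> 'd)
    \<Rightarrow> ('a, 'b) tens \<Rightarrow> ('c, 'd) tens"
  where "tensor_map M' N' f g T = (let u = (SOME u. u \<in> T) in
    finsum (tensor M' N')
      (\<lambda>(m, n). Poly_Mapping.lookup u (m, n) \<odot>\<^bsub>tensor M' N'\<^esub> pure M' N' (f m) (g n))
      (Poly_Mapping.keys u))"

text \<open>For a subspace \<open>H\<close> of \<open>M\<close>: the tensor product of \<open>H\<close> and
  \<open>N\<close>, viewed as a subspace of the tensor product of \<open>M\<close> and \<open>N\<close>.\<close>

definition sub_tensor ::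
  "(complex, 'a) module \<Rightarrow> (complex, 'b) module \<Rightarrow> 'a set \<Rightarrow> ('a, 'b) tens set"
  where "sub_tensor M N H = mod_span (tensor M N) {pure M N m n | m n. m \<in> H \<and> n \<in> carrier N}"


section \<open>Riemann surfaces\<close>

text \<open>A chart is a pair of an open domain and a coordinate function; the values of the
  coordinate function outside the domain are irrelevant.\<close>

type_synonym 'x chart = "'x set \<times> ('x \<Rightarrow> complex)"

definition chart_inv :: "'x chart \<Rightarrow> complex \<Rightarrow> 'x"
  where "chart_inv a = inv_into (fst a) (snd a)"

definition riemann_surface :: "'x::t2_space chart set \<Rightarrow> bool"
  where "riemann_surface A \<longleftrightarrow> connected (UNIV :: 'x set) \<and>
    (\<Union>a\<in>A. fst a) = UNIV \<and>
    (\<forall>a\<in>A. open (fst a) \<and> open (snd a ` fst a) \<and>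
        homeomorphism (fst a) (snd a ` fst a) (snd a) (chart_inv a)) \<and>
    (\<forall>a\<in>A. \<forall>b\<in>A. (snd b \<circ> chart_inv a) holomorphic_on (snd a ` (fst a \<inter> fst b)))"

definition compact_riemann_surface :: "'x::t2_space chart set \<Rightarrow> bool"
  where "compact_riemann_surface A \<longleftrightarrow> riemann_surface A \<and> compact (UNIV :: 'x set)"

definition charts_at :: "'x chart set \<Rightarrow> 'x \<Rightarrow> 'x chart set"
  where "charts_at A x = {a \<in> A. x \<in> fst a}"

definition hol_fun :: "'x chart set \<Rightarrow> 'x set \<Rightarrow> ('x \<Rightarrow> complex) \<Rightarrow> bool"
  where "hol_fun A U f \<longleftrightarrow>
    (\<forall>a\<in>A. (f \<circ> chart_inv a) holomorphic_on (snd a ` (U \<inter> fst a)))"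


section \<open>Holomorphic vector bundles\<close>

text \<open>A holomorphic vector bundle is a family of complex vector spaces with an atlas of local
  frames.  A member \<open>(U, e)\<close> of the atlas gives the basis \<open>e 0 x\<close>, ...,
  \<open>e (rk - 1) x\<close> of the fiber over each point \<open>x\<close> of \<open>U\<close>, that is, a
  trivialization over \<open>U\<close>; any two of them differ by a holomorphic matrix.  The rank is
  one number because all base spaces considered here are connected.\<close>

record ('x, 'e) vbundle =
  rk :: nat
  fib :: "'x \<Rightarrow> (complex, 'e) module"
  frames :: "('x set \<times> (nat \<Rightarrow> 'x \<Rightarrow> 'e)) set"

definition lin_comb :: "('x, 'e) vbundle \<Rightarrow> (nat \<Rightarrow> 'x \<Rightarrow> complex) \<Rightarrow> (nat \<Rightarrow> 'x \<Rightarrow> 'e) \<Rightarrow> nat \<Rightarrow> 'x \<Rightarrow> 'e"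
  where "lin_comb E c s n x = finsum (fib E x) (\<lambda>i. c i x \<odot>\<^bsub>fib E x\<^esub> s i x) {..<n}"

definition hol_bundle :: "'x::t2_space chart set \<Rightarrow> ('x, 'e) vbundle \<Rightarrow> bool"
  where "hol_bundle A E \<longleftrightarrow>
    (\<forall>x. Module.module CC (fib E x)) \<and>
    (\<Union>(U, e)\<in>frames E. U) = UNIV \<and>
    (\<forall>(U, e)\<in>frames E. open U \<and> (\<forall>x\<in>U. is_basis (fib E x) (rk E) (\<lambda>i. e i x))) \<and>
    (\<forall>(U, e)\<in>frames E. \<forall>(W, f)\<in>frames E. \<forall>j<rk E. \<exists>c.
        (\<forall>i<rk E. hol_fun A (U \<inter> W) (c i)) \<and>
        (\<forall>x\<in>U \<inter> W. f j x = lin_comb E c e (rk E) x))"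

text \<open>Holomorphic sections over \<open>U\<close>.  They are extensional on \<open>U\<close>, so that
  equality of sections is equality of functions.\<close>

definition sections :: "'x::t2_space chart set \<Rightarrow> ('x, 'e) vbundle \<Rightarrow> 'x set \<Rightarrow> ('x \<Rightarrow> 'e) set"
  where "sections A E U = {s \<in> extensional U. (\<forall>x\<in>U. s x \<in> carrier (fib E x)) \<and>
    (\<forall>(W, e)\<in>frames E. \<exists>c. (\<forall>i<rk E. hol_fun A (U \<inter> W) (c i)) \<and>
        (\<forall>x\<in>U \<inter> W. s x = lin_comb E c e (rk E) x))}"

definition sec_zero :: "('x, 'e) vbundle \<Rightarrow> 'x set \<Rightarrow> 'x \<Rightarrow> 'e"
  where "sec_zero E U = restrict (\<lambda>x. \<zero>\<^bsub>fib E x\<^esub>) U"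

definition sec_add :: "('x, 'e) vbundle \<Rightarrow> 'x set \<Rightarrow> ('x \<Rightarrow> 'e) \<Rightarrow> ('x \<Rightarrow> 'e) \<Rightarrow> 'x \<Rightarrow> 'e"
  where "sec_add E U s t = restrict (\<lambda>x. s x \<oplus>\<^bsub>fib E x\<^esub> t x) U"

definition sec_smult :: "('x, 'e) vbundle \<Rightarrow> 'x set \<Rightarrow> ('x \<Rightarrow> complex) \<Rightarrow> ('x \<Rightarrow> 'e) \<Rightarrow> 'x \<Rightarrow> 'e"
  where "sec_smult E U f s = restrict (\<lambda>x. f x \<odot>\<^bsub>fib E x\<^esub> s x) U"

definition dual_bundle :: "('x, 'e) vbundle \<Rightarrow> ('x, 'e \<Rightarrow> complex) vbundle"
  where "dual_bundle E =
    \<lparr>rk = rk E, fib = (\<lambda>x. dual (fib E x)),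
     frames = {(U, l). \<exists>e. (U, e) \<in> frames E \<and> (\<forall>x\<in>U. \<forall>i<rk E.
        l i x \<in> carrier (dual (fib E x)) \<and>
        (\<forall>j<rk E. l i x (e j x) = (if i = j then 1 else 0)))}\<rparr>"

definition tensor_bundle :: "('x, 'e) vbundle \<Rightarrow> ('x, 'f) vbundle \<Rightarrow> ('x, ('e, 'f) tens) vbundle"
  where "tensor_bundle E F =
    \<lparr>rk = rk E * rk F, fib = (\<lambda>x. tensor (fib E x) (fib F x)),
     frames = {(U \<inter> W, \<lambda>k x. pure (fib E x) (fib F x) (e (k div rk F) x) (f (k mod rk F) x))
        | U W e f. (U, e) \<in> frames E \<and> (W, f) \<in> frames F}\<rparr>"

text \<open>Homomorphisms of holomorphic vector bundles, i.e. O-linear homomorphisms of their sheaves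
  of sections.\<close>

definition bundle_hom ::
  "'x::t2_space chart set \<Rightarrow> ('x, 'e) vbundle \<Rightarrow> ('x, 'f) vbundle \<Rightarrow> ('x \<Rightarrow> 'e \<Rightarrow> 'f) \<Rightarrow> bool"
  where "bundle_hom A E F h \<longleftrightarrow> (\<forall>x. h x \<in> linear_maps (fib E x) (fib F x)) \<and>
    (\<forall>U. open U \<longrightarrow> (\<forall>s\<in>sections A E U. restrict (\<lambda>x. h x (s x)) U \<in> sections A F U))"


section \<open>Tangent and cotangent bundle\<close>

text \<open>A tangent vector at \<open>x\<close> assigns to each chart around \<open>x\<close> a complex
  number, its component with respect to the coordinate vector field of that chart; components in
  different charts are related by the derivative of the coordinate change.\<close>

definition tangent_space :: "'x chart set \<Rightarrow> 'x \<Rightarrow> (complex, 'x chart \<Rightarrow> complex) module"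
  where "tangent_space A x =
    \<lparr>carrier = {v. (\<forall>a. a \<notin> charts_at A x \<longrightarrow> v a = 0) \<and>
        (\<forall>a\<in>charts_at A x. \<forall>b\<in>charts_at A x.
            v b = deriv (snd b \<circ> chart_inv a) (snd a x) * v a)},
     mult = undefined, one = undefined,
     ring.zero = (\<lambda>_. 0), add = (\<lambda>v w a. v a + w a), smult = (\<lambda>c v a. c * v a)\<rparr>"

definition coord_field :: "'x chart set \<Rightarrow> 'x chart \<Rightarrow> 'x \<Rightarrow> 'x chart \<Rightarrow> complex"
  where "coord_field A a x b =
    (if b \<in> charts_at A x then deriv (snd b \<circ> chart_inv a) (snd a x) else 0)"

definition TX :: "'x chart set \<Rightarrow> ('x, 'x chart \<Rightarrow> complex) vbundle"
  where "TX A = \<lparr>rk = 1, fib = tangent_space A,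
    frames = {(fst a, \<lambda>_. coord_field A a) | a. a \<in> A}\<rparr>"

abbreviation KX :: "'x chart set \<Rightarrow> ('x, ('x chart \<Rightarrow> complex) \<Rightarrow> complex) vbundle"
  where "KX A \<equiv> dual_bundle (TX A)"

text \<open>The differential at \<open>x\<close> of a function that is holomorphic near \<open>x\<close>, as
  an element of the cotangent space; the chart used is immaterial.\<close>

definition differential ::
  "'x chart set \<Rightarrow> ('x \<Rightarrow> complex) \<Rightarrow> 'x \<Rightarrow> ('x chart \<Rightarrow> complex) \<Rightarrow> complex"
  where "differential A f x v = (if v \<in> carrier (tangent_space A x)
    then let a = (SOME a. a \<in> charts_at A x) in deriv (f \<circ> chart_inv a) (snd a x) * v a
    else 0)"

text \<open>The Lie bracket of vector fields: in each chart \<open>a\<close>, the component of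
  \<open>[\<xi>, \<eta>]\<close> is the derivative along \<open>\<xi>\<close> of the component of \<open>\<eta>\<close> minus
  the derivative along \<open>\<eta>\<close> of the component of \<open>\<xi>\<close>.\<close>

definition vf_bracket ::
  "'x chart set \<Rightarrow> 'x set \<Rightarrow> ('x \<Rightarrow> 'x chart \<Rightarrow> complex) \<Rightarrow> ('x \<Rightarrow> 'x chart \<Rightarrow> complex)
    \<Rightarrow> 'x \<Rightarrow> 'x chart \<Rightarrow> complex"
  where "vf_bracket A U \<xi> \<eta> = restrict (\<lambda>x a. if a \<in> charts_at A x
    then differential A (\<lambda>y. \<eta> y a) x (\<xi> x) - differential A (\<lambda>y. \<xi> y a) x (\<eta> x)
    else 0) U"


section \<open>Differential operators of first order\<close>

text \<open>The fiber at \<open>x\<close> of the first jet bundle of \<open>E\<close> is the stalk of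
  \<open>E\<close> modulo the square of the maximal ideal at \<open>x\<close>.  So the 1-jet of
  \<open>s\<close> at \<open>x\<close> vanishes iff near \<open>x\<close> the section \<open>s\<close> is a
  combination of holomorphic sections with coefficients in the square of that ideal.\<close>

definition jet1_zero ::
  "'x::t2_space chart set \<Rightarrow> ('x, 'e) vbundle \<Rightarrow> 'x \<Rightarrow> ('x \<Rightarrow> 'e) \<Rightarrow> bool"
  where "jet1_zero A E x s \<longleftrightarrow> (\<exists>W n f g t. open W \<and> x \<in> W \<and>
    (\<forall>k<n. hol_fun A W (f k) \<and> f k x = 0 \<and> hol_fun A W (g k) \<and> g k x = 0 \<and>
        t k \<in> sections A E W) \<and>
    (\<forall>y\<in>W. s y = lin_comb E (\<lambda>k y. f k y * g k y) t n y))"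

type_synonym ('x, 'e, 'f) sheaf_map = "'x set \<Rightarrow> ('x \<Rightarrow> 'e) \<Rightarrow> 'x \<Rightarrow> 'f"

definition sheaf_hom ::
  "'x::t2_space chart set \<Rightarrow> ('x, 'e) vbundle \<Rightarrow> ('x, 'f) vbundle \<Rightarrow> ('x, 'e, 'f) sheaf_map \<Rightarrow> bool"
  where "sheaf_hom A E F D \<longleftrightarrow> (\<forall>U. open U \<longrightarrow> (\<forall>s\<in>sections A E U.
      D U s \<in> sections A F U \<and>
      (\<forall>W. open W \<and> W \<subseteq> U \<longrightarrow> D W (restrict s W) = restrict (D U s) W) \<and>
      (\<forall>t\<in>sections A E U. D U (sec_add E U s t) = sec_add F U (D U s) (D U t)) \<and>
      (\<forall>c. D U (sec_smult E U (\<lambda>_. c) s) = sec_smult F U (\<lambda>_. c) (D U s))))"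

text \<open>A complex linear sheaf homomorphism comes from a homomorphism from the first jet bundle of
  \<open>E\<close> to \<open>F\<close> iff its values at a point depend only on 1-jets at that point
  (holomorphy is automatic, the jet bundle being locally generated by jets of sections).\<close>

definition first_order_operator ::
  "'x::t2_space chart set \<Rightarrow> ('x, 'e) vbundle \<Rightarrow> ('x, 'f) vbundle \<Rightarrow> ('x, 'e, 'f) sheaf_map \<Rightarrow> bool"
  where "first_order_operator A E F D \<longleftrightarrow> sheaf_hom A E F D \<and>
    (\<forall>U x. open U \<and> x \<in> U \<longrightarrow> (\<forall>s\<in>sections A E U.
        jet1_zero A E x s \<longrightarrow> D U s x = \<zero>\<^bsub>fib F x\<^esub>))"


section \<open>Lie algebroids\<close>

type_synonym ('x, 'v) pairing = "'x set \<Rightarrow> ('x \<Rightarrow> 'v) \<Rightarrow> ('x \<Rightarrow> 'v) \<Rightarrow> 'x \<Rightarrow> 'v"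
type_synonym ('x, 'v) anchor = "'x \<Rightarrow> 'v \<Rightarrow> 'x chart \<Rightarrow> complex"

definition sheaf_pairing ::
  "'x::t2_space chart set \<Rightarrow> ('x, 'v) vbundle \<Rightarrow> ('x, 'v) pairing \<Rightarrow> bool"
  where "sheaf_pairing A V br \<longleftrightarrow> (\<forall>U. open U \<longrightarrow>
    (\<forall>s\<in>sections A V U. \<forall>t\<in>sections A V U.
      br U s t \<in> sections A V U \<and>
      (\<forall>W. open W \<and> W \<subseteq> U \<longrightarrow>
          br W (restrict s W) (restrict t W) = restrict (br U s t) W) \<and>
      (\<forall>s'\<in>sections A V U. br U (sec_add V U s s') t = sec_add V U (br U s t) (br U s' t)) \<and>
      (\<forall>t'\<in>sections A V U. br U s (sec_add V U t t') = sec_add V U (br U s t) (br U s t')) \<and>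
      (\<forall>c. br U (sec_smult V U (\<lambda>_. c) s) t = sec_smult V U (\<lambda>_. c) (br U s t)) \<and>
      (\<forall>c. br U s (sec_smult V U (\<lambda>_. c) t) = sec_smult V U (\<lambda>_. c) (br U s t)) \<and>
      (\<forall>x\<in>U. jet1_zero A V x s \<or> jet1_zero A V x t \<longrightarrow> br U s t x = \<zero>\<^bsub>fib V x\<^esub>)))"

definition anchor_apply :: "('x, 'v) anchor \<Rightarrow> 'x set \<Rightarrow> ('x \<Rightarrow> 'v) \<Rightarrow> 'x \<Rightarrow> 'x chart \<Rightarrow> complex"
  where "anchor_apply \<phi> U s = restrict (\<lambda>x. \<phi> x (s x)) U"

definition lie_algebroid ::
  "'x::t2_space chart set \<Rightarrow> ('x, 'v) vbundle \<Rightarrow> ('x, 'v) pairing \<Rightarrow> ('x, 'v) anchor \<Rightarrow> bool"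
  where "lie_algebroid A V br \<phi> \<longleftrightarrow>
    hol_bundle A V \<and> sheaf_pairing A V br \<and> bundle_hom A V (TX A) \<phi> \<and>
    (\<forall>U. open U \<longrightarrow> (\<forall>s\<in>sections A V U. \<forall>t\<in>sections A V U.
      sec_add V U (br U s t) (br U t s) = sec_zero V U \<and>
      (\<forall>u\<in>sections A V U.
        sec_add V U (br U s (br U t u)) (sec_add V U (br U t (br U u s)) (br U u (br U s t)))
          = sec_zero V U) \<and>
      anchor_apply \<phi> U (br U s t) = vf_bracket A U (anchor_apply \<phi> U s) (anchor_apply \<phi> U t) \<and>
      (\<forall>f. hol_fun A U f \<longrightarrow>
        br U s (sec_smult V U f t) =
          sec_add V U (sec_smult V U f (br U s t))
            (sec_smult V U (\<lambda>x. differential A f x (\<phi> x (s x))) t))))"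

definition dual_anchor ::
  "('x, 'v) vbundle \<Rightarrow> ('x, 'v) anchor \<Rightarrow> 'x \<Rightarrow> (('x chart \<Rightarrow> complex) \<Rightarrow> complex) \<Rightarrow> 'v \<Rightarrow> complex"
  where "dual_anchor V \<phi> x \<omega> v = (if v \<in> carrier (fib V x) then \<omega> (\<phi> x v) else 0)"


section \<open>The sheaf Q and its fibers\<close>

text \<open>A germ at \<open>x\<close> is the set of all functions that agree near \<open>x\<close> with a
  given section.\<close>

definition germ :: "'x::t2_space \<Rightarrow> ('x \<Rightarrow> 'e) \<Rightarrow> ('x \<Rightarrow> 'e) set"
  where "germ x s = {t. \<forall>\<^sub>F y in nhds x. t y = s y}"

definition stalk ::
  "'x::t2_space chart set \<Rightarrow> ('x, 'e) vbundle \<Rightarrow> 'x \<Rightarrow> (complex, ('x \<Rightarrow> 'e) set) module"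
  where "stalk A E x =
    \<lparr>carrier = {germ x s | s U. open U \<and> x \<in> U \<and> s \<in> sections A E U},
     mult = undefined, one = undefined,
     ring.zero = germ x (\<lambda>y. \<zero>\<^bsub>fib E y\<^esub>),
     add = (\<lambda>g h. \<Union>s\<in>g. \<Union>t\<in>h. germ x (\<lambda>y. s y \<oplus>\<^bsub>fib E y\<^esub> t y)),
     smult = (\<lambda>c g. \<Union>s\<in>g. germ x (\<lambda>y. c \<odot>\<^bsub>fib E y\<^esub> s y))\<rparr>"

definition dual_anchor_image ::
  "'x::t2_space chart set \<Rightarrow> ('x, 'v) vbundle \<Rightarrow> ('x, 'v) anchor \<Rightarrow> 'x \<Rightarrow> ('x \<Rightarrow> 'v \<Rightarrow> complex) set set"
  where "dual_anchor_image A V \<phi> x =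
    {germ x (\<lambda>y. dual_anchor V \<phi> y (\<omega> y)) | \<omega> U. open U \<and> x \<in> U \<and> \<omega> \<in> sections A (KX A) U}"

definition Q_stalk ::
  "'x::t2_space chart set \<Rightarrow> ('x, 'v) vbundle \<Rightarrow> ('x, 'v) anchor \<Rightarrow> 'x
    \<Rightarrow> (complex, ('x \<Rightarrow> 'v \<Rightarrow> complex) set set) module"
  where "Q_stalk A V \<phi> x =
    quot_module (stalk A (dual_bundle V) x) (dual_anchor_image A V \<phi> x)"

definition q_stalk ::
  "'x::t2_space chart set \<Rightarrow> ('x, 'v) vbundle \<Rightarrow> ('x, 'v) anchor \<Rightarrow> 'x
    \<Rightarrow> ('x \<Rightarrow> 'v \<Rightarrow> complex) set \<Rightarrow> ('x \<Rightarrow> 'v \<Rightarrow> complex) set set"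
  where "q_stalk A V \<phi> x g = dual_anchor_image A V \<phi> x +>\<^bsub>stalk A (dual_bundle V) x\<^esub> g"

text \<open>The product of the maximal ideal at \<open>x\<close> and the stalk of Q.  By definition of the
  O-module structure on Q, the product of a germ \<open>f\<close> and the class of \<open>l\<close> is the
  class of \<open>f l\<close>.\<close>

definition mQ ::
  "'x::t2_space chart set \<Rightarrow> ('x, 'v) vbundle \<Rightarrow> ('x, 'v) anchor \<Rightarrow> 'x
    \<Rightarrow> ('x \<Rightarrow> 'v \<Rightarrow> complex) set set set"
  where "mQ A V \<phi> x = mod_span (Q_stalk A V \<phi> x)
    {q_stalk A V \<phi> x (germ x (sec_smult (dual_bundle V) U f l)) | U f l.
      open U \<and> x \<in> U \<and> hol_fun A U f \<and> f x = 0 \<and> l \<in> sections A (dual_bundle V) U}"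

definition Q_fiber ::
  "'x::t2_space chart set \<Rightarrow> ('x, 'v) vbundle \<Rightarrow> ('x, 'v) anchor \<Rightarrow> 'x
    \<Rightarrow> (complex, ('x \<Rightarrow> 'v \<Rightarrow> complex) set set set) module"
  where "Q_fiber A V \<phi> x = quot_module (Q_stalk A V \<phi> x) (mQ A V \<phi> x)"

text \<open>The map induced by the quotient map q from the fiber at \<open>x\<close> of the dual of
  \<open>V\<close> to that of Q: extend to a local section, apply q, and take the class modulo
  the maximal ideal.\<close>

definition q_fiber ::
  "'x::t2_space chart set \<Rightarrow> ('x, 'v) vbundle \<Rightarrow> ('x, 'v) anchor \<Rightarrow> 'x
    \<Rightarrow> ('v \<Rightarrow> complex) \<Rightarrow> ('x \<Rightarrow> 'v \<Rightarrow> complex) set set set"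
  where "q_fiber A V \<phi> x l = (THE w. \<exists>U \<sigma>. open U \<and> x \<in> U \<and>
    \<sigma> \<in> sections A (dual_bundle V) U \<and> \<sigma> x = l \<and>
    w = mQ A V \<phi> x +>\<^bsub>Q_stalk A V \<phi> x\<^esub> q_stalk A V \<phi> x (germ x \<sigma>))"


section \<open>Lie algebroid connections\<close>

definition lie_algebroid_connection ::
  "'x::t2_space chart set \<Rightarrow> ('x, 'v) vbundle \<Rightarrow> ('x, 'v) anchor \<Rightarrow> ('x, 'e) vbundle
    \<Rightarrow> ('x, 'e, ('e, 'v \<Rightarrow> complex) tens) sheaf_map \<Rightarrow> bool"
  where "lie_algebroid_connection A V \<phi> E D \<longleftrightarrow>
    first_order_operator A E (tensor_bundle E (dual_bundle V)) D \<and>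
    (\<forall>U s f. open U \<and> s \<in> sections A E U \<and> hol_fun A U f \<longrightarrow>
      D U (sec_smult E U f s) =
        sec_add (tensor_bundle E (dual_bundle V)) U
          (sec_smult (tensor_bundle E (dual_bundle V)) U f (D U s))
          (restrict (\<lambda>x. pure (fib E x) (dual (fib V x)) (s x)
              (dual_anchor V \<phi> x (differential A f x))) U))"

definition S_map ::
  "'x::t2_space chart set \<Rightarrow> ('x, 'v) vbundle \<Rightarrow> ('x, 'v) anchor \<Rightarrow> ('x, 'e) vbundle
    \<Rightarrow> ('x, 'e, ('e, 'v \<Rightarrow> complex) tens) sheaf_map \<Rightarrow> 'x \<Rightarrow> 'e
    \<Rightarrow> ('e, ('x \<Rightarrow> 'v \<Rightarrow> complex) set set set) tens"
  where "S_map A V \<phi> E D x v = (THE w. \<exists>U s. open U \<and> x \<in> U \<and> s \<in> sections A E U \<and> s x = v \<and>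
    w = tensor_map (fib E x) (Q_fiber A V \<phi> x) id (q_fiber A V \<phi> x) (D U s x))"


section \<open>Parabolic bundles and quasi-parabolic connections\<close>

text \<open>Indices of filtrations and weights start from 1, as usual for parabolic bundles.\<close>

record ('x, 'e) parabolic =
  len :: "'x \<Rightarrow> nat"
  fil :: "'x \<Rightarrow> nat \<Rightarrow> 'e set"
  wt :: "'x \<Rightarrow> nat \<Rightarrow> real"

definition parabolic_structure ::
  "'x set \<Rightarrow> ('x, 'e) vbundle \<Rightarrow> ('x, 'e) parabolic \<Rightarrow> bool"
  where "parabolic_structure S E P \<longleftrightarrow> (\<forall>x\<in>S.
    fil P x 1 = carrier (fib E x) \<and> fil P x (len P x + 1) = {\<zero>\<^bsub>fib E x\<^esub>} \<and>
    (\<forall>i\<in>{1..len P x + 1}. submodule (fil P x i) CC (fib E x)) \<and>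
    (\<forall>i\<in>{1..len P x}. fil P x (i + 1) \<subset> fil P x i) \<and>
    (\<forall>i\<in>{1..len P x}. 0 \<le> wt P x i \<and> wt P x i < 1) \<and>
    strict_mono_on {1..len P x} (wt P x))"

text \<open>The sections over \<open>U\<close> of the kernel of the map from \<open>E\<close> to the skyscraper
  sheaf given by the quotient of the fiber at \<open>x\<close> by the \<open>i\<close>-th filtration step.\<close>

definition fil_sections ::
  "'x::t2_space chart set \<Rightarrow> ('x, 'e) vbundle \<Rightarrow> ('x, 'e) parabolic \<Rightarrow> 'x \<Rightarrow> nat \<Rightarrow> 'x set
    \<Rightarrow> ('x \<Rightarrow> 'e) set"
  where "fil_sections A E P x i U = {s \<in> sections A E U. x \<in> U \<longrightarrow> s x \<in> fil P x i}"

text \<open>For a subsheaf of \<open>E\<close> with sections \<open>G U\<close>: the sections over \<open>U\<close>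
  of its tensor product with \<open>F\<close>, as a subsheaf of the tensor product of \<open>E\<close> and
  \<open>F\<close>.\<close>

definition subsheaf_tensor ::
  "'x::t2_space chart set \<Rightarrow> ('x, 'e) vbundle \<Rightarrow> ('x, 'f) vbundle \<Rightarrow> ('x set \<Rightarrow> ('x \<Rightarrow> 'e) set)
    \<Rightarrow> 'x set \<Rightarrow> ('x \<Rightarrow> ('e, 'f) tens) set"
  where "subsheaf_tensor A E F G U = {t \<in> sections A (tensor_bundle E F) U.
    \<forall>y\<in>U. \<exists>W n s l. open W \<and> y \<in> W \<and> W \<subseteq> U \<and>
      (\<forall>k<n. s k \<in> G W \<and> l k \<in> sections A F W) \<and>
      (\<forall>z\<in>W. t z = finsum (tensor (fib E z) (fib F z))
          (\<lambda>k. pure (fib E z) (fib F z) (s k z) (l k z)) {..<(n::nat)})}"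

definition quasi_parabolic_connection ::
  "'x::t2_space chart set \<Rightarrow> 'x set \<Rightarrow> ('x, 'v) vbundle \<Rightarrow> ('x, 'v) anchor \<Rightarrow> ('x, 'e) vbundle
    \<Rightarrow> ('x, 'e) parabolic \<Rightarrow> ('x, 'e, ('e, 'v \<Rightarrow> complex) tens) sheaf_map \<Rightarrow> bool"
  where "quasi_parabolic_connection A S V \<phi> E P D \<longleftrightarrow>
    lie_algebroid_connection A V \<phi> E D \<and>
    (\<forall>x\<in>S. \<forall>i\<in>{1..len P x + 1}. \<forall>U. open U \<longrightarrow>
      D U ` fil_sections A E P x i U
        \<subseteq> subsheaf_tensor A E (dual_bundle V) (fil_sections A E P x i) U)"

end

theory Submission
  imports Defs
begin

text \<open>On a local frame \<open>e\<close> of \<open>E\<close> the Leibniz rule gives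
  \<open>D (\<Sum> c\<^sub>i e\<^sub>i) = \<Sum> c\<^sub>i D e\<^sub>i + e\<^sub>i \<otimes> \<phi>\<^sup>*(dc\<^sub>i)\<close>, and \<open>q\<close> kills the second summands;
  so \<open>(id \<otimes> q)(D s)(x)\<close> depends only on \<open>s x\<close>.

  If \<open>D\<close> preserves the subsheaves, condition (1) is evaluation at \<open>x\<close>, and applying \<open>D\<close> to
  \<open>z e\<^sub>0\<close> with a coordinate \<open>z\<close> centred at \<open>x\<close> gives \<open>e\<^sub>0 \<otimes> \<phi>\<^sup>*(dz) = 0\<close> at \<open>x\<close>, because
  the last step of the filtration is 0; this is condition (2).

  Conversely, write \<open>D s = \<Sum> s\<^sub>j \<otimes> l\<^sub>j\<close> near \<open>x\<close> for a local frame \<open>l\<close> of the dual of \<open>V\<close>.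
  By (2), evaluation at a vector of the fiber of \<open>V\<close> descends to the fiber of \<open>Q\<close> at \<open>x\<close>;
  contracting \<open>(id \<otimes> q)(D s)(x)\<close> with the basis of the fiber of \<open>V\<close> dual to \<open>l\<close> and using (1),
  each \<open>s\<^sub>j\<close> takes a value in the given step of the filtration at \<open>x\<close>.\<close>

subsection \<open>Vector spaces\<close>

text \<open>Taking fibers is right exact, so the fiber of Q at x is the cokernel of the dual anchor
  at x. Condition (2) makes the map onto it from the dual of the fiber of V an isomorphism, and only
  then does S_x retain all of D s at x; the converse turns on this. The isomorphism itself is never
  built: recovering one coefficient of a tensor takes one functional on the fiber of Q, and such a
  functional arises from evaluation of germs by two descents, one for each quotient. Tensors are
  decomposed over a frame in the second factor because the first factors are then determined by the
  tensor, so the decomposition at hand is already the required one.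

  Most of the work is well-definedness. \<open>S_map\<close> and \<open>q_fiber\<close> are definite
  descriptions over all local extensions, \<open>tensor_map\<close> chooses a representative, and
  the operations on stalks and the scaling of cosets are unions over representatives; each has to be
  shown independent of the choice before it can be computed. Holomorphic extensions of single
  vectors and covectors, with constant coefficients in a frame or a coordinate, supply
  existence.\<close>

abbreviation vspace :: "(complex, 'a) module \<Rightarrow> bool"
  where "vspace M \<equiv> Module.module CC M"

lemma CC_simps [simp]:
  "carrier CC = UNIV" "\<zero>\<^bsub>CC\<^esub> = 0" "\<one>\<^bsub>CC\<^esub> = 1" "x \<oplus>\<^bsub>CC\<^esub> y = x + y" "x \<otimes>\<^bsub>CC\<^esub> y = x * y"
  by (simp_all add: ring_of_type_algebra_def)

text \<open>Additive inverses need not be supplied: (-1) u is one, by distributivity and the laws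
  for the scalars 0 and 1.\<close>

lemma vspaceI:
  fixes M (structure)
  assumes "\<And>u v. u \<in> carrier M \<Longrightarrow> v \<in> carrier M \<Longrightarrow> u \<oplus> v \<in> carrier M"
    and "\<zero> \<in> carrier M"
    and "\<And>c u. u \<in> carrier M \<Longrightarrow> c \<odot>\<^bsub>M\<^esub> u \<in> carrier M"
    and "\<And>u v w. u \<in> carrier M \<Longrightarrow> v \<in> carrier M \<Longrightarrow> w \<in> carrier M \<Longrightarrow>
      (u \<oplus> v) \<oplus> w = u \<oplus> (v \<oplus> w)"
    and "\<And>u v. u \<in> carrier M \<Longrightarrow> v \<in> carrier M \<Longrightarrow> u \<oplus> v = v \<oplus> u"
    and "\<And>u. u \<in> carrier M \<Longrightarrow> \<zero> \<oplus> u = u"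
    and null: "\<And>u. u \<in> carrier M \<Longrightarrow> (0::complex) \<odot>\<^bsub>M\<^esub> u = \<zero>"
    and one: "\<And>u. u \<in> carrier M \<Longrightarrow> 1 \<odot>\<^bsub>M\<^esub> u = u"
    and distr: "\<And>c d u. u \<in> carrier M \<Longrightarrow> (c + d) \<odot>\<^bsub>M\<^esub> u = c \<odot>\<^bsub>M\<^esub> u \<oplus> d \<odot>\<^bsub>M\<^esub> u"
    and "\<And>c u v. u \<in> carrier M \<Longrightarrow> v \<in> carrier M \<Longrightarrow>
      c \<odot>\<^bsub>M\<^esub> (u \<oplus> v) = c \<odot>\<^bsub>M\<^esub> u \<oplus> c \<odot>\<^bsub>M\<^esub> v"
    and "\<And>c d u. u \<in> carrier M \<Longrightarrow> (c * d) \<odot>\<^bsub>M\<^esub> u = c \<odot>\<^bsub>M\<^esub> (d \<odot>\<^bsub>M\<^esub> u)"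
  shows "vspace M"
proof (rule moduleI)
  show "abelian_group M"
  proof (rule abelian_groupI)
    fix u assume u: "u \<in> carrier M"
    have "(-1) \<odot>\<^bsub>M\<^esub> u \<oplus> u = \<zero>"
      using distr[OF u, of "-1" 1] null[OF u] one[OF u] by simp
    then show "\<exists>v\<in>carrier M. v \<oplus> u = \<zero>" using assms(3)[OF u] by blast
  qed (use assms in auto)
qed (use assms cring_from_type_algebra in auto)

lemma
  assumes "vspace M" "u \<in> carrier M"
  shows vspace_null: "0 \<odot>\<^bsub>M\<^esub> u = \<zero>\<^bsub>M\<^esub>"
    and vspace_one: "1 \<odot>\<^bsub>M\<^esub> u = u"
    and vspace_smult_closed: "c \<odot>\<^bsub>M\<^esub> u \<in> carrier M"
    and vspace_distr: "(c + d) \<odot>\<^bsub>M\<^esub> u = c \<odot>\<^bsub>M\<^esub> u \<oplus>\<^bsub>M\<^esub> d \<odot>\<^bsub>M\<^esub> u"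
    and vspace_assoc: "(c * d) \<odot>\<^bsub>M\<^esub> u = c \<odot>\<^bsub>M\<^esub> (d \<odot>\<^bsub>M\<^esub> u)"
proof -
  interpret Module.module CC M by fact
  show "0 \<odot>\<^bsub>M\<^esub> u = \<zero>\<^bsub>M\<^esub>" "1 \<odot>\<^bsub>M\<^esub> u = u" "c \<odot>\<^bsub>M\<^esub> u \<in> carrier M"
    "(c + d) \<odot>\<^bsub>M\<^esub> u = c \<odot>\<^bsub>M\<^esub> u \<oplus>\<^bsub>M\<^esub> d \<odot>\<^bsub>M\<^esub> u" "(c * d) \<odot>\<^bsub>M\<^esub> u = c \<odot>\<^bsub>M\<^esub> (d \<odot>\<^bsub>M\<^esub> u)"
    using smult_l_null[OF assms(2)] smult_one[OF assms(2)] smult_l_distr[of c d, OF _ _ assms(2)]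
      smult_assoc1[of c d, OF _ _ assms(2)] assms(2) by simp_all
qed

text \<open>Closure under negation comes for free, since the negative of u is (-1) u.\<close>

lemma submodule_iff:
  assumes "vspace M"
  shows "submodule H CC M \<longleftrightarrow> H \<subseteq> carrier M \<and> \<zero>\<^bsub>M\<^esub> \<in> H \<and>
    (\<forall>u\<in>H. \<forall>v\<in>H. u \<oplus>\<^bsub>M\<^esub> v \<in> H) \<and> (\<forall>c. \<forall>u\<in>H. c \<odot>\<^bsub>M\<^esub> u \<in> H)"
proof -
  interpret Module.module CC M by fact
  have neg: "\<ominus>\<^bsub>M\<^esub> u = (-1) \<odot>\<^bsub>M\<^esub> u" if "u \<in> carrier M" for u
  proof -
    have "(-1) \<odot>\<^bsub>M\<^esub> u \<oplus>\<^bsub>M\<^esub> u = \<zero>\<^bsub>M\<^esub>"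
      using smult_l_distr[of "-1" 1 u] that smult_one[OF that] smult_l_null[OF that] by simp
    then show ?thesis using that by (simp add: M.minus_equality)
  qed
  show ?thesis
  proof
    assume H: "submodule H CC M"
    have "\<zero>\<^bsub>M\<^esub> \<in> H"
      using H unfolding submodule_def by (metis subgroup.one_closed monoid.simps(2))
    then show "H \<subseteq> carrier M \<and> \<zero>\<^bsub>M\<^esub> \<in> H \<and>
      (\<forall>u\<in>H. \<forall>v\<in>H. u \<oplus>\<^bsub>M\<^esub> v \<in> H) \<and> (\<forall>c. \<forall>u\<in>H. c \<odot>\<^bsub>M\<^esub> u \<in> H)"
      using submoduleE[OF H] by auto
  next
    assume H: "H \<subseteq> carrier M \<and> \<zero>\<^bsub>M\<^esub> \<in> H \<and>
      (\<forall>u\<in>H. \<forall>v\<in>H. u \<oplus>\<^bsub>M\<^esub> v \<in> H) \<and> (\<forall>c. \<forall>u\<in>H. c \<odot>\<^bsub>M\<^esub> u \<in> H)"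
    then show "submodule H CC M" by (intro submoduleI) (auto simp: neg subset_iff)
  qed
qed

lemma
  assumes "submodule H CC M" "vspace M"
  shows submodule_subset: "H \<subseteq> carrier M"
    and submodule_zero: "\<zero>\<^bsub>M\<^esub> \<in> H"
    and submodule_add: "u \<in> H \<Longrightarrow> v \<in> H \<Longrightarrow> u \<oplus>\<^bsub>M\<^esub> v \<in> H"
    and submodule_smult: "u \<in> H \<Longrightarrow> c \<odot>\<^bsub>M\<^esub> u \<in> H"
  using assms submodule_iff[of M H] by auto

lemma submodule_finsum:
  assumes "submodule H CC M" "vspace M" "finite I" "\<And>i. i \<in> I \<Longrightarrow> f i \<in> H"
  shows "finsum M f I \<in> H"
  using assms(3,4)
proof (induction I rule: finite_induct)
  case empty
  interpret Module.module CC M by fact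
  show ?case by (simp add: submodule_zero[OF assms(1,2)])
next
  case (insert i I)
  interpret Module.module CC M by fact
  have "f \<in> insert i I \<rightarrow> carrier M"
    using insert.prems submodule_subset[OF assms(1,2)] by blast
  then show ?case
    using insert by (simp add: submodule_add[OF assms(1,2)] Pi_def)
qed

lemma finsum_one: "vspace M \<Longrightarrow> f 0 \<in> carrier M \<Longrightarrow> finsum M f {..<(1::nat)} = f 0"
proof -
  assume M: "vspace M" and f: "f 0 \<in> carrier M"
  interpret M: Module.module CC M by (rule M)
  have "finsum M f {0::nat} = f 0" using M.finsum_insert[of "{}" "0::nat" f] f by simp
  then show ?thesis by (simp add: lessThan_Suc)
qed

subsection \<open>Linear maps\<close>

lemma linear_mapsI:
  assumes "\<And>u. u \<in> carrier M \<Longrightarrow> h u \<in> carrier N"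
    and "\<And>u v. u \<in> carrier M \<Longrightarrow> v \<in> carrier M \<Longrightarrow> h (u \<oplus>\<^bsub>M\<^esub> v) = h u \<oplus>\<^bsub>N\<^esub> h v"
    and "\<And>c u. u \<in> carrier M \<Longrightarrow> h (c \<odot>\<^bsub>M\<^esub> u) = c \<odot>\<^bsub>N\<^esub> h u"
  shows "h \<in> linear_maps M N"
  using assms by (auto simp: linear_maps_def)

lemma
  assumes "h \<in> linear_maps M N"
  shows linear_closed: "u \<in> carrier M \<Longrightarrow> h u \<in> carrier N"
    and linear_add: "u \<in> carrier M \<Longrightarrow> v \<in> carrier M \<Longrightarrow> h (u \<oplus>\<^bsub>M\<^esub> v) = h u \<oplus>\<^bsub>N\<^esub> h v"
    and linear_smult: "u \<in> carrier M \<Longrightarrow> h (c \<odot>\<^bsub>M\<^esub> u) = c \<odot>\<^bsub>N\<^esub> h u"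
  using assms by (auto simp: linear_maps_def)

lemma linear_zero:
  assumes "h \<in> linear_maps M N" "vspace M" "vspace N"
  shows "h \<zero>\<^bsub>M\<^esub> = \<zero>\<^bsub>N\<^esub>"
proof -
  interpret M: Module.module CC M by fact
  interpret N: Module.module CC N by fact
  have "h (0 \<odot>\<^bsub>M\<^esub> \<zero>\<^bsub>M\<^esub>) = 0 \<odot>\<^bsub>N\<^esub> h \<zero>\<^bsub>M\<^esub>"
    using linear_smult[OF assms(1)] M.zero_closed by blast
  then show ?thesis
    using M.smult_l_null[of "\<zero>\<^bsub>M\<^esub>"] N.smult_l_null[of "h \<zero>\<^bsub>M\<^esub>"] linear_closed[OF assms(1)] by simp
qed

lemma linear_finsum:
  assumes h: "h \<in> linear_maps M N" "vspace M" "vspace N" and f: "f \<in> I \<rightarrow> carrier M"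
    and "finite I"
  shows "h (finsum M f I) = finsum N (\<lambda>i. h (f i)) I"
  using \<open>finite I\<close> f
proof (induction I rule: finite_induct)
  case empty
  interpret M: Module.module CC M by fact
  interpret N: Module.module CC N by fact
  show ?case by (simp add: linear_zero[OF h])
next
  case (insert i I)
  interpret M: Module.module CC M by fact
  interpret N: Module.module CC N by fact
  have "(\<lambda>i. h (f i)) \<in> insert i I \<rightarrow> carrier N" using insert.prems linear_closed[OF h(1)] by auto
  then show ?case
    using insert by (simp add: linear_add[OF h(1)] Pi_def)
qed

lemma id_linear: "id \<in> linear_maps M M"
  by (rule linear_mapsI) simp_all

lemma linear_comp:
  "h \<in> linear_maps M N \<Longrightarrow> k \<in> linear_maps N L \<Longrightarrow> (\<lambda>u. k (h u)) \<in> linear_maps M L"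
  by (rule linear_mapsI) (simp_all add: linear_closed linear_add linear_smult)

subsection \<open>Spans\<close>

lemma mod_span_submodule:
  assumes "vspace M" "G \<subseteq> carrier M"
  shows "submodule (mod_span M G) CC M"
proof -
  interpret Module.module CC M by fact
  have "submodule (carrier M) CC M" by (rule carrier_is_submodule)
  then show ?thesis
    using assms(2) unfolding submodule_iff[OF assms(1)] mod_span_def by blast
qed

lemma mod_span_superset: "G \<subseteq> mod_span M G"
  by (auto simp: mod_span_def)

text \<open>The preimage of H is a subspace containing G, hence contains the span. With H the zero
  subspace this shows that a map kills a span once it kills the generators.\<close>

lemma mod_span_image:
  assumes h: "h \<in> linear_maps M N" "vspace M" "vspace N" and "G \<subseteq> carrier M"
    and H: "submodule H CC N" and hG: "\<And>g. g \<in> G \<Longrightarrow> h g \<in> H"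
    and u: "u \<in> mod_span M G"
  shows "h u \<in> H"
proof -
  interpret M: Module.module CC M by fact
  have "submodule {u \<in> carrier M. h u \<in> H} CC M"
    using H linear_zero[OF h] unfolding submodule_iff[OF h(2)] submodule_iff[OF h(3)]
    by (auto simp: linear_add[OF h(1)] linear_smult[OF h(1)])
  then have "mod_span M G \<subseteq> {u \<in> carrier M. h u \<in> H}"
    using assms(4) hG by (auto simp: mod_span_def)
  then show ?thesis using u by blast
qed

lemma zero_submodule:
  assumes "vspace M"
  shows "submodule {\<zero>\<^bsub>M\<^esub>} CC M"
proof -
  interpret Module.module CC M by fact
  show ?thesis by (simp add: submodule_iff[OF assms])
qed

subsection \<open>Quotients\<close>

lemma submodule_abelian_subgroup:
  assumes "vspace M" "submodule N CC M"
  shows "abelian_subgroup N M"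
proof -
  interpret Module.module CC M by fact
  show ?thesis
    using assms(2) by (intro abelian_subgroupI3 additive_subgroup.intro)
      (auto simp: submodule_def M.abelian_group_axioms)
qed

text \<open>The induced map on a quotient, computed at a chosen representative of the coset; it is
  meaningful only for h that vanish on the subspace. The choice is the one built into
  \<open>tensor_map\<close>.\<close>

definition quot_lift :: "('a \<Rightarrow> 'b) \<Rightarrow> 'a set \<Rightarrow> 'b"
  where "quot_lift h T = h (SOME u. u \<in> T)"

locale quotient =
  fixes M :: "(complex, 'a) module" and N
  assumes M: "vspace M" and N: "submodule N CC M"
begin

sublocale M: Module.module CC M by (rule M)
sublocale abelian_subgroup N M by (rule submodule_abelian_subgroup[OF M N])

lemma carrier_quot: "carrier (quot_module M N) = {N +>\<^bsub>M\<^esub> u |u. u \<in> carrier M}"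
  by (auto simp: quot_module_def A_RCOSETS_def' )

lemma coset_closed: "u \<in> carrier M \<Longrightarrow> N +>\<^bsub>M\<^esub> u \<in> carrier (quot_module M N)"
  by (auto simp: carrier_quot)

lemma coset_cases:
  assumes "w \<in> carrier (quot_module M N)"
  obtains u where "u \<in> carrier M" "w = N +>\<^bsub>M\<^esub> u"
  using assms by (auto simp: carrier_quot)

lemma coset_eq:
  assumes "u \<in> carrier M" "v \<in> N +>\<^bsub>M\<^esub> u"
  shows "v \<in> carrier M" "\<exists>n\<in>N. v = n \<oplus>\<^bsub>M\<^esub> u" "N +>\<^bsub>M\<^esub> v = N +>\<^bsub>M\<^esub> u"
  using assms a_elemrcos_carrier a_repr_independence'[OF assms(2,1)]
  by (auto simp: a_r_coset_def')

lemma self_in_coset: "u \<in> carrier M \<Longrightarrow> u \<in> N +>\<^bsub>M\<^esub> u"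
  by (rule a_rcos_self)

lemma coset_add:
  "u \<in> carrier M \<Longrightarrow> v \<in> carrier M \<Longrightarrow>
    (N +>\<^bsub>M\<^esub> u) \<oplus>\<^bsub>quot_module M N\<^esub> (N +>\<^bsub>M\<^esub> v) = N +>\<^bsub>M\<^esub> (u \<oplus>\<^bsub>M\<^esub> v)"
  by (simp add: quot_module_def a_rcos_sum)

text \<open>Scaling in \<open>quot_module\<close> is a union over all representatives.
  Representatives differ by elements of N, which is stable under scaling, so every member of the
  union is the same coset.\<close>

lemma coset_smult:
  assumes u: "u \<in> carrier M"
  shows "c \<odot>\<^bsub>quot_module M N\<^esub> (N +>\<^bsub>M\<^esub> u) = N +>\<^bsub>M\<^esub> (c \<odot>\<^bsub>M\<^esub> u)"
proof -
  have "N +>\<^bsub>M\<^esub> (c \<odot>\<^bsub>M\<^esub> v) = N +>\<^bsub>M\<^esub> (c \<odot>\<^bsub>M\<^esub> u)" if v: "v \<in> N +>\<^bsub>M\<^esub> u" for v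
  proof -
    obtain n where n: "n \<in> N" "v = n \<oplus>\<^bsub>M\<^esub> u" using coset_eq(2)[OF u v] by blast
    then have "n \<in> carrier M" using submodule_subset[OF N M] by blast
    then have "c \<odot>\<^bsub>M\<^esub> v = (c \<odot>\<^bsub>M\<^esub> n) \<oplus>\<^bsub>M\<^esub> (c \<odot>\<^bsub>M\<^esub> u)" using n u by (simp add: M.smult_r_distr)
    then have "c \<odot>\<^bsub>M\<^esub> v \<in> N +>\<^bsub>M\<^esub> (c \<odot>\<^bsub>M\<^esub> u)"
      using submodule_smult[OF N M n(1)] by (auto simp: a_r_coset_def')
    then show ?thesis using coset_eq(3)[of "c \<odot>\<^bsub>M\<^esub> u"] u by simp
  qed
  then have "(\<Union>v\<in>N +>\<^bsub>M\<^esub> u. N +>\<^bsub>M\<^esub> (c \<odot>\<^bsub>M\<^esub> v)) = N +>\<^bsub>M\<^esub> (c \<odot>\<^bsub>M\<^esub> u)"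
    using self_in_coset[OF u] by blast
  then show ?thesis by (simp add: quot_module_def)
qed

lemma coset_eq_self: "n \<in> N \<Longrightarrow> N +>\<^bsub>M\<^esub> n = N"
  by (rule a_rcos_const)

lemma zero_quot: "\<zero>\<^bsub>quot_module M N\<^esub> = N +>\<^bsub>M\<^esub> \<zero>\<^bsub>M\<^esub>"
  using coset_eq_self[OF submodule_zero[OF N M]] by (simp add: quot_module_def)

lemma vspace_quot: "vspace (quot_module M N)"
  by (rule vspaceI; (elim coset_cases)?; simp add: coset_closed coset_add coset_smult zero_quot
      M.a_assoc M.smult_r_distr vspace_null[OF M] vspace_one[OF M] vspace_distr[OF M]
      vspace_assoc[OF M]; simp add: M.a_comm)

lemma proj_linear: "(\<lambda>u. N +>\<^bsub>M\<^esub> u) \<in> linear_maps M (quot_module M N)"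
  by (rule linear_mapsI) (auto simp: carrier_quot coset_add coset_smult)

end

context quotient
begin

text \<open>The chosen representative differs from u by an element of N, which h kills.\<close>

lemma quot_lift_coset:
  assumes h: "h \<in> linear_maps M P" "vspace P" and hN: "\<And>n. n \<in> N \<Longrightarrow> h n = \<zero>\<^bsub>P\<^esub>"
    and u: "u \<in> carrier M"
  shows "quot_lift h (N +>\<^bsub>M\<^esub> u) = h u"
proof -
  interpret P: Module.module CC P by fact
  define v where "v = (SOME v. v \<in> N +>\<^bsub>M\<^esub> u)"
  have "v \<in> N +>\<^bsub>M\<^esub> u" unfolding v_def using self_in_coset[OF u] by (rule someI)
  then obtain n where n: "n \<in> N" "v = n \<oplus>\<^bsub>M\<^esub> u" using coset_eq(2)[OF u] by blast
  then have "n \<in> carrier M" using submodule_subset[OF N M] by blast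
  then have "h v = h u"
    using n u hN linear_closed[OF h(1) u] by (simp add: linear_add[OF h(1)])
  then show ?thesis by (simp add: quot_lift_def v_def)
qed

lemma quot_lift_linear:
  assumes h: "h \<in> linear_maps M P" "vspace P" and hN: "\<And>n. n \<in> N \<Longrightarrow> h n = \<zero>\<^bsub>P\<^esub>"
  shows "quot_lift h \<in> linear_maps (quot_module M N) P"
  by (rule linear_mapsI; elim coset_cases)
    (simp_all add: coset_add coset_smult quot_lift_coset[OF assms]
      linear_closed[OF h(1)] linear_add[OF h(1)] linear_smult[OF h(1)])

end

subsection \<open>Free vector spaces and tensor products\<close>

lemma lookup_scale: "Poly_Mapping.lookup (Poly_Mapping.map ((*) c) p) b = c * Poly_Mapping.lookup p b"
  for c :: complex
  by (simp add: Poly_Mapping.map.rep_eq when_def)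

lemma free_simps:
  "\<zero>\<^bsub>free_module B\<^esub> = 0" "u \<oplus>\<^bsub>free_module B\<^esub> v = u + v"
  "c \<odot>\<^bsub>free_module B\<^esub> u = Poly_Mapping.map ((*) c) u"
  by (simp_all add: free_module_def)

lemma scale_single: "Poly_Mapping.map ((*) c) (gen m n) = Poly_Mapping.single (m, n) c"
  for c :: complex
  by (rule poly_mapping_eqI) (simp add: lookup_scale lookup_single when_def)

lemma vspace_free: "vspace (free_module B)"
proof (rule vspaceI)
  fix u v assume "u \<in> carrier (free_module B)" "v \<in> carrier (free_module B)"
  then show "u \<oplus>\<^bsub>free_module B\<^esub> v \<in> carrier (free_module B)"
    using Poly_Mapping.keys_add[of u v] by (auto simp: free_module_def)
next
  fix u c assume "u \<in> carrier (free_module B)"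
  then show "c \<odot>\<^bsub>free_module B\<^esub> u \<in> carrier (free_module B)"
    by (auto simp: free_module_def in_keys_iff lookup_scale)
qed (auto simp: free_module_def lookup_scale Poly_Mapping.lookup_add algebra_simps intro!: poly_mapping_eqI)

text \<open>Extension by linearity of a map given on basis elements, written as the sum over the
  support that \<open>tensor_map\<close> uses.\<close>

definition free_ext :: "(complex, 'b) module \<Rightarrow> ('a \<Rightarrow> 'b) \<Rightarrow> ('a \<Rightarrow>\<^sub>0 complex) \<Rightarrow> 'b"
  where "free_ext P \<beta> u =
    finsum P (\<lambda>b. Poly_Mapping.lookup u b \<odot>\<^bsub>P\<^esub> \<beta> b) (Poly_Mapping.keys u)"

context
  fixes P :: "(complex, 'b) module" and B :: "'a set" and \<beta>
  assumes P: "vspace P" and \<beta>: "\<And>b. b \<in> B \<Longrightarrow> \<beta> b \<in> carrier P"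
begin

interpretation P: Module.module CC P by (rule P)

text \<open>Terms outside the support vanish, so sums belonging to different supports can be
  compared over one finite set; linearity of the extension rests on this.\<close>

lemma free_ext_superset:
  assumes "finite K" "Poly_Mapping.keys u \<subseteq> K" "K \<subseteq> B"
  shows "free_ext P \<beta> u = finsum P (\<lambda>b. Poly_Mapping.lookup u b \<odot>\<^bsub>P\<^esub> \<beta> b) K"
  unfolding free_ext_def
  by (rule P.add.finprod_mono_neutral_cong_left)
    (use assms \<beta> in \<open>auto simp: in_keys_iff subset_iff vspace_null[OF P]\<close>)

lemma free_ext_linear: "free_ext P \<beta> \<in> linear_maps (free_module B) P"
proof (rule linear_mapsI)
  fix u assume "u \<in> carrier (free_module B)"
  then show "free_ext P \<beta> u \<in> carrier P"
    using \<beta> unfolding free_ext_def by (intro P.finsum_closed) (auto simp: free_module_def subset_iff)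
next
  fix u v assume u: "u \<in> carrier (free_module B)" and v: "v \<in> carrier (free_module B)"
  let ?K = "Poly_Mapping.keys u \<union> Poly_Mapping.keys v"
  have K: "finite ?K" "?K \<subseteq> B" using u v by (auto simp: free_module_def)
  have "free_ext P \<beta> (u + v) =
    finsum P (\<lambda>b. Poly_Mapping.lookup u b \<odot>\<^bsub>P\<^esub> \<beta> b \<oplus>\<^bsub>P\<^esub> Poly_Mapping.lookup v b \<odot>\<^bsub>P\<^esub> \<beta> b) ?K"
    unfolding free_ext_superset[OF K(1) Poly_Mapping.keys_add K(2)]
    by (rule P.finsum_cong')
      (use K \<beta> in \<open>auto simp: Poly_Mapping.lookup_add vspace_distr[OF P] subset_iff\<close>)
  also have "\<dots> = free_ext P \<beta> u \<oplus>\<^bsub>P\<^esub> free_ext P \<beta> v"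
    unfolding free_ext_superset[OF K(1) Un_upper1 K(2)] free_ext_superset[OF K(1) Un_upper2 K(2)]
    by (rule P.finsum_addf) (use K \<beta> in \<open>auto simp: subset_iff\<close>)
  finally show "free_ext P \<beta> (u \<oplus>\<^bsub>free_module B\<^esub> v) = free_ext P \<beta> u \<oplus>\<^bsub>P\<^esub> free_ext P \<beta> v"
    by (simp add: free_module_def)
next
  fix c u assume u: "u \<in> carrier (free_module B)"
  let ?K = "Poly_Mapping.keys u"
  have K: "finite ?K" "?K \<subseteq> B" using u by (auto simp: free_module_def)
  have sub: "Poly_Mapping.keys (Poly_Mapping.map ((*) c) u) \<subseteq> ?K"
    by (auto simp: in_keys_iff lookup_scale)
  have "free_ext P \<beta> (Poly_Mapping.map ((*) c) u) =
    finsum P (\<lambda>b. c \<odot>\<^bsub>P\<^esub> (Poly_Mapping.lookup u b \<odot>\<^bsub>P\<^esub> \<beta> b)) ?K"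
    unfolding free_ext_superset[OF K(1) sub K(2)]
    by (intro P.finsum_cong')
      (use K \<beta> in \<open>auto simp: lookup_scale vspace_assoc[OF P] subset_iff\<close>)
  also have "\<dots> = c \<odot>\<^bsub>P\<^esub> free_ext P \<beta> u"
    unfolding free_ext_def
    by (rule P.finsum_smult_ldistr[symmetric]) (use K \<beta> in \<open>auto simp: subset_iff\<close>)
  finally show "free_ext P \<beta> (c \<odot>\<^bsub>free_module B\<^esub> u) = c \<odot>\<^bsub>P\<^esub> free_ext P \<beta> u"
    by (simp add: free_module_def)
qed

lemma free_ext_single:
  assumes "b \<in> B"
  shows "free_ext P \<beta> (Poly_Mapping.single b c) = c \<odot>\<^bsub>P\<^esub> \<beta> b"
proof -
  have b: "\<beta> b \<in> carrier P" by (rule \<beta>[OF assms])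
  have "free_ext P \<beta> (Poly_Mapping.single b c) =
    finsum P (\<lambda>b'. Poly_Mapping.lookup (Poly_Mapping.single b c) b' \<odot>\<^bsub>P\<^esub> \<beta> b') {b}"
    by (rule free_ext_superset) (use assms in auto)
  also have "\<dots> = c \<odot>\<^bsub>P\<^esub> \<beta> b" using b by (simp add: P.finsum_insert[of "{}", simplified])
  finally show ?thesis .
qed

end

text \<open>The bilinearity relations are written with the subtraction of finitely supported
  functions. From h (u - v) + h v = h u, such a relation becomes an equation between images.\<close>

lemma linear_free_diff:
  assumes h: "h \<in> linear_maps (free_module B) P" "vspace P"
    and u: "Poly_Mapping.keys u \<subseteq> B" "Poly_Mapping.keys v \<subseteq> B"
  shows "h (u - v) = \<zero>\<^bsub>P\<^esub> \<longleftrightarrow> h u = h v"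
proof -
  interpret P: Module.module CC P by fact
  have "Poly_Mapping.keys (u - v) \<subseteq> B" using u Poly_Mapping.keys_diff[of u v] by blast
  then have uv: "u - v \<in> carrier (free_module B)" "v \<in> carrier (free_module B)"
    using u by (auto simp: free_module_def)
  have "h (u - v) \<oplus>\<^bsub>P\<^esub> h v = h u" using linear_add[OF h(1) uv] by (simp add: free_module_def)
  then show ?thesis
    using P.add.r_cancel_one[OF linear_closed[OF h(1) uv(2)] linear_closed[OF h(1) uv(1)]] by simp
qed

context
  fixes M :: "(complex, 'a) module" and N :: "(complex, 'b) module"
  assumes M: "vspace M" and N: "vspace N"
begin

interpretation M: Module.module CC M by (rule M)
interpretation N: Module.module CC N by (rule N)

lemma tensor_gens_subset:
  "({gen (m \<oplus>\<^bsub>M\<^esub> m') n - gen m n - gen m' n | m m' n.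
        m \<in> carrier M \<and> m' \<in> carrier M \<and> n \<in> carrier N} \<union>
     {gen m (n \<oplus>\<^bsub>N\<^esub> n') - gen m n - gen m n' | m n n'.
        m \<in> carrier M \<and> n \<in> carrier N \<and> n' \<in> carrier N} \<union>
     {gen (c \<odot>\<^bsub>M\<^esub> m) n - Poly_Mapping.single (m, n) c | c m n.
        m \<in> carrier M \<and> n \<in> carrier N} \<union>
     {gen m (c \<odot>\<^bsub>N\<^esub> n) - Poly_Mapping.single (m, n) c | c m n.
        m \<in> carrier M \<and> n \<in> carrier N}) \<subseteq> carrier (free_module (carrier M \<times> carrier N))"
  by (auto simp: free_module_def in_keys_iff Poly_Mapping.lookup_minus lookup_single when_def
      split: if_splits)

lemma quotient_tensor: "quotient (free_module (carrier M \<times> carrier N)) (tensor_rels M N)"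
  unfolding tensor_rels_def
  by (intro quotient.intro vspace_free mod_span_submodule tensor_gens_subset)

interpretation Q: quotient "free_module (carrier M \<times> carrier N)" "tensor_rels M N"
  by (rule quotient_tensor)

lemma vspace_tensor: "vspace (tensor M N)"
  unfolding tensor_def by (rule Q.vspace_quot)

lemma gen_closed: "m \<in> carrier M \<Longrightarrow> n \<in> carrier N \<Longrightarrow>
    Poly_Mapping.single (m, n) c \<in> carrier (free_module (carrier M \<times> carrier N))"
  by (auto simp: free_module_def)

lemma pure_closed: "m \<in> carrier M \<Longrightarrow> n \<in> carrier N \<Longrightarrow> pure M N m n \<in> carrier (tensor M N)"
  unfolding tensor_def pure_def by (intro Q.coset_closed gen_closed)

lemma pure_rel:
  assumes "u - v \<in> tensor_rels M N"
    "Poly_Mapping.keys u \<subseteq> carrier M \<times> carrier N" "Poly_Mapping.keys v \<subseteq> carrier M \<times> carrier N"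
  shows "tensor_rels M N +>\<^bsub>free_module (carrier M \<times> carrier N)\<^esub> u =
    tensor_rels M N +>\<^bsub>free_module (carrier M \<times> carrier N)\<^esub> v"
  using linear_free_diff[OF Q.proj_linear Q.vspace_quot assms(2,3)] Q.coset_eq_self[OF assms(1)]
  by (simp add: quot_module_def)

lemma pure_add_left:
  assumes "m \<in> carrier M" "m' \<in> carrier M" "n \<in> carrier N"
  shows "pure M N (m \<oplus>\<^bsub>M\<^esub> m') n = pure M N m n \<oplus>\<^bsub>tensor M N\<^esub> pure M N m' n"
proof -
  have mem: "gen (m \<oplus>\<^bsub>M\<^esub> m') n - (gen m n + gen m' n) \<in> tensor_rels M N"
    unfolding tensor_rels_def using assms
    by (intro subsetD[OF mod_span_superset]) (auto simp: diff_diff_eq[symmetric])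
  have keys: "Poly_Mapping.keys (gen m n + gen m' n) \<subseteq> carrier M \<times> carrier N"
    using assms Poly_Mapping.keys_add[of "gen m n" "gen m' n"] by auto
  show ?thesis
    unfolding pure_def tensor_def using assms
    by (simp add: pure_rel[OF mem _ keys] Q.coset_add gen_closed free_simps)
qed

lemma pure_add_right:
  assumes "m \<in> carrier M" "n \<in> carrier N" "n' \<in> carrier N"
  shows "pure M N m (n \<oplus>\<^bsub>N\<^esub> n') = pure M N m n \<oplus>\<^bsub>tensor M N\<^esub> pure M N m n'"
proof -
  have mem: "gen m (n \<oplus>\<^bsub>N\<^esub> n') - (gen m n + gen m n') \<in> tensor_rels M N"
    unfolding tensor_rels_def using assms
    by (intro subsetD[OF mod_span_superset]) (auto simp: diff_diff_eq[symmetric])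
  have keys: "Poly_Mapping.keys (gen m n + gen m n') \<subseteq> carrier M \<times> carrier N"
    using assms Poly_Mapping.keys_add[of "gen m n" "gen m n'"] by auto
  show ?thesis
    unfolding pure_def tensor_def using assms
    by (simp add: pure_rel[OF mem _ keys] Q.coset_add gen_closed free_simps)
qed

text \<open>The scaling relations contain \<open>single (m, n) c\<close> where one expects c times a
  generator; this reconciles the two, so that they yield homogeneity of \<open>pure\<close> in
  either argument.\<close>

lemma pure_single:
  assumes "m \<in> carrier M" "n \<in> carrier N"
  shows "tensor_rels M N +>\<^bsub>free_module (carrier M \<times> carrier N)\<^esub> Poly_Mapping.single (m, n) c =
    c \<odot>\<^bsub>tensor M N\<^esub> pure M N m n"
  using Q.coset_smult[OF gen_closed[OF assms], of c 1]
  unfolding pure_def tensor_def free_simps scale_single by (rule sym)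

lemma pure_smult_left:
  assumes "m \<in> carrier M" "n \<in> carrier N"
  shows "pure M N (c \<odot>\<^bsub>M\<^esub> m) n = c \<odot>\<^bsub>tensor M N\<^esub> pure M N m n"
proof -
  have mem: "gen (c \<odot>\<^bsub>M\<^esub> m) n - Poly_Mapping.single (m, n) c \<in> tensor_rels M N"
    unfolding tensor_rels_def using assms by (intro subsetD[OF mod_span_superset]) auto
  show ?thesis
    unfolding pure_single[OF assms, symmetric]
    by (subst pure_def, rule pure_rel[OF mem]) (use assms in auto)
qed

lemma pure_smult_right:
  assumes "m \<in> carrier M" "n \<in> carrier N"
  shows "pure M N m (c \<odot>\<^bsub>N\<^esub> n) = c \<odot>\<^bsub>tensor M N\<^esub> pure M N m n"
proof -
  have mem: "gen m (c \<odot>\<^bsub>N\<^esub> n) - Poly_Mapping.single (m, n) c \<in> tensor_rels M N"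
    unfolding tensor_rels_def using assms by (intro subsetD[OF mod_span_superset]) auto
  show ?thesis
    unfolding pure_single[OF assms, symmetric]
    by (subst pure_def, rule pure_rel[OF mem]) (use assms in auto)
qed

lemma pure_linear_left: "n \<in> carrier N \<Longrightarrow> (\<lambda>m. pure M N m n) \<in> linear_maps M (tensor M N)"
  by (rule linear_mapsI) (simp_all add: pure_closed pure_add_left pure_smult_left)

lemma pure_linear_right: "m \<in> carrier M \<Longrightarrow> pure M N m \<in> linear_maps N (tensor M N)"
  by (rule linear_mapsI) (simp_all add: pure_closed pure_add_right pure_smult_right)

end

text \<open>Defined through the same choice of representative as \<open>tensor_map\<close>, so that the latter is
  literally an instance.\<close>

definition tensor_lift :: "(complex, 'c) module \<Rightarrow> ('a \<Rightarrow> 'b \<Rightarrow> 'c) \<Rightarrow> ('a, 'b) tens \<Rightarrow> 'c"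
  where "tensor_lift P \<beta> = quot_lift (free_ext P (\<lambda>(m, n). \<beta> m n))"

lemma tensor_map_lift:
  "tensor_map M' N' f g = tensor_lift (tensor M' N') (\<lambda>m n. pure M' N' (f m) (g n))"
  by (rule ext) (simp add: tensor_map_def tensor_lift_def quot_lift_def free_ext_def split_def Let_def)

context
  fixes M :: "(complex, 'a) module" and N :: "(complex, 'b) module"
    and P :: "(complex, 'c) module" and \<beta>
  assumes M: "vspace M" and N: "vspace N" and P: "vspace P"
    and left: "\<And>n. n \<in> carrier N \<Longrightarrow> (\<lambda>m. \<beta> m n) \<in> linear_maps M P"
    and right: "\<And>m. m \<in> carrier M \<Longrightarrow> \<beta> m \<in> linear_maps N P"
begin

interpretation M: Module.module CC M by (rule M)
interpretation N: Module.module CC N by (rule N)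
interpretation P: Module.module CC P by (rule P)
interpretation Q: quotient "free_module (carrier M \<times> carrier N)" "tensor_rels M N"
  by (rule quotient_tensor[OF M N])

private abbreviation "H \<equiv> free_ext P (\<lambda>(m, n). \<beta> m n)"

private lemma bilinear_closed: "\<And>b. b \<in> carrier M \<times> carrier N \<Longrightarrow> (case b of (m, n) \<Rightarrow> \<beta> m n) \<in> carrier P"
  using linear_closed[OF right] by auto

private lemma free_ext_bilinear_linear: "H \<in> linear_maps (free_module (carrier M \<times> carrier N)) P"
  by (rule free_ext_linear[OF P bilinear_closed])

private lemma free_ext_bilinear_single: "m \<in> carrier M \<Longrightarrow> n \<in> carrier N \<Longrightarrow>
    H (Poly_Mapping.single (m, n) c) = c \<odot>\<^bsub>P\<^esub> \<beta> m n"
  using free_ext_single[where B = "carrier M \<times> carrier N" and \<beta> = "\<lambda>(m, n). \<beta> m n", OF P bilinear_closed,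
      of "(m, n)"] by auto

private lemma free_ext_bilinear_add:
  assumes "m \<in> carrier M" "m' \<in> carrier M" "n \<in> carrier N" "n' \<in> carrier N"
  shows "H (gen m n + gen m' n') = \<beta> m n \<oplus>\<^bsub>P\<^esub> \<beta> m' n'"
    "Poly_Mapping.keys (gen m n + gen m' n') \<subseteq> carrier M \<times> carrier N"
  using linear_add[OF free_ext_bilinear_linear gen_closed[OF M N assms(1,3)] gen_closed[OF M N assms(2,4)], of 1 1] assms
    Poly_Mapping.keys_add[of "gen m n" "gen m' n'"]
  by (auto simp: free_simps free_ext_bilinear_single vspace_one[OF P] linear_closed[OF right])

private lemma free_ext_bilinear_diff: "Poly_Mapping.keys u \<subseteq> carrier M \<times> carrier N \<Longrightarrow>
    Poly_Mapping.keys v \<subseteq> carrier M \<times> carrier N \<Longrightarrow> H u = H v \<Longrightarrow> H (u - v) = \<zero>\<^bsub>P\<^esub>"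
  using linear_free_diff[OF free_ext_bilinear_linear P] by blast

text \<open>Each of the four families of generators expresses one of the four bilinearity laws of
  \<beta>, so the linear extension kills the generators and hence their span.\<close>

private lemma free_ext_bilinear_rels:
  assumes "u \<in> tensor_rels M N"
  shows "H u = \<zero>\<^bsub>P\<^esub>"
proof -
  have "H u \<in> {\<zero>\<^bsub>P\<^esub>}"
    using assms unfolding tensor_rels_def
  proof (rule mod_span_image[OF free_ext_bilinear_linear vspace_free P tensor_gens_subset[OF M N] zero_submodule[OF P],
        rotated -1])
  qed (auto simp: diff_diff_eq free_ext_bilinear_add free_ext_bilinear_single vspace_one[OF P] linear_closed[OF right] intro!: free_ext_bilinear_diff
      simp: linear_add[OF left] linear_add[OF right] linear_smult[OF left] linear_smult[OF right]
        dest!: subsetD[OF keys_add] split: if_splits)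
  then show ?thesis by simp
qed

text \<open>Together with the value on pure tensors this is the existence half of the universal
  property. Induced maps of tensor products and contractions are both instances.\<close>

lemma tensor_lift_linear: "tensor_lift P \<beta> \<in> linear_maps (tensor M N) P"
  unfolding tensor_lift_def tensor_def by (rule Q.quot_lift_linear[OF free_ext_bilinear_linear P free_ext_bilinear_rels])

lemma tensor_lift_pure:
  assumes "m \<in> carrier M" "n \<in> carrier N"
  shows "tensor_lift P \<beta> (pure M N m n) = \<beta> m n"
  unfolding tensor_lift_def pure_def using assms linear_closed[OF right]
  by (subst Q.quot_lift_coset[OF free_ext_bilinear_linear P free_ext_bilinear_rels]) (auto simp: gen_closed[OF M N] free_ext_bilinear_single vspace_one[OF P])

end

lemma tensor_map_linear:
  assumes "vspace M" "vspace N" "vspace M'" "vspace N'"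
    and "f \<in> linear_maps M M'" "g \<in> linear_maps N N'"
  shows "tensor_map M' N' f g \<in> linear_maps (tensor M N) (tensor M' N')"
    and "m \<in> carrier M \<Longrightarrow> n \<in> carrier N \<Longrightarrow>
      tensor_map M' N' f g (pure M N m n) = pure M' N' (f m) (g n)"
  unfolding tensor_map_lift using assms
  by (intro tensor_lift_linear tensor_lift_pure vspace_tensor
      linear_comp[OF _ pure_linear_left] linear_comp[OF _ pure_linear_right];
      simp add: linear_closed)+

subsection \<open>Bases and duals\<close>

definition coord :: "(complex, 'a) module \<Rightarrow> nat \<Rightarrow> (nat \<Rightarrow> 'a) \<Rightarrow> 'a \<Rightarrow> nat \<Rightarrow> complex"
  where "coord M n b v = (THE c. c \<in> extensional {..<n} \<and>
    v = finsum M (\<lambda>i. c i \<odot>\<^bsub>M\<^esub> b i) {..<n})"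

context
  fixes M :: "(complex, 'a) module" and n b
  assumes M: "vspace M" and b: "is_basis M n b"
begin

interpretation M: Module.module CC M by (rule M)

lemma basis_closed: "i < n \<Longrightarrow> b i \<in> carrier M"
  using b by (auto simp: is_basis_def)

lemma basis_comb_closed: "i < n \<Longrightarrow> c \<odot>\<^bsub>M\<^esub> b i \<in> carrier M"
  by (simp add: basis_closed)

lemma coord_expand: "v \<in> carrier M \<Longrightarrow> v = finsum M (\<lambda>i. coord M n b v i \<odot>\<^bsub>M\<^esub> b i) {..<n}"
  using theI'[of "\<lambda>c. c \<in> extensional {..<n} \<and> v = finsum M (\<lambda>i. c i \<odot>\<^bsub>M\<^esub> b i) {..<n}"] b
  unfolding coord_def is_basis_def by blast

text \<open>Uniqueness in \<open>is_basis\<close> concerns extensional families only. The family c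
  is therefore compared through its restriction, which has the same sum.\<close>

lemma coord_unique:
  assumes "v = finsum M (\<lambda>i. c i \<odot>\<^bsub>M\<^esub> b i) {..<n}" "i < n"
  shows "coord M n b v i = c i"
proof -
  have v: "v \<in> carrier M"
    unfolding assms(1) by (rule M.finsum_closed) (auto simp: basis_comb_closed)
  have eq: "v = finsum M (\<lambda>i. restrict c {..<n} i \<odot>\<^bsub>M\<^esub> b i) {..<n}"
    unfolding assms(1) by (rule M.finsum_cong') (auto simp: basis_comb_closed)
  have "\<exists>!c. c \<in> extensional {..<n} \<and> v = finsum M (\<lambda>i. c i \<odot>\<^bsub>M\<^esub> b i) {..<n}"
    using b v unfolding is_basis_def by blast
  then have "coord M n b v = restrict c {..<n}"
    unfolding coord_def by (rule the1_equality) (use eq in auto)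
  then show ?thesis using assms(2) by simp
qed

lemma coord_add:
  assumes "u \<in> carrier M" "v \<in> carrier M" "i < n"
  shows "coord M n b (u \<oplus>\<^bsub>M\<^esub> v) i = coord M n b u i + coord M n b v i"
proof (rule coord_unique[OF _ assms(3)])
  have "u \<oplus>\<^bsub>M\<^esub> v = (\<Oplus>\<^bsub>M\<^esub>i\<in>{..<n}. coord M n b u i \<odot>\<^bsub>M\<^esub> b i) \<oplus>\<^bsub>M\<^esub>
    (\<Oplus>\<^bsub>M\<^esub>i\<in>{..<n}. coord M n b v i \<odot>\<^bsub>M\<^esub> b i)"
    using coord_expand[OF assms(1)] coord_expand[OF assms(2)] by (rule arg_cong2)
  also have "\<dots> = (\<Oplus>\<^bsub>M\<^esub>i\<in>{..<n}. coord M n b u i \<odot>\<^bsub>M\<^esub> b i \<oplus>\<^bsub>M\<^esub> coord M n b v i \<odot>\<^bsub>M\<^esub> b i)"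
    by (rule M.finsum_addf[symmetric]) (auto simp: basis_comb_closed)
  also have "\<dots> = (\<Oplus>\<^bsub>M\<^esub>i\<in>{..<n}. (coord M n b u i + coord M n b v i) \<odot>\<^bsub>M\<^esub> b i)"
    by (rule M.finsum_cong') (auto simp: basis_comb_closed vspace_distr[OF M] basis_closed)
  finally show "u \<oplus>\<^bsub>M\<^esub> v = (\<Oplus>\<^bsub>M\<^esub>i\<in>{..<n}. (coord M n b u i + coord M n b v i) \<odot>\<^bsub>M\<^esub> b i)" .
qed

lemma coord_smult:
  assumes "u \<in> carrier M" "i < n"
  shows "coord M n b (c \<odot>\<^bsub>M\<^esub> u) i = c * coord M n b u i"
proof (rule coord_unique[OF _ assms(2)])
  show "c \<odot>\<^bsub>M\<^esub> u = (\<Oplus>\<^bsub>M\<^esub>i\<in>{..<n}. (c * coord M n b u i) \<odot>\<^bsub>M\<^esub> b i)"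
    by (subst coord_expand[OF assms(1)], subst M.finsum_smult_ldistr)
      (auto simp: basis_comb_closed vspace_assoc[OF M] basis_closed intro!: M.finsum_cong')
qed

lemma coord_basis:
  assumes "i < n" "j < n"
  shows "coord M n b (b j) i = (if i = j then 1 else 0)"
proof (rule coord_unique[OF _ assms(1)])
  have "(\<Oplus>\<^bsub>M\<^esub>i\<in>{..<n}. (if i = j then 1 else 0) \<odot>\<^bsub>M\<^esub> b i) =
    (\<Oplus>\<^bsub>M\<^esub>i\<in>{..<n}. if j = i then b i else \<zero>\<^bsub>M\<^esub>)"
    by (rule M.finsum_cong')
      (auto simp: basis_closed vspace_one[OF M] vspace_null[OF M])
  then show "b j = (\<Oplus>\<^bsub>M\<^esub>i\<in>{..<n}. (if i = j then 1 else 0) \<odot>\<^bsub>M\<^esub> b i)"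
    using M.finsum_singleton[of j "{..<n}" b] assms(2) basis_closed by auto
qed

end

lemma dual_simps:
  "\<zero>\<^bsub>dual M\<^esub> = (\<lambda>_. 0)" "l \<oplus>\<^bsub>dual M\<^esub> m = (\<lambda>u. l u + m u)" "c \<odot>\<^bsub>dual M\<^esub> l = (\<lambda>u. c * l u)"
  by (simp_all add: dual_def)

lemma
  assumes "l \<in> carrier (dual M)"
  shows dual_outside: "u \<notin> carrier M \<Longrightarrow> l u = 0"
    and dual_add: "u \<in> carrier M \<Longrightarrow> v \<in> carrier M \<Longrightarrow> l (u \<oplus>\<^bsub>M\<^esub> v) = l u + l v"
    and dual_smult: "u \<in> carrier M \<Longrightarrow> l (c \<odot>\<^bsub>M\<^esub> u) = c * l u"
  using assms by (auto simp: dual_def)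

lemma dualI:
  assumes "\<And>u. u \<notin> carrier M \<Longrightarrow> l u = 0"
    and "\<And>u v. u \<in> carrier M \<Longrightarrow> v \<in> carrier M \<Longrightarrow> l (u \<oplus>\<^bsub>M\<^esub> v) = l u + l v"
    and "\<And>c u. u \<in> carrier M \<Longrightarrow> l (c \<odot>\<^bsub>M\<^esub> u) = c * l u"
  shows "l \<in> carrier (dual M)"
  using assms by (auto simp: dual_def)

lemma vspace_dual:
  assumes "vspace M"
  shows "vspace (dual M)"
proof -
  interpret M: Module.module CC M by fact
  show ?thesis by (rule vspaceI) (auto simp: dual_def algebra_simps fun_eq_iff)
qed

lemma dual_zero:
  assumes "l \<in> carrier (dual M)" "vspace M"
  shows "l \<zero>\<^bsub>M\<^esub> = 0"
proof -
  interpret M: Module.module CC M by fact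
  show ?thesis using dual_smult[OF assms(1) M.zero_closed, of 0] by simp
qed

lemma dual_finsum_arg:
  assumes "l \<in> carrier (dual M)" "vspace M" "finite I" "\<And>i. i \<in> I \<Longrightarrow> f i \<in> carrier M"
  shows "l (finsum M f I) = (\<Sum>i\<in>I. l (f i))"
  using assms(3,4)
proof (induction I rule: finite_induct)
  case empty
  interpret M: Module.module CC M by fact
  show ?case by (simp add: dual_zero[OF assms(1,2)])
next
  case (insert i I)
  interpret M: Module.module CC M by fact
  show ?case using insert by (simp add: Pi_def dual_add[OF assms(1)])
qed

lemma dual_finsum:
  assumes "vspace M" "finite I" "\<And>i. i \<in> I \<Longrightarrow> f i \<in> carrier (dual M)"
  shows "finsum (dual M) f I u = (\<Sum>i\<in>I. f i u)"
  using assms(2,3)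
proof (induction I rule: finite_induct)
  case empty
  interpret D: Module.module CC "dual M" by (rule vspace_dual[OF assms(1)])
  show ?case by (simp add: dual_simps)
next
  case (insert i I)
  interpret D: Module.module CC "dual M" by (rule vspace_dual[OF assms(1)])
  show ?case using insert by (simp add: Pi_def) (simp add: dual_simps)
qed

text \<open>On the carrier both functionals are determined by expanding the argument in the basis;
  off the carrier both are 0 by the convention in \<open>dual\<close>.\<close>

lemma dual_eqI:
  assumes "vspace M" "is_basis M n b" "l \<in> carrier (dual M)" "m \<in> carrier (dual M)"
    and "\<And>j. j < n \<Longrightarrow> l (b j) = m (b j)"
  shows "l = m"
proof
  fix u
  show "l u = m u"
  proof (cases "u \<in> carrier M")
    case True
    interpret M: Module.module CC M by fact
    have eq: "k u = (\<Sum>i<n. coord M n b u i * k (b i))" if k: "k \<in> carrier (dual M)" for k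
      by (subst coord_expand[OF assms(1,2) True], subst dual_finsum_arg[OF k assms(1)])
        (auto simp: basis_closed[OF assms(1,2)] dual_smult[OF k])
    show ?thesis unfolding eq[OF assms(3)] eq[OF assms(4)] using assms(5) by simp
  qed (use dual_outside assms(3,4) in metis)
qed

text \<open>Evaluating a combination of the l i at b j returns its j-th coefficient. So the
  coefficients of a functional m can only be the values m (b j), and by \<open>dual_eqI\<close>
  these work.\<close>

lemma is_basis_dual:
  assumes M: "vspace M" and b: "is_basis M n b" and l: "\<And>i. i < n \<Longrightarrow> l i \<in> carrier (dual M)"
    and delta: "\<And>i j. i < n \<Longrightarrow> j < n \<Longrightarrow> l i (b j) = (if i = j then 1 else 0)"
  shows "is_basis (dual M) n l"
proof -
  interpret D: Module.module CC "dual M" by (rule vspace_dual[OF M])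
  have comb: "finsum (dual M) (\<lambda>i. c i \<odot>\<^bsub>dual M\<^esub> l i) {..<n} (b j) = c j" if "j < n" for c j
  proof -
    have "finsum (dual M) (\<lambda>i. c i \<odot>\<^bsub>dual M\<^esub> l i) {..<n} (b j) = (\<Sum>i<n. c i * l i (b j))"
      by (subst dual_finsum[OF M]) (simp_all add: l D.smult_closed, simp add: dual_simps)
    also have "\<dots> = (\<Sum>i<n. if i = j then c i else 0)"
      by (rule sum.cong) (use delta that in auto)
    finally show ?thesis using that by simp
  qed
  have closed: "finsum (dual M) (\<lambda>i. c i \<odot>\<^bsub>dual M\<^esub> l i) {..<n} \<in> carrier (dual M)" for c
    by (rule D.finsum_closed) (auto simp: l)
  show ?thesis
    unfolding is_basis_def
  proof (intro conjI ballI)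
    fix m assume m: "m \<in> carrier (dual M)"
    show "\<exists>!c. c \<in> extensional {..<n} \<and> m = finsum (dual M) (\<lambda>i. c i \<odot>\<^bsub>dual M\<^esub> l i) {..<n}"
    proof (rule ex1I[of _ "restrict (\<lambda>j. m (b j)) {..<n}"])
      show "restrict (\<lambda>j. m (b j)) {..<n} \<in> extensional {..<n} \<and>
        m = (\<Oplus>\<^bsub>dual M\<^esub>i\<in>{..<n}. restrict (\<lambda>j. m (b j)) {..<n} i \<odot>\<^bsub>dual M\<^esub> l i)"
        by (intro conjI dual_eqI[OF M b m closed]) (simp_all add: comb)
    next
      fix c assume c: "c \<in> extensional {..<n} \<and> m = finsum (dual M) (\<lambda>i. c i \<odot>\<^bsub>dual M\<^esub> l i) {..<n}"
      then have "m (b j) = c j" if "j < n" for j using comb[OF that] by auto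
      then show "c = restrict (\<lambda>j. m (b j)) {..<n}" using c by (intro extensionalityI[of c "{..<n}"]) auto
    qed
  qed (use l in auto)
qed

text \<open>The members of the dual basis. The value 0 off the carrier is what membership in
  \<open>dual M\<close> demands.\<close>

definition dual_elt :: "(complex, 'a) module \<Rightarrow> nat \<Rightarrow> (nat \<Rightarrow> 'a) \<Rightarrow> nat \<Rightarrow> 'a \<Rightarrow> complex"
  where "dual_elt M n b i v = (if v \<in> carrier M then coord M n b v i else 0)"

lemma dual_elt:
  assumes M: "vspace M" and b: "is_basis M n b" and "i < n"
  shows "dual_elt M n b i \<in> carrier (dual M)"
    and "j < n \<Longrightarrow> dual_elt M n b i (b j) = (if i = j then 1 else 0)"
proof -
  interpret M: Module.module CC M by (rule M)
  show "dual_elt M n b i \<in> carrier (dual M)"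
    by (rule dualI) (auto simp: dual_elt_def coord_add[OF M b] coord_smult[OF M b] assms(3))
  show "j < n \<Longrightarrow> dual_elt M n b i (b j) = (if i = j then 1 else 0)"
    by (simp add: dual_elt_def coord_basis[OF M b] basis_closed[OF M b] assms(3))
qed

subsection \<open>Holomorphic functions on a Riemann surface\<close>

locale surface =
  fixes A :: "'x::t2_space chart set"
  assumes A: "riemann_surface A"
begin

lemma charts_cover: "\<exists>a\<in>A. x \<in> fst a"
  using A unfolding riemann_surface_def by blast

lemma chart_open: "a \<in> A \<Longrightarrow> open (fst a)"
  using A unfolding riemann_surface_def by blast

lemma chart_inv_snd: "a \<in> A \<Longrightarrow> x \<in> fst a \<Longrightarrow> chart_inv a (snd a x) = x"
  using A unfolding riemann_surface_def by (meson homeomorphism_apply1)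

lemma chart_image_open:
  assumes "a \<in> A" "open U"
  shows "open (snd a ` (U \<inter> fst a))"
proof -
  have hom: "homeomorphism (fst a) (snd a ` fst a) (snd a) (chart_inv a)" "open (snd a ` fst a)"
    using A assms(1) unfolding riemann_surface_def by blast+
  have "openin (top_of_set (fst a)) (U \<inter> fst a)"
    using openin_open_Int[OF assms(2), of "fst a"] by (simp add: Int_commute)
  then show ?thesis
    using homeomorphism_imp_open_map[OF hom(1)] hom(2) openin_open_trans by blast
qed

lemma hol_fun_chart: "a \<in> A \<Longrightarrow> hol_fun A (fst a) (snd a)"
  using A unfolding riemann_surface_def hol_fun_def by (metis Int_commute)

lemma hol_fun_cong:
  assumes "\<And>x. x \<in> U \<Longrightarrow> f x = g x" "hol_fun A U f"
  shows "hol_fun A U g"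
  unfolding hol_fun_def
proof
  fix a assume a: "a \<in> A"
  then have "(f \<circ> chart_inv a) holomorphic_on snd a ` (U \<inter> fst a)"
    using assms(2) by (simp add: hol_fun_def)
  then show "(g \<circ> chart_inv a) holomorphic_on snd a ` (U \<inter> fst a)"
    by (rule holomorphic_transform) (use assms(1) in \<open>auto simp: chart_inv_snd[OF a]\<close>)
qed

lemma hol_fun_mono: "hol_fun A U f \<Longrightarrow> W \<subseteq> U \<Longrightarrow> hol_fun A W f"
  unfolding hol_fun_def
  by (blast intro: holomorphic_on_subset)

lemma hol_fun_const: "hol_fun A U (\<lambda>_. c)"
  by (simp add: hol_fun_def o_def)

lemma hol_fun_add: "hol_fun A U f \<Longrightarrow> hol_fun A U g \<Longrightarrow> hol_fun A U (\<lambda>x. f x + g x)"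
  by (simp add: hol_fun_def o_def holomorphic_on_add)

lemma hol_fun_mult: "hol_fun A U f \<Longrightarrow> hol_fun A U g \<Longrightarrow> hol_fun A U (\<lambda>x. f x * g x)"
  by (simp add: hol_fun_def o_def holomorphic_on_mult)

text \<open>Charts map the overlap of U with W to an open set of the plane, so holomorphy there
  gives a genuine derivative at the point, which does not depend on the size of the
  neighbourhood.\<close>

lemma hol_fun_local:
  assumes "open U" and "\<And>x. x \<in> U \<Longrightarrow> \<exists>W. open W \<and> x \<in> W \<and> hol_fun A (U \<inter> W) f"
  shows "hol_fun A U f"
  unfolding hol_fun_def
proof
  fix a assume a: "a \<in> A"
  show "(f \<circ> chart_inv a) holomorphic_on snd a ` (U \<inter> fst a)"
    unfolding holomorphic_on_def
  proof
    fix z assume "z \<in> snd a ` (U \<inter> fst a)"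
    then obtain x where x: "x \<in> U" "x \<in> fst a" "z = snd a x" by blast
    obtain W where W: "open W" "x \<in> W" "hol_fun A (U \<inter> W) f" using assms(2) x(1) by blast
    have "(f \<circ> chart_inv a) holomorphic_on snd a ` (U \<inter> W \<inter> fst a)"
      using W(3) a by (simp add: hol_fun_def)
    moreover have "open (snd a ` (U \<inter> W \<inter> fst a))"
      using chart_image_open[OF a] assms(1) W(1) by blast
    moreover have "z \<in> snd a ` (U \<inter> W \<inter> fst a)" using x W(2) by blast
    ultimately have "(f \<circ> chart_inv a) field_differentiable (at z)"
      by (rule holomorphic_on_imp_differentiable_at)
    then show "(f \<circ> chart_inv a) field_differentiable (at z within snd a ` (U \<inter> fst a))"
      by (rule field_differentiable_at_within)
  qed
qed

lemma hol_fun_differentiable: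
  assumes "hol_fun A U f" "open U" "x \<in> U" "a \<in> charts_at A x"
  shows "(f \<circ> chart_inv a) field_differentiable (at (snd a x))"
  using assms by (intro holomorphic_on_imp_differentiable_at[of _ "snd a ` (U \<inter> fst a)"])
    (auto simp: hol_fun_def charts_at_def chart_image_open)

end

subsection \<open>Sections of bundles\<close>

text \<open>Fibers with an atlas of frames, without holomorphic transitions. This already suffices
  for sections to be closed under sums and holomorphic multiples and for stalks to be vector spaces,
  and it is all that is established for the tangent and cotangent bundles. That frame members are
  sections is added in \<open>hol_vb\<close>.\<close>

locale frame_bundle = surface A for A :: "'x::t2_space chart set" +
  fixes E :: "('x, 'e) vbundle"
  assumes fib: "vspace (fib E x)"
    and frames_cover: "\<exists>W e. (W, e) \<in> frames E \<and> x \<in> W"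
    and frame_open: "(W, e) \<in> frames E \<Longrightarrow> open W"
    and frame_basis: "(W, e) \<in> frames E \<Longrightarrow> x \<in> W \<Longrightarrow> is_basis (fib E x) (rk E) (\<lambda>i. e i x)"
begin

abbreviation coef :: "(nat \<Rightarrow> 'x \<Rightarrow> 'e) \<Rightarrow> ('x \<Rightarrow> 'e) \<Rightarrow> nat \<Rightarrow> 'x \<Rightarrow> complex"
  where "coef e s i y \<equiv> coord (fib E y) (rk E) (\<lambda>i. e i y) (s y) i"

lemma frame_closed: "(W, e) \<in> frames E \<Longrightarrow> x \<in> W \<Longrightarrow> i < rk E \<Longrightarrow> e i x \<in> carrier (fib E x)"
  using basis_closed[OF fib frame_basis] by blast

lemma coef_lin_comb:
  "(W, e) \<in> frames E \<Longrightarrow> x \<in> W \<Longrightarrow> s x = lin_comb E c e (rk E) x \<Longrightarrow> i < rk E \<Longrightarrow>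
    coef e s i x = c i x"
  unfolding lin_comb_def by (rule coord_unique[OF fib frame_basis])

lemma lin_comb_coef:
  "(W, e) \<in> frames E \<Longrightarrow> x \<in> W \<Longrightarrow> s x \<in> carrier (fib E x) \<Longrightarrow> s x = lin_comb E (coef e s) e (rk E) x"
  unfolding lin_comb_def by (rule coord_expand[OF fib frame_basis])

text \<open>The coefficients whose existence \<open>sections\<close> demands are unique because
  frames are bases. Naming them \<open>coef\<close> replaces the existential quantifier by
  holomorphy of specific functions.\<close>

lemma sections_iff:
  "s \<in> sections A E U \<longleftrightarrow> s \<in> extensional U \<and> (\<forall>x\<in>U. s x \<in> carrier (fib E x)) \<and>
    (\<forall>W e i. (W, e) \<in> frames E \<longrightarrow> i < rk E \<longrightarrow> hol_fun A (U \<inter> W) (coef e s i))"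
  (is "_ \<longleftrightarrow> ?ext \<and> ?car \<and> ?hol")
proof
  assume s: "s \<in> sections A E U"
  have "hol_fun A (U \<inter> W) (coef e s i)" if We: "(W, e) \<in> frames E" and i: "i < rk E" for W e i
  proof -
    obtain c where c: "\<And>i. i < rk E \<Longrightarrow> hol_fun A (U \<inter> W) (c i)"
      "\<And>x. x \<in> U \<inter> W \<Longrightarrow> s x = lin_comb E c e (rk E) x"
      using s We unfolding sections_def by fast
    show ?thesis
      by (rule hol_fun_cong[OF _ c(1)[OF i]]) (use coef_lin_comb[of W e _ s c] We c(2) i in auto)
  qed
  then show "?ext \<and> ?car \<and> ?hol" using s by (auto simp: sections_def)
next
  assume s: "?ext \<and> ?car \<and> ?hol"
  have "\<exists>c. (\<forall>i<rk E. hol_fun A (U \<inter> W) (c i)) \<and> (\<forall>x\<in>U \<inter> W. s x = lin_comb E c e (rk E) x)"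
    if We: "(W, e) \<in> frames E" for W e
    by (rule exI[of _ "coef e s"]) (use s We lin_comb_coef[of W e _ s] in auto)
  then show "s \<in> sections A E U" using s by (auto simp: sections_def)
qed

lemma section_closed: "s \<in> sections A E U \<Longrightarrow> x \<in> U \<Longrightarrow> s x \<in> carrier (fib E x)"
  by (simp add: sections_def)

lemma coef_hol: "s \<in> sections A E U \<Longrightarrow> (W, e) \<in> frames E \<Longrightarrow> i < rk E \<Longrightarrow>
    hol_fun A (U \<inter> W) (coef e s i)"
  by (simp add: sections_iff)

lemma sectionI:
  assumes "\<And>x. x \<in> U \<Longrightarrow> s x \<in> carrier (fib E x)"
    and "\<And>W e i. (W, e) \<in> frames E \<Longrightarrow> i < rk E \<Longrightarrow> hol_fun A (U \<inter> W) (coef e s i)"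
  shows "restrict s U \<in> sections A E U"
  using assms hol_fun_cong[of "U \<inter> _" "coef _ s _" "coef _ (restrict s U) _"]
  by (fastforce simp: sections_iff)

lemma section_restrict: "s \<in> sections A E U \<Longrightarrow> W \<subseteq> U \<Longrightarrow> restrict s W \<in> sections A E W"
  by (rule sectionI) (auto simp: section_closed intro: hol_fun_mono[OF coef_hol])

lemma section_add:
  assumes "s \<in> sections A E U" "t \<in> sections A E U"
  shows "sec_add E U s t \<in> sections A E U"
  unfolding sec_add_def
proof (rule sectionI)
  fix x assume "x \<in> U"
  interpret M: Module.module CC "fib E x" by (rule fib)
  show "s x \<oplus>\<^bsub>fib E x\<^esub> t x \<in> carrier (fib E x)"
    using assms \<open>x \<in> U\<close> by (simp add: section_closed)
next
  fix W e i assume We: "(W, e) \<in> frames E" "i < rk E"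
  show "hol_fun A (U \<inter> W) (coef e (\<lambda>x. s x \<oplus>\<^bsub>fib E x\<^esub> t x) i)"
    by (rule hol_fun_cong[OF _ hol_fun_add[OF coef_hol[OF assms(1) We] coef_hol[OF assms(2) We]]])
      (use We assms in \<open>auto simp: coord_add[OF fib frame_basis] section_closed\<close>)
qed

lemma section_smult:
  assumes "s \<in> sections A E U" "hol_fun A U f"
  shows "sec_smult E U f s \<in> sections A E U"
  unfolding sec_smult_def
proof (rule sectionI)
  fix x assume "x \<in> U"
  then show "f x \<odot>\<^bsub>fib E x\<^esub> s x \<in> carrier (fib E x)"
    using assms by (simp add: section_closed vspace_smult_closed[OF fib])
next
  fix W e i assume We: "(W, e) \<in> frames E" "i < rk E"
  show "hol_fun A (U \<inter> W) (coef e (\<lambda>x. f x \<odot>\<^bsub>fib E x\<^esub> s x) i)"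
    by (rule hol_fun_cong[OF _ hol_fun_mult[OF hol_fun_mono[OF assms(2)] coef_hol[OF assms(1) We]]])
      (use We assms in \<open>auto simp: coord_smult[OF fib frame_basis] section_closed\<close>)
qed

lemma section_zero: "sec_zero E U \<in> sections A E U"
  unfolding sec_zero_def
proof (rule sectionI)
  fix x
  interpret M: Module.module CC "fib E x" by (rule fib)
  show "\<zero>\<^bsub>fib E x\<^esub> \<in> carrier (fib E x)" by simp
next
  fix W e i assume We: "(W, e) \<in> frames E" "i < rk E"
  have "coef e (\<lambda>x. \<zero>\<^bsub>fib E x\<^esub>) i x = 0" if "x \<in> U \<inter> W" for x
  proof -
    interpret M: Module.module CC "fib E x" by (rule fib)
    show ?thesis
      using coord_smult[OF fib frame_basis[OF We(1), of x] M.zero_closed We(2), of 0] that by simp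
  qed
  then show "hol_fun A (U \<inter> W) (coef e (\<lambda>x. \<zero>\<^bsub>fib E x\<^esub>) i)"
    by (intro hol_fun_cong[OF _ hol_fun_const[of _ 0]]) simp
qed

lemma lin_comb_Suc:
  assumes "\<And>i. i < Suc n \<Longrightarrow> s i x \<in> carrier (fib E x)"
  shows "lin_comb E c s (Suc n) x = lin_comb E c s n x \<oplus>\<^bsub>fib E x\<^esub> c n x \<odot>\<^bsub>fib E x\<^esub> s n x"
proof -
  interpret M: Module.module CC "fib E x" by (rule fib)
  have "(\<Oplus>\<^bsub>fib E x\<^esub>i\<in>insert n {..<n}. c i x \<odot>\<^bsub>fib E x\<^esub> s i x) =
    c n x \<odot>\<^bsub>fib E x\<^esub> s n x \<oplus>\<^bsub>fib E x\<^esub> (\<Oplus>\<^bsub>fib E x\<^esub>i\<in>{..<n}. c i x \<odot>\<^bsub>fib E x\<^esub> s i x)"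
    by (rule M.finsum_insert) (auto simp: assms)
  then show ?thesis
    using assms by (simp add: lin_comb_def lessThan_Suc M.a_comm Pi_def)
qed

lemma lin_comb_0: "lin_comb E c s 0 x = \<zero>\<^bsub>fib E x\<^esub>"
proof -
  interpret M: Module.module CC "fib E x" by (rule fib)
  show ?thesis by (simp add: lin_comb_def)
qed

text \<open>Sheaf maps and germs are additive for two sections at a time. Splitting off the last
  summand, as an equation between sections, lets them be evaluated on a linear combination by
  induction.\<close>

lemma lin_comb_partial:
  assumes "\<And>i. i < Suc n \<Longrightarrow> s i \<in> sections A E U"
  shows "restrict (lin_comb E c s (Suc n)) U =
    sec_add E U (restrict (lin_comb E c s n) U) (sec_smult E U (c n) (s n))"
proof
  fix x
  show "restrict (lin_comb E c s (Suc n)) U x =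
      sec_add E U (restrict (lin_comb E c s n) U) (sec_smult E U (c n) (s n)) x"
    using lin_comb_Suc[of n s x c] section_closed[OF assms]
    by (cases "x \<in> U") (simp_all add: sec_add_def sec_smult_def)
qed

lemma section_lin_comb:
  assumes "\<And>i. i < n \<Longrightarrow> s i \<in> sections A E U" "\<And>i. i < n \<Longrightarrow> hol_fun A U (c i)"
  shows "restrict (lin_comb E c s n) U \<in> sections A E U"
  using assms
proof (induction n)
  case 0
  have "restrict (lin_comb E c s 0) U = sec_zero E U"
    by (auto simp: sec_zero_def lin_comb_0 fun_eq_iff)
  then show ?case using section_zero by simp
next
  case (Suc n)
  have IH: "restrict (lin_comb E c s n) U \<in> sections A E U"
    by (rule Suc.IH) (simp_all add: Suc.prems)
  have "sec_add E U (restrict (lin_comb E c s n) U) (sec_smult E U (c n) (s n)) \<in> sections A E U"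
    by (intro section_add section_smult IH Suc.prems) simp_all
  then show ?case using lin_comb_partial[OF Suc.prems(1), of n] by simp
qed

end

locale hol_vb = frame_bundle A E for A :: "'x::t2_space chart set" and E :: "('x, 'e) vbundle" +
  assumes frame_section: "(W, e) \<in> frames E \<Longrightarrow> j < rk E \<Longrightarrow> restrict (e j) W \<in> sections A E W"
begin

text \<open>A frame of the atlas cut down to its overlap with U, so that its members are extensional
  there and hence sections. One and the same frame serves every section over U.\<close>

lemma local_frame:
  assumes "open U" "x \<in> U"
  obtains W e where "open W" "x \<in> W" "W \<subseteq> U"
    "\<And>i. i < rk E \<Longrightarrow> e i \<in> sections A E W"
    "\<And>y. y \<in> W \<Longrightarrow> is_basis (fib E y) (rk E) (\<lambda>i. e i y)"
    "\<And>s. s \<in> sections A E U \<Longrightarrow> \<exists>c. (\<forall>i<rk E. hol_fun A W (c i)) \<and>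
      (\<forall>y\<in>W. s y = lin_comb E c e (rk E) y)"
proof -
  obtain W e where We: "(W, e) \<in> frames E" "x \<in> W" using frames_cover by blast
  define e' where "e' i = restrict (e i) (U \<inter> W)" for i
  have eq: "e' i = restrict (restrict (e i) W) (U \<inter> W)" for i
    by (auto simp: e'_def fun_eq_iff)
  show ?thesis
  proof (rule that[of "U \<inter> W" e'])
    show "open (U \<inter> W)" using assms(1) frame_open[OF We(1)] by blast
    show "e' i \<in> sections A E (U \<inter> W)" if "i < rk E" for i
      unfolding eq by (rule section_restrict[OF frame_section[OF We(1) that]]) simp
    show "is_basis (fib E y) (rk E) (\<lambda>i. e' i y)" if "y \<in> U \<inter> W" for y
      using frame_basis[OF We(1), of y] that by (simp add: e'_def)
    show "\<exists>c. (\<forall>i<rk E. hol_fun A (U \<inter> W) (c i)) \<and> (\<forall>y\<in>U \<inter> W. s y = lin_comb E c e' (rk E) y)"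
      if s: "s \<in> sections A E U" for s
    proof (intro exI[of _ "coef e s"] conjI ballI allI impI)
      show "hol_fun A (U \<inter> W) (coef e s i)" if "i < rk E" for i
        by (rule coef_hol[OF s We(1) that])
      show "s y = lin_comb E (coef e s) e' (rk E) y" if y: "y \<in> U \<inter> W" for y
        using lin_comb_coef[OF We(1), of y s] section_closed[OF s, of y] y
        by (simp add: lin_comb_def e'_def)
    qed
  qed (use assms We in auto)
qed

text \<open>Keep the coordinates of v constant in a local frame.\<close>

lemma section_extend:
  assumes "v \<in> carrier (fib E x)"
  obtains U s where "open U" "x \<in> U" "s \<in> sections A E U" "s x = v"
proof -
  obtain W e where W: "open W" "x \<in> W" "\<And>i. i < rk E \<Longrightarrow> e i \<in> sections A E W"
    "\<And>y. y \<in> W \<Longrightarrow> is_basis (fib E y) (rk E) (\<lambda>i. e i y)"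
    by (rule local_frame[of UNIV x]) auto
  define c where "c = (\<lambda>i (y :: 'x). coord (fib E x) (rk E) (\<lambda>i. e i x) v i)"
  show ?thesis
  proof (rule that[of W "restrict (lin_comb E c e (rk E)) W"])
    show "restrict (lin_comb E c e (rk E)) W \<in> sections A E W"
      by (rule section_lin_comb) (simp_all add: W(3) c_def hol_fun_const)
    show "restrict (lin_comb E c e (rk E)) W x = v"
      using W(2) coord_expand[OF fib W(4)[OF W(2)] assms] by (simp add: lin_comb_def c_def)
  qed (use W in auto)
qed

end

lemmas frame_bundleI = frame_bundle.intro[OF surface.intro frame_bundle_axioms.intro]

text \<open>The transition condition of \<open>hol_bundle\<close>, read for one frame member against
  all frames, says that this member is a section.\<close>

lemma hol_vbI:
  assumes "riemann_surface A" "hol_bundle A E"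
  shows "hol_vb A E"
proof -
  have E: "\<And>x. vspace (fib E x)" "(\<Union>(U, e)\<in>frames E. U) = UNIV"
    "\<And>U e. (U, e) \<in> frames E \<Longrightarrow> open U \<and> (\<forall>x\<in>U. is_basis (fib E x) (rk E) (\<lambda>i. e i x))"
    using assms(2) unfolding hol_bundle_def by auto
  have trans: "\<forall>(U, e)\<in>frames E. \<forall>(W, f)\<in>frames E. \<forall>j<rk E. \<exists>c.
        (\<forall>i<rk E. hol_fun A (U \<inter> W) (c i)) \<and>
        (\<forall>x\<in>U \<inter> W. f j x = lin_comb E c e (rk E) x)"
    using assms(2) unfolding hol_bundle_def by (elim conjE)
  interpret frame_bundle A E
  proof (rule frame_bundleI)
    show "\<exists>W e. (W, e) \<in> frames E \<and> x \<in> W" for x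
    proof -
      have "x \<in> (\<Union>(U, e)\<in>frames E. U)" by (simp only: E(2) UNIV_I)
      then show ?thesis by auto
    qed
  qed (use assms(1) E in auto)
  show ?thesis
  proof
    fix W f j assume Wf: "(W, f) \<in> frames E" "j < rk E"
    show "restrict (f j) W \<in> sections A E W"
    proof (rule sectionI)
      fix U e i assume Ue: "(U, e) \<in> frames E" "i < rk E"
      obtain c where c: "\<forall>i<rk E. hol_fun A (U \<inter> W) (c i)"
        "\<forall>x\<in>U \<inter> W. f j x = lin_comb E c e (rk E) x"
        using bspec[OF bspec[OF trans Ue(1), simplified] Wf(1)] Wf(2) by auto
      show "hol_fun A (W \<inter> U) (coef e (f j) i)"
        by (rule hol_fun_cong[of _ "c i"])
          (use c Ue coef_lin_comb[OF Ue(1), of _ "f j" c i] in \<open>auto simp: Int_commute\<close>)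
    qed (use frame_closed[OF Wf(1) _ Wf(2)] in auto)
  qed
qed

subsection \<open>Dual bundles\<close>

lemma dual_bundle_simps [simp]:
  "rk (dual_bundle E) = rk E" "fib (dual_bundle E) x = dual (fib E x)"
  by (simp_all add: dual_bundle_def)

lemma coord_dual:
  assumes M: "vspace M" and b: "is_basis M n b" and l: "\<And>i. i < n \<Longrightarrow> l i \<in> carrier (dual M)"
    and delta: "\<And>i j. i < n \<Longrightarrow> j < n \<Longrightarrow> l i (b j) = (if i = j then 1 else 0)"
    and m: "m \<in> carrier (dual M)" and j: "j < n"
  shows "coord (dual M) n l m j = m (b j)"
proof -
  let ?c = "coord (dual M) n l m"
  have "m (b j) = finsum (dual M) (\<lambda>i. ?c i \<odot>\<^bsub>dual M\<^esub> l i) {..<n} (b j)"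
    using coord_expand[OF vspace_dual[OF M] is_basis_dual[OF M b l delta] m] by metis
  also have "\<dots> = (\<Sum>i<n. ?c i * l i (b j))"
    by (subst dual_finsum[OF M]) (simp_all add: l vspace_smult_closed[OF vspace_dual[OF M]], simp add: dual_simps)
  also have "\<dots> = (\<Sum>i<n. if i = j then ?c i else 0)"
    by (rule sum.cong) (use delta j in auto)
  finally show ?thesis using j by simp
qed

context frame_bundle
begin

lemma dual_frameD:
  assumes "(W, l) \<in> frames (dual_bundle E)"
  obtains e where "(W, e) \<in> frames E" "\<And>x i. x \<in> W \<Longrightarrow> i < rk E \<Longrightarrow> l i x \<in> carrier (dual (fib E x))"
    "\<And>x i j. x \<in> W \<Longrightarrow> i < rk E \<Longrightarrow> j < rk E \<Longrightarrow> l i x (e j x) = (if i = j then 1 else 0)"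
  using assms by (fastforce simp: dual_bundle_def)

lemma dual_frame:
  assumes "(W, e) \<in> frames E"
  shows "(W, \<lambda>i x. dual_elt (fib E x) (rk E) (\<lambda>i. e i x) i) \<in> frames (dual_bundle E)"
  using assms dual_elt[OF fib frame_basis] by (auto simp: dual_bundle_def)

lemma frame_bundle_dual: "frame_bundle A (dual_bundle E)"
proof (rule frame_bundleI[OF A])
  fix x
  show "vspace (fib (dual_bundle E) x)" by (simp add: vspace_dual[OF fib])
  show "\<exists>W e. (W, e) \<in> frames (dual_bundle E) \<and> x \<in> W"
    using frames_cover[of x] dual_frame by blast
next
  fix W l assume Wl: "(W, l) \<in> frames (dual_bundle E)"
  obtain e where e: "(W, e) \<in> frames E" "\<And>x i. x \<in> W \<Longrightarrow> i < rk E \<Longrightarrow> l i x \<in> carrier (dual (fib E x))"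
    "\<And>x i j. x \<in> W \<Longrightarrow> i < rk E \<Longrightarrow> j < rk E \<Longrightarrow> l i x (e j x) = (if i = j then 1 else 0)"
    using dual_frameD[OF Wl] by blast
  show "open W" by (rule frame_open[OF e(1)])
  show "is_basis (fib (dual_bundle E) x) (rk (dual_bundle E)) (\<lambda>i. l i x)" if "x \<in> W" for x
    using is_basis_dual[OF fib frame_basis[OF e(1) that]] e(2,3) that by simp
qed

text \<open>The coordinates of \<sigma> in a dual frame are its values on the original frame, by
  \<open>coord_dual\<close>. Holomorphy can therefore be tested on the frames of E, and the frames
  of the dual bundle disappear from later arguments.\<close>

lemma dual_sections_iff:
  "\<sigma> \<in> sections A (dual_bundle E) U \<longleftrightarrow>
    \<sigma> \<in> extensional U \<and> (\<forall>x\<in>U. \<sigma> x \<in> carrier (dual (fib E x))) \<and>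
    (\<forall>W e j. (W, e) \<in> frames E \<longrightarrow> j < rk E \<longrightarrow> hol_fun A (U \<inter> W) (\<lambda>y. \<sigma> y (e j y)))"
proof -
  interpret D: frame_bundle A "dual_bundle E" by (rule frame_bundle_dual)
  show ?thesis
    unfolding D.sections_iff dual_bundle_simps
  proof (intro conj_cong refl iffI allI impI)
    fix W e j assume car: "\<forall>x\<in>U. \<sigma> x \<in> carrier (dual (fib E x))"
      and hol: "\<forall>W e i. (W, e) \<in> frames (dual_bundle E) \<longrightarrow> i < rk E \<longrightarrow> hol_fun A (U \<inter> W)
          (\<lambda>y. coord (dual (fib E y)) (rk E) (\<lambda>i. e i y) (\<sigma> y) i)"
      and We: "(W, e) \<in> frames E" and j: "j < rk E"
    show "hol_fun A (U \<inter> W) (\<lambda>y. \<sigma> y (e j y))"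
      by (rule hol_fun_cong[OF _ hol[rule_format, OF dual_frame[OF We] j]])
        (use j car in \<open>auto intro!: coord_dual[OF fib frame_basis[OF We]] dual_elt[OF fib frame_basis[OF We]]\<close>)
  next
    fix W l j assume car: "\<forall>x\<in>U. \<sigma> x \<in> carrier (dual (fib E x))"
      and hol: "\<forall>W e j. (W, e) \<in> frames E \<longrightarrow> j < rk E \<longrightarrow> hol_fun A (U \<inter> W) (\<lambda>y. \<sigma> y (e j y))"
      and Wl: "(W, l) \<in> frames (dual_bundle E)" and j: "j < rk E"
    obtain e where e: "(W, e) \<in> frames E" "\<And>x i. x \<in> W \<Longrightarrow> i < rk E \<Longrightarrow> l i x \<in> carrier (dual (fib E x))"
      "\<And>x i j. x \<in> W \<Longrightarrow> i < rk E \<Longrightarrow> j < rk E \<Longrightarrow> l i x (e j x) = (if i = j then 1 else 0)"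
      using dual_frameD[OF Wl] by blast
    show "hol_fun A (U \<inter> W) (\<lambda>y. coord (dual (fib E y)) (rk E) (\<lambda>i. l i y) (\<sigma> y) j)"
      by (rule hol_fun_cong[OF _ hol[rule_format, OF e(1) j]])
        (use j car e(2,3) in \<open>auto intro!: coord_dual[OF fib frame_basis[OF e(1)], symmetric]\<close>)
  qed
qed

end

text \<open>If l is dual to the frame e, then l i applied to a member f j of another frame is the
  i-th coordinate of f j with respect to e. It is holomorphic because f j is a section, so no matrix
  has to be inverted.\<close>

lemma (in hol_vb) hol_vb_dual: "hol_vb A (dual_bundle E)"
proof -
  interpret D: frame_bundle A "dual_bundle E" by (rule frame_bundle_dual)
  show ?thesis
  proof
    fix W l i assume Wl: "(W, l) \<in> frames (dual_bundle E)" and i: "i < rk (dual_bundle E)"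
    obtain e where e: "(W, e) \<in> frames E" "\<And>x i. x \<in> W \<Longrightarrow> i < rk E \<Longrightarrow> l i x \<in> carrier (dual (fib E x))"
      "\<And>x i j. x \<in> W \<Longrightarrow> i < rk E \<Longrightarrow> j < rk E \<Longrightarrow> l i x (e j x) = (if i = j then 1 else 0)"
      using dual_frameD[OF Wl] by blast
    have "hol_fun A (W \<inter> U) (\<lambda>y. restrict (l i) W y (f j y))"
      if Uf: "(U, f) \<in> frames E" and j: "j < rk E" for U f j
      unfolding Int_commute[of W U]
    proof (rule hol_fun_cong[OF _ coef_hol[OF frame_section[OF Uf j] e(1)]])
      fix y assume y: "y \<in> U \<inter> W"
      have fj: "f j y \<in> carrier (fib E y)" using frame_closed[OF Uf _ j] y by blast
      have li: "l i y \<in> carrier (dual (fib E y))" using e(2) y i by simp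
      have ec: "e k y \<in> carrier (fib E y)" if "k < rk E" for k
        using frame_closed[OF e(1) _ that] y by blast
      have "l i y (f j y) = l i y (lin_comb E (coef e (f j)) e (rk E) y)"
        using lin_comb_coef[OF e(1), of y "f j"] fj y by simp
      also have "\<dots> = (\<Sum>k<rk E. coef e (f j) k y * l i y (e k y))"
        unfolding lin_comb_def using ec
        by (subst dual_finsum_arg[OF li fib]) (simp_all add: vspace_smult_closed[OF fib] dual_smult[OF li])
      also have "\<dots> = (\<Sum>k<rk E. if k = i then coef e (f j) k y else 0)"
        by (rule sum.cong) (use e(3) y i in auto)
      finally show "coef e (restrict (f j) U) i y = restrict (l i) W y (f j y)"
        using i y by simp
    qed (use i in auto)
    then show "restrict (l i) W \<in> sections A (dual_bundle E) W"
      unfolding dual_sections_iff using e(2) i by auto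
  qed
qed

subsection \<open>The tangent bundle and the anchor\<close>

context surface
begin

abbreviation jac :: "'x chart \<Rightarrow> 'x chart \<Rightarrow> 'x \<Rightarrow> complex"
  where "jac a b x \<equiv> deriv (snd b \<circ> chart_inv a) (snd a x)"

text \<open>Identities between coordinate changes hold only near the coordinate of x, since
  \<open>chart_inv\<close> is arbitrary off the image of the chart. Derivatives need no more than
  that.\<close>

lemma eventually_chart:
  assumes "a \<in> charts_at A x" "open U" "x \<in> U" "\<And>y. y \<in> U \<Longrightarrow> y \<in> fst a \<Longrightarrow> Q (snd a y)"
  shows "\<forall>\<^sub>F z in nhds (snd a x). Q z"
  unfolding eventually_nhds
proof (intro exI conjI ballI)
  have a: "a \<in> A" "x \<in> fst a" using assms(1) by (simp_all add: charts_at_def)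
  show "open (snd a ` (U \<inter> fst a))" by (rule chart_image_open[OF a(1) assms(2)])
  show "snd a x \<in> snd a ` (U \<inter> fst a)" using a(2) assms(3) by blast
  show "Q z" if "z \<in> snd a ` (U \<inter> fst a)" for z using that assms(4) by blast
qed

lemma jac_self:
  assumes "a \<in> charts_at A x"
  shows "jac a a x = 1"
proof -
  have a: "a \<in> A" using assms by (simp add: charts_at_def)
  have "\<forall>\<^sub>F z in nhds (snd a x). (snd a \<circ> chart_inv a) z = z"
    by (rule eventually_chart[OF assms open_UNIV UNIV_I]) (simp add: chart_inv_snd[OF a])
  then have "jac a a x = deriv (\<lambda>z. z) (snd a x)" by (rule deriv_cong_ev) (rule refl)
  then show ?thesis by simp
qed

text \<open>The cocycle rule for coordinate changes; it makes the values of
  \<open>coord_field\<close> tangent vectors.\<close>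

lemma jac_chain:
  assumes a: "a \<in> charts_at A x" and b: "b \<in> charts_at A x" and c: "c \<in> charts_at A x"
  shows "jac a c x = jac b c x * jac a b x"
proof -
  have ch: "a \<in> A" "b \<in> A" "c \<in> A" "x \<in> fst a" "x \<in> fst b" "x \<in> fst c"
    using assms by (auto simp: charts_at_def)
  have "\<forall>\<^sub>F z in nhds (snd a x). (snd c \<circ> chart_inv a) z = ((snd c \<circ> chart_inv b) \<circ> (snd b \<circ> chart_inv a)) z"
    by (rule eventually_chart[OF a chart_open[OF ch(2)] ch(5)])
      (simp add: chart_inv_snd[OF ch(1)] chart_inv_snd[OF ch(2)])
  then have "jac a c x = deriv ((snd c \<circ> chart_inv b) \<circ> (snd b \<circ> chart_inv a)) (snd a x)"
    by (rule deriv_cong_ev) (rule refl)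
  also have "\<dots> = deriv (snd c \<circ> chart_inv b) ((snd b \<circ> chart_inv a) (snd a x)) * jac a b x"
  proof (rule deriv_chain)
    show "(snd b \<circ> chart_inv a) field_differentiable at (snd a x)"
      by (rule hol_fun_differentiable[OF hol_fun_chart[OF ch(2)] chart_open[OF ch(2)] ch(5) a])
    show "(snd c \<circ> chart_inv b) field_differentiable at ((snd b \<circ> chart_inv a) (snd a x))"
      using hol_fun_differentiable[OF hol_fun_chart[OF ch(3)] chart_open[OF ch(3)] ch(6) b]
      by (simp add: chart_inv_snd[OF ch(1,4)])
  qed
  finally show ?thesis by (simp add: chart_inv_snd[OF ch(1,4)])
qed

lemma tangent_simps:
  "\<zero>\<^bsub>tangent_space A x\<^esub> = (\<lambda>_. 0)" "v \<oplus>\<^bsub>tangent_space A x\<^esub> w = (\<lambda>a. v a + w a)"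
  "c \<odot>\<^bsub>tangent_space A x\<^esub> v = (\<lambda>a. c * v a)"
  by (simp_all add: tangent_space_def)

lemma tangentI:
  assumes "\<And>b. b \<notin> charts_at A x \<Longrightarrow> v b = 0"
    and "\<And>a b. a \<in> charts_at A x \<Longrightarrow> b \<in> charts_at A x \<Longrightarrow> v b = jac a b x * v a"
  shows "v \<in> carrier (tangent_space A x)"
  unfolding tangent_space_def partial_object.simps mem_Collect_eq
  by (intro conjI allI ballI impI assms)

lemma
  assumes "v \<in> carrier (tangent_space A x)"
  shows tangent_outside: "b \<notin> charts_at A x \<Longrightarrow> v b = 0"
    and tangent_transform: "a \<in> charts_at A x \<Longrightarrow> b \<in> charts_at A x \<Longrightarrow> v b = jac a b x * v a"
  using assms unfolding tangent_space_def partial_object.simps mem_Collect_eq by blast+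

lemma vspace_tangent: "vspace (tangent_space A x)"
proof (rule vspaceI)
  fix u v c assume u: "u \<in> carrier (tangent_space A x)" and v: "v \<in> carrier (tangent_space A x)"
  show "u \<oplus>\<^bsub>tangent_space A x\<^esub> v \<in> carrier (tangent_space A x)"
  proof (rule tangentI)
    fix a b assume "a \<in> charts_at A x" "b \<in> charts_at A x"
    then show "(u \<oplus>\<^bsub>tangent_space A x\<^esub> v) b = jac a b x * (u \<oplus>\<^bsub>tangent_space A x\<^esub> v) a"
      using tangent_transform[OF u, of a b] tangent_transform[OF v, of a b]
      by (simp add: tangent_simps distrib_left)
  qed (simp add: tangent_simps tangent_outside[OF u] tangent_outside[OF v])
next
  fix u c assume u: "u \<in> carrier (tangent_space A x)"
  show "c \<odot>\<^bsub>tangent_space A x\<^esub> u \<in> carrier (tangent_space A x)"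
  proof (rule tangentI)
    fix a b assume "a \<in> charts_at A x" "b \<in> charts_at A x"
    then show "(c \<odot>\<^bsub>tangent_space A x\<^esub> u) b = jac a b x * (c \<odot>\<^bsub>tangent_space A x\<^esub> u) a"
      using tangent_transform[OF u, of a b] by (simp add: tangent_simps)
  qed (simp add: tangent_simps tangent_outside[OF u])
next
  show "\<zero>\<^bsub>tangent_space A x\<^esub> \<in> carrier (tangent_space A x)"
    by (rule tangentI) (simp_all add: tangent_simps)
qed (simp_all add: tangent_simps algebra_simps)

lemma coord_field_closed:
  assumes "a \<in> charts_at A x"
  shows "coord_field A a x \<in> carrier (tangent_space A x)"
proof (rule tangentI)
  fix b c assume "b \<in> charts_at A x" "c \<in> charts_at A x"
  then show "coord_field A a x c = jac b c x * coord_field A a x b"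
    using jac_chain[OF assms, of b c] by (simp add: coord_field_def)
qed (simp add: coord_field_def)

lemma tangent_expand:
  assumes v: "v \<in> carrier (tangent_space A x)" and a: "a \<in> charts_at A x"
  shows "v = v a \<odot>\<^bsub>tangent_space A x\<^esub> coord_field A a x"
proof
  fix b
  show "v b = (v a \<odot>\<^bsub>tangent_space A x\<^esub> coord_field A a x) b"
    using tangent_outside[OF v, of b] tangent_transform[OF v a, of b]
    by (cases "b \<in> charts_at A x") (simp_all add: tangent_simps coord_field_def)
qed

lemma coord_field_self: "a \<in> charts_at A x \<Longrightarrow> coord_field A a x a = 1"
  by (simp add: coord_field_def jac_self)

lemma is_basis_tangent:
  assumes a: "a \<in> charts_at A x"
  shows "is_basis (tangent_space A x) 1 (\<lambda>_. coord_field A a x)"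
proof -
  have sum: "finsum (tangent_space A x) (\<lambda>i. c i \<odot>\<^bsub>tangent_space A x\<^esub> coord_field A a x) {..<(1::nat)}
    = c 0 \<odot>\<^bsub>tangent_space A x\<^esub> coord_field A a x" for c
    by (rule finsum_one[OF vspace_tangent vspace_smult_closed[OF vspace_tangent coord_field_closed[OF a]]])
  show ?thesis
    unfolding is_basis_def sum
  proof (intro conjI ballI)
    fix v assume v: "v \<in> carrier (tangent_space A x)"
    show "\<exists>!c. c \<in> extensional {..<(1::nat)} \<and> v = c 0 \<odot>\<^bsub>tangent_space A x\<^esub> coord_field A a x"
    proof (rule ex1I[of _ "restrict (\<lambda>_. v a) {..<1}"])
      show "restrict (\<lambda>_. v a) {..<1} \<in> extensional {..<(1::nat)} \<and>
        v = restrict (\<lambda>_. v a) {..<1} (0::nat) \<odot>\<^bsub>tangent_space A x\<^esub> coord_field A a x"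
        using tangent_expand[OF v a] by simp
    next
      fix c assume c: "c \<in> extensional {..<(1::nat)} \<and> v = c 0 \<odot>\<^bsub>tangent_space A x\<^esub> coord_field A a x"
      \<comment> \<open>The coordinate field of the chart a has component 1 in that chart, so
        comparing components forces the coefficient.\<close>
      then have "v a = c 0" by (metis coord_field_self[OF a] mult_cancel_left2 tangent_simps(3))
      then show "c = restrict (\<lambda>_. v a) {..<1}"
        using c by (intro extensionalityI[of c "{..<(1::nat)}"]) auto
    qed
  qed (simp add: coord_field_closed[OF a])
qed

lemma TX_simps [simp]: "rk (TX A) = 1" "fib (TX A) x = tangent_space A x"
  "frames (TX A) = {(fst a, \<lambda>_. coord_field A a) | a. a \<in> A}"
  by (simp_all add: TX_def)

lemma frame_bundle_TX: "frame_bundle A (TX A)"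
proof (rule frame_bundleI[OF A])
  show "\<exists>W e. (W, e) \<in> frames (TX A) \<and> x \<in> W" for x
    using charts_cover[of x] by auto
next
  fix W e assume "(W, e) \<in> frames (TX A)"
  then obtain a where a: "a \<in> A" "W = fst a" "e = (\<lambda>_. coord_field A a)" by auto
  then show "open W" by (simp add: chart_open)
  show "is_basis (fib (TX A) x) (rk (TX A)) (\<lambda>i. e i x)" if "x \<in> W" for x
    using is_basis_tangent[of a x] that a by (simp add: charts_at_def)
qed (simp add: vspace_tangent)

lemma coord_tangent:
  assumes "v \<in> carrier (tangent_space A x)" "a \<in> charts_at A x"
  shows "coord (tangent_space A x) 1 (\<lambda>_. coord_field A a x) v 0 = v a"
proof (rule coord_unique[OF vspace_tangent is_basis_tangent[OF assms(2)], of _ "\<lambda>_. v a"])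
  show "v = (\<Oplus>\<^bsub>tangent_space A x\<^esub>i\<in>{..<(1::nat)}. v a \<odot>\<^bsub>tangent_space A x\<^esub> coord_field A a x)"
    by (rule trans[OF tangent_expand[OF assms] finsum_one[symmetric]])
      (intro vspace_smult_closed vspace_tangent coord_field_closed assms(2))+
qed simp

lemma TX_section_hol:
  assumes "s \<in> sections A (TX A) U" "a \<in> A"
  shows "hol_fun A (U \<inter> fst a) (\<lambda>y. s y a)"
proof -
  interpret T: frame_bundle A "TX A" by (rule frame_bundle_TX)
  have fr: "(fst a, \<lambda>_. coord_field A a) \<in> frames (TX A)"
    unfolding TX_simps using assms(2) by blast
  show ?thesis
    by (rule hol_fun_cong[OF _ T.coef_hol[OF assms(1) fr, of 0]])
      (use T.section_closed[OF assms(1)] assms(2) coord_tangent in \<open>simp_all add: charts_at_def\<close>)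
qed

lemma KX_sections_iff:
  "\<omega> \<in> sections A (KX A) U \<longleftrightarrow> \<omega> \<in> extensional U \<and>
    (\<forall>x\<in>U. \<omega> x \<in> carrier (dual (tangent_space A x))) \<and>
    (\<forall>a\<in>A. hol_fun A (U \<inter> fst a) (\<lambda>y. \<omega> y (coord_field A a y)))"
proof -
  interpret T: frame_bundle A "TX A" by (rule frame_bundle_TX)
  show ?thesis unfolding T.dual_sections_iff by (auto 0 3)
qed

lemma differential_closed: "differential A f x \<in> carrier (dual (tangent_space A x))"
proof (rule dualI)
  interpret M: Module.module CC "tangent_space A x" by (rule vspace_tangent)
  show "differential A f x (u \<oplus>\<^bsub>tangent_space A x\<^esub> v) = differential A f x u + differential A f x v"
    if "u \<in> carrier (tangent_space A x)" "v \<in> carrier (tangent_space A x)" for u v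
    using M.a_closed[OF that] that
    by (simp add: differential_def Let_def tangent_simps algebra_simps)
  show "differential A f x (c \<odot>\<^bsub>tangent_space A x\<^esub> u) = c * differential A f x u"
    if "u \<in> carrier (tangent_space A x)" for c u
    using M.smult_closed[of c, OF _ that] that
    by (simp add: differential_def Let_def tangent_simps algebra_simps)
qed (simp add: differential_def)

text \<open>The differential is computed in some unspecified chart b. The derivative of the change
  from b to a that appears is the factor by which the components of v transform, so the component in
  a results.\<close>

lemma differential_chart:
  assumes a: "a \<in> charts_at A x" and v: "v \<in> carrier (tangent_space A x)"
  shows "differential A (\<lambda>y. snd a y - snd a x) x v = v a"
proof -
  define b where "b = (SOME b. b \<in> charts_at A x)"
  have b: "b \<in> charts_at A x" unfolding b_def using a by (rule someI)
  have "(snd a \<circ> chart_inv b) field_differentiable at (snd b x)"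
    using a by (intro hol_fun_differentiable[OF hol_fun_chart _ _ b]) (auto simp: charts_at_def chart_open)
  then have "deriv (\<lambda>z. (snd a \<circ> chart_inv b) z - snd a x) (snd b x) = jac b a x"
    by (subst deriv_diff) (auto simp: )
  then have "differential A (\<lambda>y. snd a y - snd a x) x v = jac b a x * v b"
    using v by (simp add: differential_def b_def[symmetric] o_def)
  then show ?thesis using tangent_transform[OF v b a] by simp
qed

end

section \<open>The dual anchor on covectors and on differential forms\<close>

locale anchored_vb = hol_vb A V for A :: "'x::t2_space chart set" and V :: "('x, 'v) vbundle" +
  fixes \<phi> :: "('x, 'v) anchor"
  assumes anchor: "bundle_hom A V (TX A) \<phi>"
begin

lemma anchor_linear: "\<phi> x \<in> linear_maps (fib V x) (tangent_space A x)"
  using anchor by (auto simp: bundle_hom_def)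

lemma dual_anchor_closed:
  assumes "\<omega> \<in> carrier (dual (tangent_space A x))"
  shows "dual_anchor V \<phi> x \<omega> \<in> carrier (dual (fib V x))"
proof -
  interpret M: Module.module CC "fib V x" by (rule fib)
  show ?thesis
    by (rule dualI) (auto simp: dual_anchor_def linear_add[OF anchor_linear] linear_smult[OF anchor_linear]
        dual_add[OF assms] dual_smult[OF assms] linear_closed[OF anchor_linear])
qed

text \<open>On a frame member e j the pulled back form is the component of \<phi> (e j) in a chart
  times the value of \<omega> on the coordinate field, and both factors are holomorphic. The product
  formula needs a chart, which is why holomorphy is checked locally.\<close>

lemma dual_anchor_section:
  assumes U: "open U" and \<omega>: "\<omega> \<in> sections A (KX A) U"
  shows "restrict (\<lambda>y. dual_anchor V \<phi> y (\<omega> y)) U \<in> sections A (dual_bundle V) U"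
  unfolding dual_sections_iff
proof (intro conjI allI impI ballI)
  have \<omega>_closed: "\<omega> y \<in> carrier (dual (tangent_space A y))" if "y \<in> U" for y
    using \<omega> that by (simp add: KX_sections_iff)
  then show "restrict (\<lambda>y. dual_anchor V \<phi> y (\<omega> y)) U x \<in> carrier (dual (fib V x))" if "x \<in> U" for x
    using that by (simp add: dual_anchor_closed)
  fix W e j assume We: "(W, e) \<in> frames V" and j: "j < rk V"
  show "hol_fun A (U \<inter> W) (\<lambda>y. restrict (\<lambda>y. dual_anchor V \<phi> y (\<omega> y)) U y (e j y))"
  proof (rule hol_fun_local)
    show "open (U \<inter> W)" using U frame_open[OF We] by blast
    fix x assume "x \<in> U \<inter> W"
    obtain a where a: "a \<in> A" "x \<in> fst a" using charts_cover by blast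
    have "restrict (\<lambda>y. \<phi> y (restrict (e j) W y)) W \<in> sections A (TX A) W"
      using anchor frame_open[OF We] frame_section[OF We j] unfolding bundle_hom_def by blast
    then have "hol_fun A (W \<inter> fst a) (\<lambda>y. restrict (\<lambda>y. \<phi> y (restrict (e j) W y)) W y a)"
      by (rule TX_section_hol[OF _ a(1)])
    then have 1: "hol_fun A (U \<inter> W \<inter> fst a) (\<lambda>y. restrict (\<lambda>y. \<phi> y (restrict (e j) W y)) W y a)"
      by (rule hol_fun_mono) blast
    have "hol_fun A (U \<inter> fst a) (\<lambda>y. \<omega> y (coord_field A a y))"
      using \<omega> a(1) by (simp add: KX_sections_iff)
    then have 2: "hol_fun A (U \<inter> W \<inter> fst a) (\<lambda>y. \<omega> y (coord_field A a y))"
      by (rule hol_fun_mono) blast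
    have "hol_fun A (U \<inter> W \<inter> fst a) (\<lambda>y. restrict (\<lambda>y. dual_anchor V \<phi> y (\<omega> y)) U y (e j y))"
    proof (rule hol_fun_cong[OF _ hol_fun_mult[OF 1 2]])
      fix y assume y: "y \<in> U \<inter> W \<inter> fst a"
      have ay: "a \<in> charts_at A y" using a(1) y by (simp add: charts_at_def)
      have ej: "e j y \<in> carrier (fib V y)" using frame_closed[OF We _ j] y by blast
      have "\<omega> y (\<phi> y (e j y)) = \<omega> y (\<phi> y (e j y) a \<odot>\<^bsub>tangent_space A y\<^esub> coord_field A a y)"
        using tangent_expand[OF linear_closed[OF anchor_linear ej] ay] by simp
      also have "\<dots> = \<phi> y (e j y) a * \<omega> y (coord_field A a y)"
        using y by (intro dual_smult[OF \<omega>_closed coord_field_closed[OF ay]]) blast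
      finally show "restrict (\<lambda>y. \<phi> y (restrict (e j) W y)) W y a * \<omega> y (coord_field A a y) =
          restrict (\<lambda>y. dual_anchor V \<phi> y (\<omega> y)) U y (e j y)"
        using y ej by (simp add: dual_anchor_def)
    qed
    then show "\<exists>Z. open Z \<and> x \<in> Z \<and> hol_fun A (U \<inter> W \<inter> Z)
        (\<lambda>y. restrict (\<lambda>y. dual_anchor V \<phi> y (\<omega> y)) U y (e j y))"
      using a chart_open[OF a(1)] by blast
  qed
qed simp

end

subsection \<open>Stalks\<close>

lemma germ_eq_iff: "germ x s = germ x t \<longleftrightarrow> (\<forall>\<^sub>F y in nhds x. s y = t y)"
proof
  assume "germ x s = germ x t"
  moreover have "s \<in> germ x s" by (simp add: germ_def)
  ultimately show "\<forall>\<^sub>F y in nhds x. s y = t y" by (auto simp: germ_def)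
next
  assume eq: "\<forall>\<^sub>F y in nhds x. s y = t y"
  have "(\<forall>\<^sub>F y in nhds x. u y = s y) \<longleftrightarrow> (\<forall>\<^sub>F y in nhds x. u y = t y)" for u
  proof
    show "\<forall>\<^sub>F y in nhds x. u y = t y" if "\<forall>\<^sub>F y in nhds x. u y = s y"
      using that eq by eventually_elim simp
    show "\<forall>\<^sub>F y in nhds x. u y = s y" if "\<forall>\<^sub>F y in nhds x. u y = t y"
      using that eq by eventually_elim simp
  qed
  then show "germ x s = germ x t" by (simp add: germ_def)
qed

lemma germ_eqI: "open U \<Longrightarrow> x \<in> U \<Longrightarrow> (\<And>y. y \<in> U \<Longrightarrow> s y = t y) \<Longrightarrow> germ x s = germ x t"
  unfolding germ_eq_iff by (auto simp: eventually_nhds)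

lemma germ_value: "t \<in> germ x s \<Longrightarrow> t x = s x"
  by (auto simp: germ_def dest: eventually_nhds_x_imp_x)

lemma stalk_zero: "\<zero>\<^bsub>stalk A E x\<^esub> = germ x (\<lambda>y. \<zero>\<^bsub>fib E y\<^esub>)"
  by (simp add: stalk_def)

text \<open>Addition on the stalk is a union over all representatives. Any two representatives of a
  germ agree near x, so all members of the union coincide.\<close>

lemma stalk_add:
  "germ x s \<oplus>\<^bsub>stalk A E x\<^esub> germ x t = germ x (\<lambda>y. s y \<oplus>\<^bsub>fib E y\<^esub> t y)"
proof -
  have "germ x (\<lambda>y. s' y \<oplus>\<^bsub>fib E y\<^esub> t' y) = germ x (\<lambda>y. s y \<oplus>\<^bsub>fib E y\<^esub> t y)"
    if "s' \<in> germ x s" "t' \<in> germ x t" for s' t'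
    unfolding germ_eq_iff using that unfolding germ_def mem_Collect_eq by eventually_elim simp
  moreover have "s \<in> germ x s" "t \<in> germ x t" by (simp_all add: germ_def)
  ultimately have "(\<Union>s'\<in>germ x s. \<Union>t'\<in>germ x t. germ x (\<lambda>y. s' y \<oplus>\<^bsub>fib E y\<^esub> t' y)) =
      germ x (\<lambda>y. s y \<oplus>\<^bsub>fib E y\<^esub> t y)"
    by blast
  then show ?thesis by (simp add: stalk_def)
qed

lemma stalk_smult: "c \<odot>\<^bsub>stalk A E x\<^esub> germ x s = germ x (\<lambda>y. c \<odot>\<^bsub>fib E y\<^esub> s y)"
proof -
  have "germ x (\<lambda>y. c \<odot>\<^bsub>fib E y\<^esub> s' y) = germ x (\<lambda>y. c \<odot>\<^bsub>fib E y\<^esub> s y)"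
    if "s' \<in> germ x s" for s'
    unfolding germ_eq_iff using that unfolding germ_def mem_Collect_eq by eventually_elim simp
  moreover have "s \<in> germ x s" by (simp add: germ_def)
  ultimately have "(\<Union>s'\<in>germ x s. germ x (\<lambda>y. c \<odot>\<^bsub>fib E y\<^esub> s' y)) = germ x (\<lambda>y. c \<odot>\<^bsub>fib E y\<^esub> s y)"
    by blast
  then show ?thesis by (simp add: stalk_def)
qed

context frame_bundle
begin

lemma stalkI: "open U \<Longrightarrow> x \<in> U \<Longrightarrow> s \<in> sections A E U \<Longrightarrow> germ x s \<in> carrier (stalk A E x)"
  by (auto simp: stalk_def)

lemma stalk_cases:
  assumes "g \<in> carrier (stalk A E x)"
  obtains U s where "open U" "x \<in> U" "s \<in> sections A E U" "g = germ x s"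
  using assms by (auto simp: stalk_def)

lemma germ_sec_add: "open U \<Longrightarrow> x \<in> U \<Longrightarrow> germ x (sec_add E U s t) = germ x s \<oplus>\<^bsub>stalk A E x\<^esub> germ x t"
  unfolding stalk_add by (rule germ_eqI[of U]) (auto simp: sec_add_def)

lemma germ_sec_smult: "open U \<Longrightarrow> x \<in> U \<Longrightarrow> germ x (sec_smult E U (\<lambda>_. c) s) = c \<odot>\<^bsub>stalk A E x\<^esub> germ x s"
  unfolding stalk_smult by (rule germ_eqI[of U]) (auto simp: sec_smult_def)

lemma germ_restrict: "open U \<Longrightarrow> x \<in> U \<Longrightarrow> germ x (restrict s U) = germ x s"
  by (rule germ_eqI[of U]) auto

lemma germ_sec_zero: "open U \<Longrightarrow> x \<in> U \<Longrightarrow> germ x (sec_zero E U) = \<zero>\<^bsub>stalk A E x\<^esub>"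
  unfolding stalk_zero by (rule germ_eqI[of U]) (auto simp: sec_zero_def)

text \<open>Representatives live over different neighbourhoods. On their intersection all values lie
  in the fibers, and each axiom holds there fiber by fiber.\<close>

lemma vspace_stalk: "vspace (stalk A E x)"
proof (rule vspaceI)
  fix g h assume "g \<in> carrier (stalk A E x)" "h \<in> carrier (stalk A E x)"
  then obtain U s W t where s: "open U" "x \<in> U" "s \<in> sections A E U" "g = germ x s"
    and t: "open W" "x \<in> W" "t \<in> sections A E W" "h = germ x t"
    by (metis stalk_cases)
  have UW: "open (U \<inter> W)" "x \<in> U \<inter> W" using s t by auto
  have closed: "y \<in> U \<inter> W \<Longrightarrow> s y \<in> carrier (fib E y) \<and> t y \<in> carrier (fib E y)" for y
    using section_closed s(3) t(3) by blast
  have "germ x (sec_add E (U \<inter> W) (restrict s (U \<inter> W)) (restrict t (U \<inter> W))) \<in> carrier (stalk A E x)"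
    by (rule stalkI[OF UW section_add[OF section_restrict[OF s(3)] section_restrict[OF t(3)]]]) auto
  then show "g \<oplus>\<^bsub>stalk A E x\<^esub> h \<in> carrier (stalk A E x)"
    by (simp only: germ_sec_add[OF UW] germ_restrict[OF UW] s(4) t(4))
  show "g \<oplus>\<^bsub>stalk A E x\<^esub> h = h \<oplus>\<^bsub>stalk A E x\<^esub> g"
    unfolding s(4) t(4) stalk_add
  proof (rule germ_eqI[OF UW])
    fix y assume "y \<in> U \<inter> W"
    interpret M: Module.module CC "fib E y" by (rule fib)
    show "s y \<oplus>\<^bsub>fib E y\<^esub> t y = t y \<oplus>\<^bsub>fib E y\<^esub> s y"
      using closed[OF \<open>y \<in> U \<inter> W\<close>] by (simp add: M.a_comm)
  qed
  show "c \<odot>\<^bsub>stalk A E x\<^esub> (g \<oplus>\<^bsub>stalk A E x\<^esub> h) =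
      c \<odot>\<^bsub>stalk A E x\<^esub> g \<oplus>\<^bsub>stalk A E x\<^esub> c \<odot>\<^bsub>stalk A E x\<^esub> h" for c
    unfolding s(4) t(4) stalk_add stalk_smult
  proof (rule germ_eqI[OF UW])
    fix y assume "y \<in> U \<inter> W"
    interpret M: Module.module CC "fib E y" by (rule fib)
    show "c \<odot>\<^bsub>fib E y\<^esub> (s y \<oplus>\<^bsub>fib E y\<^esub> t y) = c \<odot>\<^bsub>fib E y\<^esub> s y \<oplus>\<^bsub>fib E y\<^esub> c \<odot>\<^bsub>fib E y\<^esub> t y"
      using closed[OF \<open>y \<in> U \<inter> W\<close>] by (simp add: M.smult_r_distr)
  qed
  fix k assume "k \<in> carrier (stalk A E x)"
  then obtain Z u where u: "open Z" "x \<in> Z" "u \<in> sections A E Z" "k = germ x u"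
    by (metis stalk_cases)
  show "g \<oplus>\<^bsub>stalk A E x\<^esub> h \<oplus>\<^bsub>stalk A E x\<^esub> k = g \<oplus>\<^bsub>stalk A E x\<^esub> (h \<oplus>\<^bsub>stalk A E x\<^esub> k)"
    unfolding s(4) t(4) u(4) stalk_add
  proof (rule germ_eqI[of "U \<inter> W \<inter> Z"])
    fix y assume y: "y \<in> U \<inter> W \<inter> Z"
    interpret M: Module.module CC "fib E y" by (rule fib)
    show "s y \<oplus>\<^bsub>fib E y\<^esub> t y \<oplus>\<^bsub>fib E y\<^esub> u y = s y \<oplus>\<^bsub>fib E y\<^esub> (t y \<oplus>\<^bsub>fib E y\<^esub> u y)"
      using closed[of y] section_closed[OF u(3), of y] y by (simp add: M.a_assoc)
  qed (use UW u in auto)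
next
  show "\<zero>\<^bsub>stalk A E x\<^esub> \<in> carrier (stalk A E x)"
    using stalkI[OF open_UNIV UNIV_I section_zero, of x] by (simp only: germ_sec_zero open_UNIV UNIV_I)
next
  fix g and c d :: complex assume "g \<in> carrier (stalk A E x)"
  then obtain U s where s: "open U" "x \<in> U" "s \<in> sections A E U" "g = germ x s"
    by (rule stalk_cases)
  have "germ x (sec_smult E U (\<lambda>_. c) s) \<in> carrier (stalk A E x)"
    by (rule stalkI[OF s(1,2) section_smult[OF s(3) hol_fun_const]])
  then show "c \<odot>\<^bsub>stalk A E x\<^esub> g \<in> carrier (stalk A E x)"
    by (simp only: germ_sec_smult[OF s(1,2)] s(4))
  have zero: "\<zero>\<^bsub>fib E y\<^esub> \<oplus>\<^bsub>fib E y\<^esub> s y = s y" if "y \<in> U" for y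
  proof -
    interpret M: Module.module CC "fib E y" by (rule fib)
    show ?thesis using section_closed[OF s(3) that] by simp
  qed
  show "\<zero>\<^bsub>stalk A E x\<^esub> \<oplus>\<^bsub>stalk A E x\<^esub> g = g" "0 \<odot>\<^bsub>stalk A E x\<^esub> g = \<zero>\<^bsub>stalk A E x\<^esub>"
    "1 \<odot>\<^bsub>stalk A E x\<^esub> g = g"
    "(c + d) \<odot>\<^bsub>stalk A E x\<^esub> g = c \<odot>\<^bsub>stalk A E x\<^esub> g \<oplus>\<^bsub>stalk A E x\<^esub> d \<odot>\<^bsub>stalk A E x\<^esub> g"
    "c * d \<odot>\<^bsub>stalk A E x\<^esub> g = c \<odot>\<^bsub>stalk A E x\<^esub> (d \<odot>\<^bsub>stalk A E x\<^esub> g)"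
    unfolding s(4) stalk_zero stalk_add stalk_smult
    by (rule germ_eqI[OF s(1,2)], use section_closed[OF s(3)] in
        \<open>simp add: zero vspace_null[OF fib] vspace_one[OF fib] vspace_distr[OF fib] vspace_assoc[OF fib]\<close>)+
qed

end

subsection \<open>The fibers of Q\<close>

text \<open>The target for functionals regarded as \<open>linear_maps\<close>. Unlike the members of
  \<open>dual\<close>, these need not be 0 off the carrier, which suits maps obtained by descent to
  quotients.\<close>

definition complex_line :: "(complex, complex) module"
  where "complex_line = \<lparr>carrier = UNIV, mult = undefined, one = undefined,
    ring.zero = 0, add = (+), smult = (*)\<rparr>"

lemma complex_line_simps [simp]:
  "carrier complex_line = UNIV" "\<zero>\<^bsub>complex_line\<^esub> = 0" "a \<oplus>\<^bsub>complex_line\<^esub> b = a + b"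
  "a \<odot>\<^bsub>complex_line\<^esub> b = a * b"
  by (simp_all add: complex_line_def)

lemma vspace_complex_line: "vspace complex_line"
  by (rule vspaceI) (simp_all add: algebra_simps)

lemma dual_anchor_simps:
  "dual_anchor V \<phi> x (\<lambda>_. 0) = (\<lambda>_. 0)"
  "dual_anchor V \<phi> x (\<lambda>u. \<omega> u + \<omega>' u) = (\<lambda>u. dual_anchor V \<phi> x \<omega> u + dual_anchor V \<phi> x \<omega>' u)"
  "dual_anchor V \<phi> x (\<lambda>u. c * \<omega> u) = (\<lambda>u. c * dual_anchor V \<phi> x \<omega> u)"
  by (simp_all add: dual_anchor_def fun_eq_iff)

text \<open>In a third chart c this is the derivative of the change from b to a, holomorphic on an
  open set, composed with the change from c to b. It shows that the coordinate differential of a is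
  a holomorphic form.\<close>

lemma (in surface) coord_field_hol:
  assumes a: "a \<in> A" and b: "b \<in> A"
  shows "hol_fun A (fst a \<inter> fst b) (\<lambda>y. coord_field A b y a)"
  unfolding hol_fun_def
proof
  fix c assume c: "c \<in> A"
  let ?g = "snd a \<circ> chart_inv b"
  have "open (snd b ` (fst a \<inter> fst b))" by (rule chart_image_open[OF b chart_open[OF a]])
  moreover have "?g holomorphic_on snd b ` (fst a \<inter> fst b)"
    using hol_fun_chart[OF a] b by (simp add: hol_fun_def)
  ultimately have g: "deriv ?g holomorphic_on snd b ` (fst a \<inter> fst b)" by (rule holomorphic_deriv[rotated])
  have "(snd b \<circ> chart_inv c) holomorphic_on snd c ` (fst b \<inter> fst c)"
    using hol_fun_chart[OF b] c by (simp add: hol_fun_def)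
  then have t: "(snd b \<circ> chart_inv c) holomorphic_on snd c ` (fst a \<inter> fst b \<inter> fst c)"
    by (rule holomorphic_on_subset) blast
  have "(deriv ?g \<circ> (snd b \<circ> chart_inv c)) holomorphic_on snd c ` (fst a \<inter> fst b \<inter> fst c)"
    by (rule holomorphic_on_compose_gen[OF t g]) (auto simp: chart_inv_snd[OF c])
  then show "((\<lambda>y. coord_field A b y a) \<circ> chart_inv c) holomorphic_on snd c ` (fst a \<inter> fst b \<inter> fst c)"
    by (rule holomorphic_transform)
      (use a in \<open>auto simp: chart_inv_snd[OF c] coord_field_def charts_at_def\<close>)
qed

context anchored_vb
begin

sublocale D: hol_vb A "dual_bundle V" by (rule hol_vb_dual)

section \<open>The stalk and the fiber of Q as iterated quotients\<close>

lemma dual_anchor_image_submodule: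
  "submodule (dual_anchor_image A V \<phi> x) CC (stalk A (dual_bundle V) x)"
  unfolding submodule_iff[OF D.vspace_stalk]
proof (intro conjI ballI allI subsetI)
  interpret T: frame_bundle A "TX A" by (rule frame_bundle_TX)
  interpret K: frame_bundle A "KX A" by (rule T.frame_bundle_dual)
  let ?I = "dual_anchor_image A V \<phi> x"
  have I: "germ x (\<lambda>y. dual_anchor V \<phi> y (\<omega> y)) \<in> ?I"
    if "open U" "x \<in> U" "\<omega> \<in> sections A (KX A) U" for U \<omega>
    using that unfolding dual_anchor_image_def by blast
  show "g \<in> carrier (stalk A (dual_bundle V) x)" if g: "g \<in> ?I" for g
  proof -
    obtain \<omega> U where \<omega>: "open U" "x \<in> U" "\<omega> \<in> sections A (KX A) U"
      "g = germ x (\<lambda>y. dual_anchor V \<phi> y (\<omega> y))"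
      using g unfolding dual_anchor_image_def by blast
    show ?thesis
      using D.stalkI[OF \<omega>(1,2) dual_anchor_section[OF \<omega>(1,3)]]
      by (simp only: D.germ_restrict[OF \<omega>(1,2)] \<omega>(4))
  qed
  have "germ x (\<lambda>y. dual_anchor V \<phi> y (sec_zero (KX A) UNIV y)) \<in> ?I"
    by (rule I[OF open_UNIV UNIV_I K.section_zero])
  then show "\<zero>\<^bsub>stalk A (dual_bundle V) x\<^esub> \<in> ?I"
    by (simp add: stalk_zero sec_zero_def dual_simps dual_anchor_simps)
  show "g \<oplus>\<^bsub>stalk A (dual_bundle V) x\<^esub> h \<in> ?I" if g: "g \<in> ?I" and h: "h \<in> ?I" for g h
  proof -
    obtain \<omega> U where \<omega>: "open U" "x \<in> U" "\<omega> \<in> sections A (KX A) U"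
      "g = germ x (\<lambda>y. dual_anchor V \<phi> y (\<omega> y))"
      using g unfolding dual_anchor_image_def by blast
    obtain \<omega>' U' where \<omega>': "open U'" "x \<in> U'" "\<omega>' \<in> sections A (KX A) U'"
      "h = germ x (\<lambda>y. dual_anchor V \<phi> y (\<omega>' y))"
      using h unfolding dual_anchor_image_def by blast
    let ?W = "U \<inter> U'"
    let ?\<eta> = "sec_add (KX A) ?W (restrict \<omega> ?W) (restrict \<omega>' ?W)"
    have W: "open ?W" "x \<in> ?W" using \<omega> \<omega>' by auto
    have "germ x (\<lambda>y. dual_anchor V \<phi> y (?\<eta> y)) \<in> ?I"
      by (rule I[OF W K.section_add[OF K.section_restrict[OF \<omega>(3)] K.section_restrict[OF \<omega>'(3)]]]) auto
    moreover have "germ x (\<lambda>y. dual_anchor V \<phi> y (?\<eta> y)) = g \<oplus>\<^bsub>stalk A (dual_bundle V) x\<^esub> h"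
      unfolding \<omega>(4) \<omega>'(4) stalk_add
      by (rule germ_eqI[OF W]) (simp add: sec_add_def dual_simps dual_anchor_simps)
    ultimately show ?thesis by simp
  qed
  show "c \<odot>\<^bsub>stalk A (dual_bundle V) x\<^esub> g \<in> ?I" if g: "g \<in> ?I" for c g
  proof -
    obtain \<omega> U where \<omega>: "open U" "x \<in> U" "\<omega> \<in> sections A (KX A) U"
      "g = germ x (\<lambda>y. dual_anchor V \<phi> y (\<omega> y))"
      using g unfolding dual_anchor_image_def by blast
    let ?\<eta> = "sec_smult (KX A) U (\<lambda>_. c) \<omega>"
    have "germ x (\<lambda>y. dual_anchor V \<phi> y (?\<eta> y)) \<in> ?I"
      by (rule I[OF \<omega>(1,2) K.section_smult[OF \<omega>(3) hol_fun_const]])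
    moreover have "germ x (\<lambda>y. dual_anchor V \<phi> y (?\<eta> y)) = c \<odot>\<^bsub>stalk A (dual_bundle V) x\<^esub> g"
      unfolding \<omega>(4) stalk_smult
      by (rule germ_eqI[OF \<omega>(1,2)]) (simp add: sec_smult_def dual_simps dual_anchor_simps)
    ultimately show ?thesis by simp
  qed
qed

lemma quotient_Q_stalk: "quotient (stalk A (dual_bundle V) x) (dual_anchor_image A V \<phi> x)"
  by (intro quotient.intro D.vspace_stalk dual_anchor_image_submodule)

lemma vspace_Q_stalk: "vspace (Q_stalk A V \<phi> x)"
  unfolding Q_stalk_def by (rule quotient.vspace_quot[OF quotient_Q_stalk])

lemma q_stalk_linear: "q_stalk A V \<phi> x \<in> linear_maps (stalk A (dual_bundle V) x) (Q_stalk A V \<phi> x)"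
  unfolding Q_stalk_def q_stalk_def[abs_def] by (rule quotient.proj_linear[OF quotient_Q_stalk])

lemma mQ_gens_subset:
  "{q_stalk A V \<phi> x (germ x (sec_smult (dual_bundle V) U f l)) | U f l.
      open U \<and> x \<in> U \<and> hol_fun A U f \<and> f x = 0 \<and> l \<in> sections A (dual_bundle V) U}
    \<subseteq> carrier (Q_stalk A V \<phi> x)"
proof clarify
  fix U f l assume "open U" "x \<in> U" "hol_fun A U f" "l \<in> sections A (dual_bundle V) U"
  then have "germ x (sec_smult (dual_bundle V) U f l) \<in> carrier (stalk A (dual_bundle V) x)"
    using D.stalkI D.section_smult by blast
  then show "q_stalk A V \<phi> x (germ x (sec_smult (dual_bundle V) U f l)) \<in> carrier (Q_stalk A V \<phi> x)"
    by (rule linear_closed[OF q_stalk_linear])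
qed

lemma quotient_Q_fiber: "quotient (Q_stalk A V \<phi> x) (mQ A V \<phi> x)"
  unfolding mQ_def
  by (intro quotient.intro vspace_Q_stalk mod_span_submodule mQ_gens_subset)

lemma vspace_Q_fiber: "vspace (Q_fiber A V \<phi> x)"
  unfolding Q_fiber_def by (rule quotient.vspace_quot[OF quotient_Q_fiber])

text \<open>The composite of the two projections, from germs of sections of the dual of V to the
  fiber of Q. It is the germ-level form of \<open>q_fiber\<close>, available before dependence on
  the value at x alone is known.\<close>

definition q_class :: "'x \<Rightarrow> ('x \<Rightarrow> 'v \<Rightarrow> complex) set \<Rightarrow> ('x \<Rightarrow> 'v \<Rightarrow> complex) set set set"
  where "q_class x g = mQ A V \<phi> x +>\<^bsub>Q_stalk A V \<phi> x\<^esub> q_stalk A V \<phi> x g"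

lemma q_class_linear: "q_class x \<in> linear_maps (stalk A (dual_bundle V) x) (Q_fiber A V \<phi> x)"
  unfolding Q_fiber_def q_class_def[abs_def]
  by (rule linear_comp[OF q_stalk_linear quotient.proj_linear[OF quotient_Q_fiber]])

lemma q_class_smult_zero:
  assumes "open U" "x \<in> U" "hol_fun A U f" "f x = 0" "l \<in> sections A (dual_bundle V) U"
  shows "q_class x (germ x (sec_smult (dual_bundle V) U f l)) = \<zero>\<^bsub>Q_fiber A V \<phi> x\<^esub>"
proof -
  have "q_stalk A V \<phi> x (germ x (sec_smult (dual_bundle V) U f l)) \<in> mQ A V \<phi> x"
    unfolding mQ_def using assms by (intro subsetD[OF mod_span_superset]) blast
  then show ?thesis
    unfolding q_class_def by (simp add: quotient.coset_eq_self[OF quotient_Q_fiber] Q_fiber_def quot_module_def)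
qed

lemma q_class_anchor:
  assumes "g \<in> dual_anchor_image A V \<phi> x"
  shows "q_class x g = \<zero>\<^bsub>Q_fiber A V \<phi> x\<^esub>"
proof -
  have "q_stalk A V \<phi> x g = \<zero>\<^bsub>Q_stalk A V \<phi> x\<^esub>"
    using quotient.coset_eq_self[OF quotient_Q_stalk assms]
    by (simp add: q_stalk_def Q_stalk_def quot_module_def)
  then show ?thesis
    unfolding q_class_def Q_fiber_def quotient.zero_quot[OF quotient_Q_fiber] by simp
qed

text \<open>In a local frame a section that vanishes at x has coefficients in the maximal ideal, and
  products of such functions with sections are the generators of \<open>mQ\<close>.\<close>

lemma q_class_vanishing:
  assumes U: "open U" "x \<in> U" and \<tau>: "\<tau> \<in> sections A (dual_bundle V) U" and zero: "\<tau> x = (\<lambda>_. 0)"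
  shows "q_class x (germ x \<tau>) = \<zero>\<^bsub>Q_fiber A V \<phi> x\<^esub>"
proof -
  interpret Q: Module.module CC "Q_fiber A V \<phi> x" by (rule vspace_Q_fiber)
  obtain W e where W: "open W" "x \<in> W" "W \<subseteq> U" "\<And>i. i < rk V \<Longrightarrow> e i \<in> sections A (dual_bundle V) W"
    "\<And>y. y \<in> W \<Longrightarrow> is_basis (dual (fib V y)) (rk V) (\<lambda>i. e i y)"
    "\<And>s. s \<in> sections A (dual_bundle V) U \<Longrightarrow> \<exists>c. (\<forall>i<rk V. hol_fun A W (c i)) \<and>
      (\<forall>y\<in>W. s y = lin_comb (dual_bundle V) c e (rk V) y)"
    by (rule D.local_frame[OF U]) auto
  obtain c where c: "\<And>i. i < rk V \<Longrightarrow> hol_fun A W (c i)"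
    "\<And>y. y \<in> W \<Longrightarrow> \<tau> y = lin_comb (dual_bundle V) c e (rk V) y"
    using W(6)[OF \<tau>] by blast
  \<comment> \<open>The same coordinate is computed twice: by uniqueness it is c i x, and because
    \<tau> x is 0 times itself it is 0.\<close>
  have "coord (dual (fib V x)) (rk V) (\<lambda>i. e i x) (\<tau> x) i = c i x" if "i < rk V" for i
    using c(2)[OF W(2)] that
    by (intro coord_unique[OF vspace_dual[OF fib] W(5)[OF W(2)]]) (simp_all add: lin_comb_def)
  moreover have "coord (dual (fib V x)) (rk V) (\<lambda>i. e i x) (\<tau> x) i = 0" if "i < rk V" for i
    using coord_smult[OF vspace_dual[OF fib] W(5)[OF W(2)] _ that, of "\<tau> x" 0]
      D.section_closed[OF \<tau> U(2)] by (simp add: dual_simps zero)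
  ultimately have c0: "c i x = 0" if "i < rk V" for i using that by simp
  have "q_class x (germ x (restrict (lin_comb (dual_bundle V) c e n) W)) = \<zero>\<^bsub>Q_fiber A V \<phi> x\<^esub>"
    if "n \<le> rk V" for n
    using that
  proof (induction n)
    case 0
    have "restrict (lin_comb (dual_bundle V) c e 0) W = sec_zero (dual_bundle V) W"
      by (simp add: sec_zero_def D.lin_comb_0 fun_eq_iff)
    then show ?case
      by (simp only: D.germ_sec_zero[OF W(1,2)] linear_zero[OF q_class_linear D.vspace_stalk vspace_Q_fiber])
  next
    case (Suc n)
    have e: "e i \<in> sections A (dual_bundle V) W" if "i < Suc n" for i using W(4) that Suc.prems by simp
    have "restrict (lin_comb (dual_bundle V) c e n) W \<in> sections A (dual_bundle V) W"
      by (rule D.section_lin_comb) (use Suc.prems W(4) c(1) in simp_all)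
    moreover have "sec_smult (dual_bundle V) W (c n) (e n) \<in> sections A (dual_bundle V) W"
      by (rule D.section_smult) (use Suc.prems W(4) c(1) in simp_all)
    ultimately have "q_class x (germ x (restrict (lin_comb (dual_bundle V) c e (Suc n)) W)) =
      q_class x (germ x (restrict (lin_comb (dual_bundle V) c e n) W)) \<oplus>\<^bsub>Q_fiber A V \<phi> x\<^esub>
      q_class x (germ x (sec_smult (dual_bundle V) W (c n) (e n)))"
      using D.lin_comb_partial[where n = n and c = c, OF e] linear_add[OF q_class_linear]
      by (simp only: D.germ_sec_add[OF W(1,2)] D.stalkI[OF W(1,2)])
    also have "\<dots> = \<zero>\<^bsub>Q_fiber A V \<phi> x\<^esub>"
    proof -
      have n: "n < rk V" "n \<le> rk V" using Suc.prems by simp_all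
      show ?thesis
        unfolding Suc.IH[OF n(2)] q_class_smult_zero[OF W(1,2) c(1)[OF n(1)] c0[OF n(1)] W(4)[OF n(1)]]
        by simp
    qed
    finally show ?case .
  qed
  from this[of "rk V"] show ?thesis
    using germ_eqI[OF W(1,2), of \<tau> "restrict (lin_comb (dual_bundle V) c e (rk V)) W"] c(2) by simp
qed

text \<open>The difference of the two sections, formed on the common neighbourhood, vanishes at
  x.\<close>

lemma q_class_cong:
  assumes s: "open U" "x \<in> U" "\<sigma> \<in> sections A (dual_bundle V) U"
    and t: "open W" "x \<in> W" "\<tau> \<in> sections A (dual_bundle V) W" and eq: "\<sigma> x = \<tau> x"
  shows "q_class x (germ x \<sigma>) = q_class x (germ x \<tau>)"
proof -
  interpret Q: Module.module CC "Q_fiber A V \<phi> x" by (rule vspace_Q_fiber)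
  let ?Z = "U \<inter> W"
  have Z: "open ?Z" "x \<in> ?Z" using s t by auto
  \<comment> \<open>The negative of \<tau> is taken as a multiple by the constant -1, so that
    additivity and homogeneity of \<open>q_class\<close> apply directly.\<close>
  define \<rho> where "\<rho> = sec_smult (dual_bundle V) ?Z (\<lambda>_. -1) (restrict \<tau> ?Z)"
  have \<sigma>: "restrict \<sigma> ?Z \<in> sections A (dual_bundle V) ?Z" and \<tau>: "restrict \<tau> ?Z \<in> sections A (dual_bundle V) ?Z"
    using s t by (auto intro: D.section_restrict)
  have \<rho>: "\<rho> \<in> sections A (dual_bundle V) ?Z"
    unfolding \<rho>_def by (rule D.section_smult[OF \<tau> hol_fun_const])
  have d: "sec_add (dual_bundle V) ?Z (restrict \<sigma> ?Z) \<rho> \<in> sections A (dual_bundle V) ?Z"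
    by (rule D.section_add[OF \<sigma> \<rho>])
  have closed: "germ x \<sigma> \<in> carrier (stalk A (dual_bundle V) x)" "germ x \<tau> \<in> carrier (stalk A (dual_bundle V) x)"
    "germ x \<rho> \<in> carrier (stalk A (dual_bundle V) x)"
    using D.stalkI s t \<rho> Z by blast+
  have "\<zero>\<^bsub>Q_fiber A V \<phi> x\<^esub> = q_class x (germ x (sec_add (dual_bundle V) ?Z (restrict \<sigma> ?Z) \<rho>))"
    by (rule q_class_vanishing[OF Z d, symmetric])
      (use Z eq in \<open>simp add: sec_add_def sec_smult_def \<rho>_def dual_simps\<close>)
  also have "\<dots> = q_class x (germ x \<sigma>) \<oplus>\<^bsub>Q_fiber A V \<phi> x\<^esub> q_class x (germ x \<rho>)"
    by (simp only: D.germ_sec_add[OF Z] D.germ_restrict[OF Z] linear_add[OF q_class_linear] closed)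
  also have "q_class x (germ x \<rho>) = (-1) \<odot>\<^bsub>Q_fiber A V \<phi> x\<^esub> q_class x (germ x \<tau>)"
    unfolding \<rho>_def
    by (simp only: D.germ_sec_smult[OF Z] D.germ_restrict[OF Z] linear_smult[OF q_class_linear] closed)
  finally have 1: "q_class x (germ x \<sigma>) \<oplus>\<^bsub>Q_fiber A V \<phi> x\<^esub> (-1) \<odot>\<^bsub>Q_fiber A V \<phi> x\<^esub> q_class x (germ x \<tau>)
    = \<zero>\<^bsub>Q_fiber A V \<phi> x\<^esub>" by simp
  have q: "q_class x (germ x \<sigma>) \<in> carrier (Q_fiber A V \<phi> x)" "q_class x (germ x \<tau>) \<in> carrier (Q_fiber A V \<phi> x)"
    by (rule linear_closed[OF q_class_linear closed(1)], rule linear_closed[OF q_class_linear closed(2)])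
  have 2: "q_class x (germ x \<tau>) \<oplus>\<^bsub>Q_fiber A V \<phi> x\<^esub> (-1) \<odot>\<^bsub>Q_fiber A V \<phi> x\<^esub> q_class x (germ x \<tau>)
    = \<zero>\<^bsub>Q_fiber A V \<phi> x\<^esub>"
    using vspace_distr[OF vspace_Q_fiber q(2), of 1 "-1"] vspace_one[OF vspace_Q_fiber q(2)]
      vspace_null[OF vspace_Q_fiber q(2)] by simp
  show ?thesis
    by (rule Q.add.r_cancel[OF trans[OF 1 2[symmetric]] q vspace_smult_closed[OF vspace_Q_fiber q(2)]])
qed

text \<open>Independence of the extension, \<open>q_class_cong\<close>, is the uniqueness that the
  definite description requires.\<close>

lemma q_fiber_section:
  assumes "open U" "x \<in> U" "\<sigma> \<in> sections A (dual_bundle V) U"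
  shows "q_fiber A V \<phi> x (\<sigma> x) = q_class x (germ x \<sigma>)"
  unfolding q_fiber_def q_class_def[symmetric]
proof (rule the_equality)
  show "\<exists>U' \<sigma>'. open U' \<and> x \<in> U' \<and> \<sigma>' \<in> sections A (dual_bundle V) U' \<and> \<sigma>' x = \<sigma> x \<and>
      q_class x (germ x \<sigma>) = q_class x (germ x \<sigma>')"
    using assms by blast
next
  fix w assume "\<exists>U' \<sigma>'. open U' \<and> x \<in> U' \<and> \<sigma>' \<in> sections A (dual_bundle V) U' \<and> \<sigma>' x = \<sigma> x \<and>
      w = q_class x (germ x \<sigma>')"
  then obtain U' \<sigma>' where "open U'" "x \<in> U'" "\<sigma>' \<in> sections A (dual_bundle V) U'" "\<sigma>' x = \<sigma> x"
    "w = q_class x (germ x \<sigma>')" by blast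
  then show "w = q_class x (germ x \<sigma>)" using q_class_cong[OF _ _ _ assms] by blast
qed

text \<open>Functionals are extended to sections near x; sums and multiples of the extensions extend
  the sums and multiples, and \<open>q_class\<close> is linear on germs.\<close>

lemma q_fiber_linear: "q_fiber A V \<phi> x \<in> linear_maps (dual (fib V x)) (Q_fiber A V \<phi> x)"
proof (rule linear_mapsI)
  fix l assume "l \<in> carrier (dual (fib V x))"
  then have "l \<in> carrier (fib (dual_bundle V) x)" by simp
  then obtain U \<sigma> where \<sigma>: "open U" "x \<in> U" "\<sigma> \<in> sections A (dual_bundle V) U" "\<sigma> x = l"
    by (rule D.section_extend)
  note closed = D.stalkI[OF \<sigma>(1-3)]
  show "q_fiber A V \<phi> x l \<in> carrier (Q_fiber A V \<phi> x)"
    unfolding \<sigma>(4)[symmetric] q_fiber_section[OF \<sigma>(1-3)] by (rule linear_closed[OF q_class_linear closed])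
  show "q_fiber A V \<phi> x (c \<odot>\<^bsub>dual (fib V x)\<^esub> l) = c \<odot>\<^bsub>Q_fiber A V \<phi> x\<^esub> q_fiber A V \<phi> x l" for c
  proof -
    have val: "c \<odot>\<^bsub>dual (fib V x)\<^esub> l = sec_smult (dual_bundle V) U (\<lambda>_. c) \<sigma> x"
      using \<sigma>(2,4) by (simp add: sec_smult_def)
    show ?thesis
      unfolding val q_fiber_section[OF \<sigma>(1,2) D.section_smult[OF \<sigma>(3) hol_fun_const]]
      unfolding \<sigma>(4)[symmetric] q_fiber_section[OF \<sigma>(1-3)]
      by (simp only: D.germ_sec_smult[OF \<sigma>(1,2)] linear_smult[OF q_class_linear closed])
  qed
  fix m assume "m \<in> carrier (dual (fib V x))"
  then have "m \<in> carrier (fib (dual_bundle V) x)" by simp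
  then obtain W \<tau> where \<tau>: "open W" "x \<in> W" "\<tau> \<in> sections A (dual_bundle V) W" "\<tau> x = m"
    by (rule D.section_extend)
  let ?Z = "U \<inter> W"
  let ?s = "sec_add (dual_bundle V) ?Z (restrict \<sigma> ?Z) (restrict \<tau> ?Z)"
  have Z: "open ?Z" "x \<in> ?Z" using \<sigma> \<tau> by auto
  have s: "?s \<in> sections A (dual_bundle V) ?Z"
    using \<sigma> \<tau> by (intro D.section_add D.section_restrict) auto
  have val: "l \<oplus>\<^bsub>dual (fib V x)\<^esub> m = ?s x"
    using Z \<sigma>(4) \<tau>(4) by (simp add: sec_add_def)
  show "q_fiber A V \<phi> x (l \<oplus>\<^bsub>dual (fib V x)\<^esub> m) =
      q_fiber A V \<phi> x l \<oplus>\<^bsub>Q_fiber A V \<phi> x\<^esub> q_fiber A V \<phi> x m"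
    unfolding val q_fiber_section[OF Z s]
    unfolding \<sigma>(4)[symmetric] \<tau>(4)[symmetric] q_fiber_section[OF \<sigma>(1-3)] q_fiber_section[OF \<tau>(1-3)]
    by (simp only: D.germ_sec_add[OF Z] D.germ_restrict[OF Z]
        linear_add[OF q_class_linear closed D.stalkI[OF \<tau>(1-3)]])
qed

text \<open>The subspace divided out consists of germs of images of holomorphic forms, so a single
  covector at x has to be extended to a form first.\<close>

lemma q_fiber_anchor:
  assumes \<omega>: "\<omega> \<in> carrier (dual (tangent_space A x))"
  shows "q_fiber A V \<phi> x (dual_anchor V \<phi> x \<omega>) = \<zero>\<^bsub>Q_fiber A V \<phi> x\<^esub>"
proof -
  obtain a where a: "a \<in> A" "x \<in> fst a" using charts_cover by blast
  then have ax: "a \<in> charts_at A x" by (simp add: charts_at_def)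
  let ?U = "fst a"
  \<comment> \<open>The form c dz, where z is the coordinate of a and the constant c is the value of
    \<omega> on the coordinate vector at x; v a is the value of dz on v.\<close>
  define \<eta> where "\<eta> = restrict (\<lambda>y v. if v \<in> carrier (tangent_space A y)
    then \<omega> (coord_field A a x) * v a else 0) ?U"
  note U = chart_open[OF a(1)] a(2)
  have \<eta>: "\<eta> \<in> sections A (KX A) ?U"
    unfolding KX_sections_iff
  proof (intro conjI ballI)
    fix y assume "y \<in> ?U"
    interpret M: Module.module CC "tangent_space A y" by (rule vspace_tangent)
    have "(\<lambda>v. if v \<in> carrier (tangent_space A y) then \<omega> (coord_field A a x) * v a else 0)
        \<in> carrier (dual (tangent_space A y))"
      by (rule dualI) (simp_all add: tangent_simps[symmetric], simp_all add: tangent_simps algebra_simps)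
    then show "\<eta> y \<in> carrier (dual (tangent_space A y))" using \<open>y \<in> ?U\<close> by (simp add: \<eta>_def)
  next
    fix b assume b: "b \<in> A"
    have "hol_fun A (fst a \<inter> fst b) (\<lambda>y. \<omega> (coord_field A a x) * coord_field A b y a)"
      by (intro hol_fun_mult hol_fun_const coord_field_hol a b)
    then show "hol_fun A (fst a \<inter> fst b) (\<lambda>y. \<eta> y (coord_field A b y))"
      by (rule hol_fun_cong[rotated]) (use b coord_field_closed[of b] in \<open>simp add: \<eta>_def charts_at_def\<close>)
  qed (simp add: \<eta>_def)
  have "\<eta> x = \<omega>"
  proof
    fix v
    show "\<eta> x v = \<omega> v"
    proof (cases "v \<in> carrier (tangent_space A x)")
      case True
      have "\<omega> v = \<omega> (v a \<odot>\<^bsub>tangent_space A x\<^esub> coord_field A a x)"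
        using tangent_expand[OF True ax] by (rule arg_cong)
      then show ?thesis
        using True a(2) dual_smult[OF \<omega> coord_field_closed[OF ax]] by (simp add: \<eta>_def)
    qed (use dual_outside[OF \<omega>] a(2) in \<open>simp add: \<eta>_def\<close>)
  qed
  then have val: "dual_anchor V \<phi> x \<omega> = restrict (\<lambda>y. dual_anchor V \<phi> y (\<eta> y)) ?U x"
    using a(2) by simp
  show ?thesis
    unfolding val q_fiber_section[OF U dual_anchor_section[OF U(1) \<eta>]] D.germ_restrict[OF U]
    by (rule q_class_anchor) (use U \<eta> in \<open>auto simp: dual_anchor_image_def\<close>)
qed

text \<open>Evaluating a germ at x and then at v descends twice. It kills the image of the dual
  anchor because by hypothesis every element of that image takes the value 0 at x, and it kills
  \<open>mQ\<close> because functions in the maximal ideal vanish at x.\<close>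

lemma Q_fiber_eval:
  assumes zero: "\<And>\<omega>. \<omega> \<in> carrier (dual (tangent_space A x)) \<Longrightarrow> dual_anchor V \<phi> x \<omega> = (\<lambda>_. 0)"
    and v: "v \<in> carrier (fib V x)"
  obtains \<Lambda> where "\<Lambda> \<in> linear_maps (Q_fiber A V \<phi> x) complex_line"
    "\<And>l. l \<in> carrier (dual (fib V x)) \<Longrightarrow> \<Lambda> (q_fiber A V \<phi> x l) = l v"
proof -
  interpret S: quotient "stalk A (dual_bundle V) x" "dual_anchor_image A V \<phi> x"
    by (rule quotient_Q_stalk)
  interpret F: quotient "Q_stalk A V \<phi> x" "mQ A V \<phi> x" by (rule quotient_Q_fiber)
  \<comment> \<open>The chosen representative is harmless: all members of a germ at x share their
    value at x.\<close>
  define h where "h g = (SOME s. s \<in> g) x v" for g :: "('x \<Rightarrow> 'v \<Rightarrow> complex) set"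
  have h: "h (germ x s) = s x v" for s
    unfolding h_def by (subst germ_value[OF someI[of "\<lambda>t. t \<in> germ x s" s]]) (simp_all add: germ_def)
  have h_linear: "h \<in> linear_maps (stalk A (dual_bundle V) x) complex_line"
    by (rule linear_mapsI; elim D.stalk_cases) (simp_all add: stalk_add stalk_smult h dual_simps)
  have h_zero: "h g = \<zero>\<^bsub>complex_line\<^esub>" if g: "g \<in> dual_anchor_image A V \<phi> x" for g
  proof -
    obtain \<omega> U where \<omega>: "open U" "x \<in> U" "\<omega> \<in> sections A (KX A) U"
      "g = germ x (\<lambda>y. dual_anchor V \<phi> y (\<omega> y))"
      using g unfolding dual_anchor_image_def by blast
    then have "\<omega> x \<in> carrier (dual (tangent_space A x))" by (simp add: KX_sections_iff)
    then show ?thesis using zero by (simp add: \<omega>(4) h)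
  qed
  define k where "k = quot_lift h"
  have k_linear: "k \<in> linear_maps (Q_stalk A V \<phi> x) complex_line"
    unfolding k_def Q_stalk_def by (rule S.quot_lift_linear[OF h_linear vspace_complex_line h_zero])
  have k: "k (q_stalk A V \<phi> x g) = h g" if "g \<in> carrier (stalk A (dual_bundle V) x)" for g
    unfolding k_def q_stalk_def
    by (rule S.quot_lift_coset[OF h_linear vspace_complex_line h_zero that])
  have k_zero: "k g = \<zero>\<^bsub>complex_line\<^esub>" if "g \<in> mQ A V \<phi> x" for g
  proof -
    have "k g \<in> {\<zero>\<^bsub>complex_line\<^esub>}"
    proof (rule mod_span_image[OF k_linear vspace_Q_stalk vspace_complex_line mQ_gens_subset
          zero_submodule[OF vspace_complex_line] _ that[unfolded mQ_def]])
      fix w assume "w \<in> {q_stalk A V \<phi> x (germ x (sec_smult (dual_bundle V) U f l)) | U f l.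
        open U \<and> x \<in> U \<and> hol_fun A U f \<and> f x = 0 \<and> l \<in> sections A (dual_bundle V) U}"
      then obtain U f l where U: "open U" "x \<in> U" "hol_fun A U f" "f x = 0"
        "l \<in> sections A (dual_bundle V) U" and w: "w = q_stalk A V \<phi> x (germ x (sec_smult (dual_bundle V) U f l))"
        by blast
      show "k w \<in> {\<zero>\<^bsub>complex_line\<^esub>}"
        unfolding w k[OF D.stalkI[OF U(1,2) D.section_smult[OF U(5,3)]]] h
        using U(2,4) by (simp add: sec_smult_def dual_simps)
    qed
    then show ?thesis by simp
  qed
  show ?thesis
  proof (rule that[of "quot_lift k"])
    show "quot_lift k \<in> linear_maps (Q_fiber A V \<phi> x) complex_line"
      unfolding Q_fiber_def by (rule F.quot_lift_linear[OF k_linear vspace_complex_line k_zero])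
    fix l assume "l \<in> carrier (dual (fib V x))"
    then have "l \<in> carrier (fib (dual_bundle V) x)" by simp
    then obtain U \<sigma> where \<sigma>: "open U" "x \<in> U" "\<sigma> \<in> sections A (dual_bundle V) U" "\<sigma> x = l"
      by (rule D.section_extend)
    note g = D.stalkI[OF \<sigma>(1-3)]
    have "quot_lift k (q_fiber A V \<phi> x (\<sigma> x)) = k (q_stalk A V \<phi> x (germ x \<sigma>))"
      unfolding q_fiber_section[OF \<sigma>(1-3)] q_class_def
      by (rule F.quot_lift_coset[OF k_linear vspace_complex_line k_zero linear_closed[OF q_stalk_linear g]])
    then show "quot_lift k (q_fiber A V \<phi> x l) = l v" by (simp add: k[OF g] h \<sigma>(4))
  qed
qed

end

subsection \<open>Contractions\<close>

text \<open>The map id \<otimes> \<Lambda>, with the scalar in the second factor absorbed into the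
  first. It extracts coefficients from tensors without any basis of a tensor product.\<close>

definition contract :: "(complex, 'a) module \<Rightarrow> ('b \<Rightarrow> complex) \<Rightarrow> ('a, 'b) tens \<Rightarrow> 'a"
  where "contract M \<Lambda> = tensor_lift M (\<lambda>m n. \<Lambda> n \<odot>\<^bsub>M\<^esub> m)"

lemma
  assumes M: "vspace M" and N: "vspace N" and \<Lambda>: "\<Lambda> \<in> linear_maps N complex_line"
  shows contract_linear: "contract M \<Lambda> \<in> linear_maps (tensor M N) M"
    and contract_pure: "m \<in> carrier M \<Longrightarrow> n \<in> carrier N \<Longrightarrow> contract M \<Lambda> (pure M N m n) = \<Lambda> n \<odot>\<^bsub>M\<^esub> m"
proof -
  interpret M: Module.module CC M by (rule M)
  have left: "(\<lambda>m. \<Lambda> n \<odot>\<^bsub>M\<^esub> m) \<in> linear_maps M M" for n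
  proof (rule linear_mapsI)
    fix c u assume u: "u \<in> carrier M"
    show "\<Lambda> n \<odot>\<^bsub>M\<^esub> (c \<odot>\<^bsub>M\<^esub> u) = c \<odot>\<^bsub>M\<^esub> (\<Lambda> n \<odot>\<^bsub>M\<^esub> u)"
      unfolding vspace_assoc[OF M u, symmetric] by (simp add: mult.commute)
  qed (simp_all add: M.smult_r_distr)
  have right: "(\<lambda>n. \<Lambda> n \<odot>\<^bsub>M\<^esub> m) \<in> linear_maps N M" if m: "m \<in> carrier M" for m
    by (rule linear_mapsI)
      (simp_all add: m linear_add[OF \<Lambda>] linear_smult[OF \<Lambda>] vspace_distr[OF M m] vspace_assoc[OF M m])
  show "contract M \<Lambda> \<in> linear_maps (tensor M N) M"
    unfolding contract_def by (rule tensor_lift_linear[OF M N M left right])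
  show "contract M \<Lambda> (pure M N m n) = \<Lambda> n \<odot>\<^bsub>M\<^esub> m" if "m \<in> carrier M" "n \<in> carrier N"
    unfolding contract_def by (rule tensor_lift_pure[OF M N M left right that])
qed

lemma dual_eval_linear: "(\<lambda>l. l v) \<in> linear_maps (dual M) complex_line"
  by (rule linear_mapsI) (simp_all add: dual_simps)

lemma sub_tensor_submodule:
  assumes "vspace M" "vspace N" "H \<subseteq> carrier M"
  shows "submodule (sub_tensor M N H) CC (tensor M N)"
  unfolding sub_tensor_def
  using assms pure_closed[OF assms(1,2)] by (intro mod_span_submodule vspace_tensor) blast+

lemma pure_sub_tensor: "m \<in> H \<Longrightarrow> n \<in> carrier N \<Longrightarrow> pure M N m n \<in> sub_tensor M N H"
  unfolding sub_tensor_def by (intro subsetD[OF mod_span_superset]) blast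

text \<open>A generator with first factor in H is sent to a multiple of that factor. Thus membership
  of a tensor in the tensor product of H and N becomes membership of its contractions in H.\<close>

lemma contract_sub_tensor:
  assumes M: "vspace M" and N: "vspace N" and \<Lambda>: "\<Lambda> \<in> linear_maps N complex_line"
    and H: "submodule H CC M" and t: "t \<in> sub_tensor M N H"
  shows "contract M \<Lambda> t \<in> H"
proof (rule mod_span_image[OF contract_linear[OF M N \<Lambda>] vspace_tensor[OF M N] M _ H _ t[unfolded sub_tensor_def]])
  show "{pure M N m n | m n. m \<in> H \<and> n \<in> carrier N} \<subseteq> carrier (tensor M N)"
    using submodule_subset[OF H M] pure_closed[OF M N] by blast
  fix g assume "g \<in> {pure M N m n | m n. m \<in> H \<and> n \<in> carrier N}"
  then obtain m n where mn: "m \<in> H" "n \<in> carrier N" "g = pure M N m n" by blast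
  have m: "m \<in> carrier M" using mn(1) submodule_subset[OF H M] by blast
  show "contract M \<Lambda> g \<in> H"
    unfolding mn(3) contract_pure[OF M N \<Lambda> m mn(2)] by (rule submodule_smult[OF H M mn(1)])
qed

lemma pure_zero_left: "vspace M \<Longrightarrow> vspace N \<Longrightarrow> n \<in> carrier N \<Longrightarrow> pure M N \<zero>\<^bsub>M\<^esub> n = \<zero>\<^bsub>tensor M N\<^esub>"
  by (rule linear_zero[OF pure_linear_left _ vspace_tensor])

lemma pure_zero_right: "vspace M \<Longrightarrow> vspace N \<Longrightarrow> m \<in> carrier M \<Longrightarrow> pure M N m \<zero>\<^bsub>N\<^esub> = \<zero>\<^bsub>tensor M N\<^esub>"
  by (rule linear_zero[OF pure_linear_right _ vspace_tensor])

text \<open>The frames of a tensor bundle enumerate the pairs \<open>(i, j)\<close> by \<open>k = i r + j\<close>.\<close>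

lemma tensor_double_sum:
  fixes r :: nat
  assumes M: "vspace M" and N: "vspace N"
    and e: "\<And>i. i < n \<Longrightarrow> e i \<in> carrier M" and l: "\<And>j. j < r \<Longrightarrow> l j \<in> carrier N"
  shows "finsum (tensor M N) (\<lambda>k. c k \<odot>\<^bsub>tensor M N\<^esub> pure M N (e (k div r)) (l (k mod r))) {..<n * r} =
    finsum (tensor M N) (\<lambda>j. pure M N (finsum M (\<lambda>i. c (i * r + j) \<odot>\<^bsub>M\<^esub> e i) {..<n}) (l j)) {..<r}"
  using e
proof (induction n)
  case 0
  interpret M: Module.module CC M by (rule M)
  interpret T: Module.module CC "tensor M N" by (rule vspace_tensor[OF M N])
  have "finsum (tensor M N) (\<lambda>j. pure M N \<zero>\<^bsub>M\<^esub> (l j)) {..<r} = finsum (tensor M N) (\<lambda>j. \<zero>\<^bsub>tensor M N\<^esub>) {..<r}"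
    by (rule T.finsum_cong') (simp_all add: pure_zero_left[OF M N l])
  then show ?case by simp
next
  case (Suc n)
  interpret M: Module.module CC M by (rule M)
  interpret T: Module.module CC "tensor M N" by (rule vspace_tensor[OF M N])
  let ?g = "\<lambda>k. c k \<odot>\<^bsub>tensor M N\<^esub> pure M N (e (k div r)) (l (k mod r))"
  let ?s = "\<lambda>n j. finsum M (\<lambda>i. c (i * r + j) \<odot>\<^bsub>M\<^esub> e i) {..<n}"
  have div: "k div r < Suc n" "k mod r < r" if k: "k < n * r + r" for k
  proof -
    show "k div r < Suc n" by (rule less_mult_imp_div_less) (use k in simp)
    have "r > 0" using k by (cases "r = 0") simp_all
    then show "k mod r < r" by simp
  qed
  have g: "?g k \<in> carrier (tensor M N)" if "k < n * r + r" for k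
    using div[OF that] by (intro vspace_smult_closed vspace_tensor pure_closed M N Suc.prems l)
  have s: "?s n j \<in> carrier M" for j
    by (rule M.finsum_closed) (use Suc.prems in auto)
  \<comment> \<open>The new block consists of the r indices whose quotient by r is n.\<close>
  have split: "{..<Suc n * r} = {..<n * r} \<union> (\<lambda>j. n * r + j) ` {..<r}"
  proof (intro subset_antisym subsetI)
    fix k assume "k \<in> {..<Suc n * r}"
    then show "k \<in> {..<n * r} \<union> (\<lambda>j. n * r + j) ` {..<r}"
      by (cases "k < n * r") (auto intro!: image_eqI[of _ _ "k - n * r"])
  qed auto
  have "finsum (tensor M N) ?g {..<Suc n * r} =
    finsum (tensor M N) ?g {..<n * r} \<oplus>\<^bsub>tensor M N\<^esub> finsum (tensor M N) ?g ((\<lambda>j. n * r + j) ` {..<r})"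
    unfolding split by (rule T.finsum_Un_disjoint) (auto intro!: g)
  also have "finsum (tensor M N) ?g ((\<lambda>j. n * r + j) ` {..<r}) =
    finsum (tensor M N) (\<lambda>j. ?g (n * r + j)) {..<r}"
    by (rule T.finsum_reindex) (auto intro!: g)
  also have "\<dots> = finsum (tensor M N) (\<lambda>j. pure M N (c (n * r + j) \<odot>\<^bsub>M\<^esub> e n) (l j)) {..<r}"
    by (rule T.finsum_cong')
      (simp_all add: pure_smult_left[OF M N] pure_closed[OF M N] Suc.prems l)
  also have "finsum (tensor M N) ?g {..<n * r} = finsum (tensor M N) (\<lambda>j. pure M N (?s n j) (l j)) {..<r}"
    by (rule Suc.IH) (simp add: Suc.prems)
  also have "\<dots> \<oplus>\<^bsub>tensor M N\<^esub> finsum (tensor M N) (\<lambda>j. pure M N (c (n * r + j) \<odot>\<^bsub>M\<^esub> e n) (l j)) {..<r} =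
    finsum (tensor M N) (\<lambda>j. pure M N (?s n j) (l j) \<oplus>\<^bsub>tensor M N\<^esub> pure M N (c (n * r + j) \<odot>\<^bsub>M\<^esub> e n) (l j)) {..<r}"
    by (rule T.finsum_addf[symmetric]) (simp_all add: pure_closed[OF M N] Suc.prems l s)
  also have "\<dots> = finsum (tensor M N) (\<lambda>j. pure M N (?s (Suc n) j) (l j)) {..<r}"
  proof (rule T.finsum_cong')
    fix j assume j: "j \<in> {..<r}"
    have "?s (Suc n) j = c (n * r + j) \<odot>\<^bsub>M\<^esub> e n \<oplus>\<^bsub>M\<^esub> ?s n j"
      unfolding lessThan_Suc by (rule M.finsum_insert) (use Suc.prems in auto)
    also have "\<dots> = ?s n j \<oplus>\<^bsub>M\<^esub> c (n * r + j) \<odot>\<^bsub>M\<^esub> e n"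
      using s Suc.prems by (simp add: M.a_comm)
    finally show "pure M N (?s n j) (l j) \<oplus>\<^bsub>tensor M N\<^esub> pure M N (c (n * r + j) \<odot>\<^bsub>M\<^esub> e n) (l j) =
      pure M N (?s (Suc n) j) (l j)"
      using j s Suc.prems by (simp only: pure_add_left[OF M N] M.smult_closed CC_simps UNIV_I l lessThan_iff lessI)
  next
    show "(\<lambda>j. pure M N (?s (Suc n) j) (l j)) \<in> {..<r} \<rightarrow> carrier (tensor M N)"
      by (intro Pi_I pure_closed M N M.finsum_closed) (use Suc.prems l in auto)
  qed simp
  finally show ?case .
qed

lemma restrict_restrict_subset: "W \<subseteq> U \<Longrightarrow> restrict (restrict f U) W = restrict f W"
  by (auto simp: fun_eq_iff)

subsection \<open>Lie algebroid connections\<close>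

locale connection = anchored_vb A V \<phi> + E: hol_vb A E
  for A :: "'x::t2_space chart set" and V :: "('x, 'v) vbundle" and \<phi> and E :: "('x, 'e) vbundle" +
  fixes D :: "('x, 'e, ('e, 'v \<Rightarrow> complex) tens) sheaf_map"
  assumes connection: "lie_algebroid_connection A V \<phi> E D"
begin

abbreviation TB :: "('x, ('e, 'v \<Rightarrow> complex) tens) vbundle"
  where "TB \<equiv> tensor_bundle E (dual_bundle V)"

abbreviation TF :: "'x \<Rightarrow> (complex, ('e, 'v \<Rightarrow> complex) tens) module"
  where "TF x \<equiv> tensor (fib E x) (dual (fib V x))"

abbreviation QF :: "'x \<Rightarrow> (complex, ('e, ('x \<Rightarrow> 'v \<Rightarrow> complex) set set set) tens) module"
  where "QF x \<equiv> tensor (fib E x) (Q_fiber A V \<phi> x)"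

abbreviation id_q :: "'x \<Rightarrow> ('e, 'v \<Rightarrow> complex) tens \<Rightarrow> ('e, ('x \<Rightarrow> 'v \<Rightarrow> complex) set set set) tens"
  where "id_q x \<equiv> tensor_map (fib E x) (Q_fiber A V \<phi> x) id (q_fiber A V \<phi> x)"

lemma fib_TB [simp]: "fib TB x = TF x"
  by (simp add: tensor_bundle_def)

lemma rk_TB: "rk TB = rk E * rk V"
  by (simp add: tensor_bundle_def)

lemma vspace_dual_V: "vspace (dual (fib V x))"
  by (rule vspace_dual[OF fib])

lemma vspace_TF: "vspace (TF x)"
  by (rule vspace_tensor[OF E.fib vspace_dual_V])

lemma vspace_QF: "vspace (QF x)"
  by (rule vspace_tensor[OF E.fib vspace_Q_fiber])

lemma id_q_linear: "id_q x \<in> linear_maps (TF x) (QF x)"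
  by (rule tensor_map_linear(1)[OF E.fib vspace_dual_V E.fib vspace_Q_fiber id_linear q_fiber_linear])

lemma id_q_pure: "m \<in> carrier (fib E x) \<Longrightarrow> l \<in> carrier (dual (fib V x)) \<Longrightarrow>
    id_q x (pure (fib E x) (dual (fib V x)) m l) = pure (fib E x) (Q_fiber A V \<phi> x) m (q_fiber A V \<phi> x l)"
  using tensor_map_linear(2)[OF E.fib vspace_dual_V E.fib vspace_Q_fiber id_linear q_fiber_linear] by simp

section \<open>The operator D read at a point\<close>

lemma sheaf: "sheaf_hom A E TB D"
  using connection by (simp add: lie_algebroid_connection_def first_order_operator_def)

lemma D_section: "open U \<Longrightarrow> s \<in> sections A E U \<Longrightarrow> D U s \<in> sections A TB U"
  using sheaf unfolding sheaf_hom_def by blast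

lemma D_closed:
  assumes "open U" "s \<in> sections A E U" "x \<in> U"
  shows "D U s x \<in> carrier (TF x)"
proof -
  have "\<forall>y\<in>U. D U s y \<in> carrier (fib TB y)"
    using D_section[OF assms(1,2)] unfolding sections_def by blast
  then show ?thesis using assms(3) by simp
qed

lemma D_restrict:
  assumes "open U" "s \<in> sections A E U" "open W" "W \<subseteq> U" "x \<in> W"
  shows "D W (restrict s W) x = D U s x"
proof -
  have "D W (restrict s W) = restrict (D U s) W"
    using sheaf assms(1-4) unfolding sheaf_hom_def by blast
  then show ?thesis using assms(5) by simp
qed

lemma D_add:
  assumes "open U" "s \<in> sections A E U" "t \<in> sections A E U" "x \<in> U"
  shows "D U (sec_add E U s t) x = D U s x \<oplus>\<^bsub>TF x\<^esub> D U t x"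
proof -
  have "D U (sec_add E U s t) = sec_add TB U (D U s) (D U t)"
    using sheaf assms(1-3) unfolding sheaf_hom_def by blast
  then show ?thesis using assms(4) by (simp add: sec_add_def)
qed

lemma Leibniz:
  assumes "open U" "s \<in> sections A E U" "hol_fun A U f" "x \<in> U"
  shows "D U (sec_smult E U f s) x = f x \<odot>\<^bsub>TF x\<^esub> D U s x \<oplus>\<^bsub>TF x\<^esub>
    pure (fib E x) (dual (fib V x)) (s x) (dual_anchor V \<phi> x (differential A f x))"
proof -
  have "D U (sec_smult E U f s) = sec_add TB U (sec_smult TB U f (D U s))
     (restrict (\<lambda>x. pure (fib E x) (dual (fib V x)) (s x) (dual_anchor V \<phi> x (differential A f x))) U)"
    using connection assms(1-3) unfolding lie_algebroid_connection_def by blast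
  then show ?thesis using assms(4) by (simp add: sec_add_def sec_smult_def)
qed

text \<open>The zero section is 0 times itself, and D commutes with constants.\<close>

lemma D_zero:
  assumes "open U" "x \<in> U"
  shows "D U (sec_zero E U) x = \<zero>\<^bsub>TF x\<^esub>"
proof -
  have "sec_smult E U (\<lambda>_. 0) (sec_zero E U) = sec_zero E U"
    unfolding sec_smult_def sec_zero_def
  proof (rule restrict_ext)
    fix y assume "y \<in> U"
    interpret M: Module.module CC "fib E y" by (rule E.fib)
    show "0 \<odot>\<^bsub>fib E y\<^esub> restrict (\<lambda>x. \<zero>\<^bsub>fib E x\<^esub>) U y = \<zero>\<^bsub>fib E y\<^esub>"
      using \<open>y \<in> U\<close> by (simp add: vspace_null[OF E.fib])
  qed
  moreover have "D U (sec_smult E U (\<lambda>_. 0) (sec_zero E U)) = sec_smult TB U (\<lambda>_. 0) (D U (sec_zero E U))"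
    using sheaf assms(1) E.section_zero unfolding sheaf_hom_def by blast
  ultimately have "D U (sec_zero E U) x = sec_smult TB U (\<lambda>_. 0) (D U (sec_zero E U)) x" by simp
  also have "\<dots> = 0 \<odot>\<^bsub>TF x\<^esub> D U (sec_zero E U) x" using assms(2) by (simp add: sec_smult_def)
  also have "\<dots> = \<zero>\<^bsub>TF x\<^esub>" by (rule vspace_null[OF vspace_TF D_closed[OF assms(1) E.section_zero assms(2)]])
  finally show ?thesis .
qed

section \<open>Linearity over functions after composing with q, and dependence on the value at x
  alone\<close>

lemma id_q_Leibniz:
  assumes "open U" "s \<in> sections A E U" "hol_fun A U f" "x \<in> U"
  shows "id_q x (D U (sec_smult E U f s) x) = f x \<odot>\<^bsub>QF x\<^esub> id_q x (D U s x)"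
proof -
  interpret T: Module.module CC "QF x" by (rule vspace_QF)
  have s: "s x \<in> carrier (fib E x)" by (rule E.section_closed[OF assms(2,4)])
  have d: "dual_anchor V \<phi> x (differential A f x) \<in> carrier (dual (fib V x))"
    by (rule dual_anchor_closed[OF differential_closed])
  note Ds = D_closed[OF assms(1,2,4)]
  have "id_q x (D U (sec_smult E U f s) x) = f x \<odot>\<^bsub>QF x\<^esub> id_q x (D U s x) \<oplus>\<^bsub>QF x\<^esub>
    pure (fib E x) (Q_fiber A V \<phi> x) (s x) (q_fiber A V \<phi> x (dual_anchor V \<phi> x (differential A f x)))"
    unfolding Leibniz[OF assms] linear_add[OF id_q_linear vspace_smult_closed[OF vspace_TF Ds] pure_closed[OF E.fib vspace_dual_V s d]]
      linear_smult[OF id_q_linear Ds] id_q_pure[OF s d] ..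
  \<comment> \<open>The differential of f at x is a covector, so \<open>q_fiber_anchor\<close>
    removes the derivative term and leaves plain linearity over functions.\<close>
  then show ?thesis
    unfolding q_fiber_anchor[OF differential_closed] pure_zero_right[OF E.fib vspace_Q_fiber s]
    using linear_closed[OF id_q_linear Ds] by simp
qed

lemma id_q_D_lin_comb:
  assumes W: "open W" "x \<in> W" and e: "\<And>i. i < n \<Longrightarrow> e i \<in> sections A E W"
    and c: "\<And>i. i < n \<Longrightarrow> hol_fun A W (c i)"
  shows "id_q x (D W (restrict (lin_comb E c e n) W) x) =
    finsum (QF x) (\<lambda>i. c i x \<odot>\<^bsub>QF x\<^esub> id_q x (D W (e i) x)) {..<n}"
  using e c
proof (induction n)
  case 0
  interpret T: Module.module CC "QF x" by (rule vspace_QF)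
  have "restrict (lin_comb E c e 0) W = sec_zero E W"
    by (simp add: sec_zero_def E.lin_comb_0 fun_eq_iff)
  then have "id_q x (D W (restrict (lin_comb E c e 0) W) x) = \<zero>\<^bsub>QF x\<^esub>"
    by (simp only: D_zero[OF W] linear_zero[OF id_q_linear vspace_TF vspace_QF])
  then show ?case by (simp only: lessThan_0 T.finsum_empty)
next
  case (Suc n)
  interpret T: Module.module CC "QF x" by (rule vspace_QF)
  have part: "restrict (lin_comb E c e n) W \<in> sections A E W"
    by (rule E.section_lin_comb) (simp_all add: Suc.prems)
  have last: "sec_smult E W (c n) (e n) \<in> sections A E W"
    by (rule E.section_smult) (simp_all add: Suc.prems)
  have en: "e n \<in> sections A E W" "hol_fun A W (c n)" by (simp_all add: Suc.prems)
  have IH: "id_q x (D W (restrict (lin_comb E c e n) W) x) =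
      finsum (QF x) (\<lambda>i. c i x \<odot>\<^bsub>QF x\<^esub> id_q x (D W (e i) x)) {..<n}"
    by (rule Suc.IH) (simp_all add: Suc.prems)
  have closed: "c i x \<odot>\<^bsub>QF x\<^esub> id_q x (D W (e i) x) \<in> carrier (QF x)" if "i < Suc n" for i
    by (intro vspace_smult_closed vspace_QF linear_closed[OF id_q_linear] D_closed W Suc.prems that)
  have sum: "finsum (QF x) (\<lambda>i. c i x \<odot>\<^bsub>QF x\<^esub> id_q x (D W (e i) x)) {..<n} \<in> carrier (QF x)"
    by (rule T.finsum_closed) (simp add: closed Pi_def)
  have "id_q x (D W (restrict (lin_comb E c e (Suc n)) W) x) =
    finsum (QF x) (\<lambda>i. c i x \<odot>\<^bsub>QF x\<^esub> id_q x (D W (e i) x)) {..<n} \<oplus>\<^bsub>QF x\<^esub>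
    c n x \<odot>\<^bsub>QF x\<^esub> id_q x (D W (e n) x)"
    using E.lin_comb_partial[where n = n and c = c, OF Suc.prems(1)]
    by (simp only: D_add[OF W(1) part last W(2)] linear_add[OF id_q_linear D_closed[OF W(1) part W(2)]
          D_closed[OF W(1) last W(2)]] IH id_q_Leibniz[OF W(1) en W(2)])
  also have "\<dots> = c n x \<odot>\<^bsub>QF x\<^esub> id_q x (D W (e n) x) \<oplus>\<^bsub>QF x\<^esub>
    finsum (QF x) (\<lambda>i. c i x \<odot>\<^bsub>QF x\<^esub> id_q x (D W (e i) x)) {..<n}"
    by (rule T.a_comm[OF sum closed]) simp
  also have "\<dots> = finsum (QF x) (\<lambda>i. c i x \<odot>\<^bsub>QF x\<^esub> id_q x (D W (e i) x)) {..<Suc n}"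
    unfolding lessThan_Suc by (rule T.finsum_insert[symmetric]) (auto intro!: closed)
  finally show ?case .
qed

text \<open>Both sections are expanded in one frame over a common neighbourhood, and only the
  coefficients at x survive; these are the coordinates of the value at x.\<close>

lemma id_q_D_cong:
  assumes s: "open U" "x \<in> U" "s \<in> sections A E U"
    and t: "open U'" "x \<in> U'" "t \<in> sections A E U'" and eq: "s x = t x"
  shows "id_q x (D U s x) = id_q x (D U' t x)"
proof -
  let ?Z = "U \<inter> U'"
  have Z: "open ?Z" "x \<in> ?Z" using s t by auto
  interpret T: Module.module CC "QF x" by (rule vspace_QF)
  obtain W e where W: "open W" "x \<in> W" "W \<subseteq> ?Z" "\<And>i. i < rk E \<Longrightarrow> e i \<in> sections A E W"
    "\<And>y. y \<in> W \<Longrightarrow> is_basis (fib E y) (rk E) (\<lambda>i. e i y)"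
    "\<And>s. s \<in> sections A E ?Z \<Longrightarrow> \<exists>c. (\<forall>i<rk E. hol_fun A W (c i)) \<and>
      (\<forall>y\<in>W. s y = lin_comb E c e (rk E) y)"
    by (rule E.local_frame[OF Z]) auto
  \<comment> \<open>The right-hand side mentions u only through u x. The frame e is fixed
    beforehand, so the formula can be used for s and for t alike.\<close>
  have expand: "id_q x (D O' u x) =
      finsum (QF x) (\<lambda>i. coord (fib E x) (rk E) (\<lambda>i. e i x) (u x) i \<odot>\<^bsub>QF x\<^esub> id_q x (D W (e i) x)) {..<rk E}"
    if u: "open O'" "u \<in> sections A E O'" "?Z \<subseteq> O'" for O' u
  proof -
    have WO: "W \<subseteq> O'" using W(3) u(3) by blast
    have "restrict u ?Z \<in> sections A E ?Z" by (rule E.section_restrict[OF u(2,3)])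
    then obtain c where c: "\<And>i. i < rk E \<Longrightarrow> hol_fun A W (c i)"
      "\<And>y. y \<in> W \<Longrightarrow> restrict u ?Z y = lin_comb E c e (rk E) y"
      using W(6) by blast
    have uy: "u y = lin_comb E c e (rk E) y" if "y \<in> W" for y
      using c(2)[OF that] subsetD[OF W(3) that] by simp
    have "restrict u W = restrict (lin_comb E c e (rk E)) W"
      by (rule restrict_ext) (rule uy)
    then have "id_q x (D O' u x) = id_q x (D W (restrict (lin_comb E c e (rk E)) W) x)"
      using D_restrict[OF u(1,2) W(1) WO W(2)] by simp
    also have "\<dots> = finsum (QF x) (\<lambda>i. c i x \<odot>\<^bsub>QF x\<^esub> id_q x (D W (e i) x)) {..<rk E}"
      by (rule id_q_D_lin_comb[OF W(1,2,4) c(1)])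
    also have "\<dots> = finsum (QF x) (\<lambda>i. coord (fib E x) (rk E) (\<lambda>i. e i x) (u x) i \<odot>\<^bsub>QF x\<^esub> id_q x (D W (e i) x)) {..<rk E}"
    proof (rule T.finsum_cong')
      show "(\<lambda>i. coord (fib E x) (rk E) (\<lambda>i. e i x) (u x) i \<odot>\<^bsub>QF x\<^esub> id_q x (D W (e i) x)) \<in> {..<rk E} \<rightarrow> carrier (QF x)"
        by (intro Pi_I vspace_smult_closed vspace_QF linear_closed[OF id_q_linear] D_closed W) simp
      fix i assume "i \<in> {..<rk E}"
      then have "coord (fib E x) (rk E) (\<lambda>i. e i x) (u x) i = c i x"
        using uy[OF W(2)] by (intro coord_unique[OF E.fib W(5)[OF W(2)]]) (simp_all add: lin_comb_def)
      then show "c i x \<odot>\<^bsub>QF x\<^esub> id_q x (D W (e i) x) =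
          coord (fib E x) (rk E) (\<lambda>i. e i x) (u x) i \<odot>\<^bsub>QF x\<^esub> id_q x (D W (e i) x)" by simp
    qed simp
    finally show ?thesis .
  qed
  show ?thesis
    unfolding expand[OF s(1,3) Int_lower1] expand[OF t(1,3) Int_lower2] eq ..
qed

text \<open>\<open>id_q_D_cong\<close> supplies the uniqueness behind the definite description, so
  any extension of the vector may be used.\<close>

lemma S_map_section:
  assumes "open U" "x \<in> U" "s \<in> sections A E U"
  shows "S_map A V \<phi> E D x (s x) = id_q x (D U s x)"
  unfolding S_map_def
proof (rule the_equality)
  show "\<exists>U' t. open U' \<and> x \<in> U' \<and> t \<in> sections A E U' \<and> t x = s x \<and> id_q x (D U s x) = id_q x (D U' t x)"
    using assms by blast
next
  fix w assume "\<exists>U' t. open U' \<and> x \<in> U' \<and> t \<in> sections A E U' \<and> t x = s x \<and> w = id_q x (D U' t x)"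
  then obtain U' t where "open U'" "x \<in> U'" "t \<in> sections A E U'" "t x = s x" "w = id_q x (D U' t x)" by blast
  then show "w = id_q x (D U s x)" using id_q_D_cong[OF _ _ _ assms] by blast
qed

text \<open>Collecting the coefficients of t in a tensor frame according to the second factor gives
  one term for each member of a frame of the dual of V. The vectors v j, dual to that frame at the
  point x, serve to isolate single terms by contraction.\<close>

lemma tensor_section_split:
  assumes U: "open U" "x \<in> U" and t: "t \<in> sections A TB U"
  obtains W s l v where "open W" "x \<in> W" "W \<subseteq> U"
    "\<And>j. j < rk V \<Longrightarrow> s j \<in> sections A E W" "\<And>j. j < rk V \<Longrightarrow> l j \<in> sections A (dual_bundle V) W"
    "\<And>y. y \<in> W \<Longrightarrow> t y = finsum (TF y) (\<lambda>j. pure (fib E y) (dual (fib V y)) (s j y) (l j y)) {..<rk V}"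
    "\<And>j. j < rk V \<Longrightarrow> v j \<in> carrier (fib V x)"
    "\<And>i j. i < rk V \<Longrightarrow> j < rk V \<Longrightarrow> l i x (v j) = (if i = j then 1 else 0)"
proof -
  obtain W1 e where We: "(W1, e) \<in> frames E" "x \<in> W1" using E.frames_cover by blast
  obtain W2 f where Wf: "(W2, f) \<in> frames V" "x \<in> W2" using frames_cover by blast
  let ?r = "rk V" and ?W = "U \<inter> (W1 \<inter> W2)"
  define l where "l i y = dual_elt (fib V y) (rk V) (\<lambda>i. f i y) i" for i y
  have Wl: "(W2, l) \<in> frames (dual_bundle V)" using dual_frame[OF Wf(1)] unfolding l_def[abs_def] .
  let ?h = "\<lambda>k y. pure (fib E y) (dual (fib V y)) (e (k div ?r) y) (l (k mod ?r) y)"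
  have fr: "(W1 \<inter> W2, ?h) \<in> frames TB"
    unfolding tensor_bundle_def vbundle.simps dual_bundle_simps mem_Collect_eq
    by (intro exI[of _ W1] exI[of _ W2] exI[of _ e] exI[of _ l] conjI refl We(1) Wl)
  have "\<forall>(W, h)\<in>frames TB. \<exists>c. (\<forall>k<rk TB. hol_fun A (U \<inter> W) (c k)) \<and>
      (\<forall>y\<in>U \<inter> W. t y = lin_comb TB c h (rk TB) y)"
    using t unfolding sections_def by blast
  from bspec[OF this fr] have "\<exists>c. (\<forall>k<rk E * ?r. hol_fun A ?W (c k)) \<and>
      (\<forall>y\<in>?W. t y = lin_comb TB c ?h (rk E * ?r) y)"
    unfolding prod.case by (simp only: rk_TB)
  then obtain c where c: "\<And>k. k < rk E * ?r \<Longrightarrow> hol_fun A ?W (c k)"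
    "\<And>y. y \<in> ?W \<Longrightarrow> t y = lin_comb TB c ?h (rk E * ?r) y"
    by blast
  have sub: "?W \<subseteq> W1" "?W \<subseteq> W2" by auto
  have eW: "restrict (e i) ?W \<in> sections A E ?W" if "i < rk E" for i
    using E.section_restrict[OF E.frame_section[OF We(1) that] sub(1)]
    unfolding restrict_restrict_subset[OF sub(1)] .
  have lW: "restrict (l i) ?W \<in> sections A (dual_bundle V) ?W" if "i < rk V" for i
    using D.section_restrict[OF D.frame_section[OF Wl] sub(2), of i] that
    unfolding restrict_restrict_subset[OF sub(2)] by simp
  \<comment> \<open>All coefficients whose index has remainder j, that is, those belonging to the
    second factor l j.\<close>
  define s where "s j = restrict (lin_comb E (\<lambda>i. c (i * ?r + j)) (\<lambda>i. restrict (e i) ?W) (rk E)) ?W" for j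
  show ?thesis
  proof (rule that[of ?W s "\<lambda>j. restrict (l j) ?W" "\<lambda>j. f j x"])
    show "open ?W" using U E.frame_open[OF We(1)] frame_open[OF Wf(1)] by blast
    show "x \<in> ?W" "?W \<subseteq> U" using U We Wf by auto
    show "s j \<in> sections A E ?W" if j: "j < ?r" for j
      unfolding s_def
    proof (rule E.section_lin_comb[OF eW c(1)])
      fix i assume "i < rk E"
      \<comment> \<open>The index stays inside the i-th block of length \<open>rk V\<close>, hence
        below the rank of the tensor bundle.\<close>
      then have "i * ?r + j < Suc i * ?r" "Suc i * ?r \<le> rk E * ?r" using j by (simp, intro mult_right_mono) simp_all
      then show "i * ?r + j < rk E * ?r" by (rule less_le_trans)
    qed
    show "restrict (l j) ?W \<in> sections A (dual_bundle V) ?W" if "j < ?r" for j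
      by (rule lW[OF that])
    show "f j x \<in> carrier (fib V x)" if "j < ?r" for j by (rule frame_closed[OF Wf that])
    show "restrict (l i) ?W x (f j x) = (if i = j then 1 else 0)" if "i < ?r" "j < ?r" for i j
      using dual_elt(2)[OF fib frame_basis[OF Wf] that] U We Wf by (simp add: l_def)
    fix y assume y: "y \<in> ?W"
    have ey: "e i y \<in> carrier (fib E y)" if "i < rk E" for i
      using E.frame_closed[OF We(1) _ that, of y] y by blast
    have ly: "l j y \<in> carrier (dual (fib V y))" if "j < ?r" for j
      using D.frame_closed[OF Wl, of y j] y that by simp
    have sy: "s j y = finsum (fib E y) (\<lambda>i. c (i * ?r + j) y \<odot>\<^bsub>fib E y\<^esub> e i y) {..<rk E}" for j
      using y by (simp add: s_def lin_comb_def)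
    show "t y = finsum (TF y) (\<lambda>j. pure (fib E y) (dual (fib V y)) (s j y) (restrict (l j) ?W y)) {..<?r}"
      using tensor_double_sum[where c = "\<lambda>k. c k y", OF E.fib vspace_dual_V ey ly] y
      by (simp add: c(2) lin_comb_def sy)
  qed
qed

section \<open>Necessity of the two conditions\<close>

lemma subsheaf_tensor_value:
  assumes "t \<in> subsheaf_tensor A E (dual_bundle V) (fil_sections A E P x i) U" "x \<in> U"
  obtains n s l where "\<And>k. k < n \<Longrightarrow> s k \<in> fil P x i" "\<And>k. k < n \<Longrightarrow> s k \<in> carrier (fib E x)"
    "\<And>k. k < n \<Longrightarrow> l k \<in> carrier (dual (fib V x))"
    "t x = finsum (TF x) (\<lambda>k. pure (fib E x) (dual (fib V x)) (s k) (l k)) {..<(n::nat)}"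
proof -
  obtain W n s l where W: "x \<in> W" "\<forall>k<n. s k \<in> fil_sections A E P x i W \<and> l k \<in> sections A (dual_bundle V) W"
    "\<forall>z\<in>W. t z = finsum (tensor (fib E z) (fib (dual_bundle V) z))
          (\<lambda>k. pure (fib E z) (fib (dual_bundle V) z) (s k z) (l k z)) {..<(n::nat)}"
    using assms unfolding subsheaf_tensor_def by blast
  show ?thesis
  proof (rule that[of n "\<lambda>k. s k x" "\<lambda>k. l k x"])
    fix k assume "k < n"
    then have k: "s k \<in> fil_sections A E P x i W" "l k \<in> sections A (dual_bundle V) W" using W(2) by blast+
    show "s k x \<in> fil P x i" using k(1) W(1) by (simp add: fil_sections_def)
    show "s k x \<in> carrier (fib E x)" 
      by (rule E.section_closed[of _ W]) (use k(1) W(1) in \<open>simp_all add: fil_sections_def\<close>)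
    show "l k x \<in> carrier (dual (fib V x))" using D.section_closed[OF k(2) W(1)] by simp
  qed (use W in simp)
qed

text \<open>An extension of v lies in the subsheaf because only its value at x matters. Its image
  under D is at x a sum of pure tensors with first factors in the filtration step, and id \<otimes>
  q leaves first factors alone.\<close>

lemma S_map_preserves:
  assumes fil: "fil P x i \<subseteq> carrier (fib E x)"
    and pres: "\<And>U. open U \<Longrightarrow> D U ` fil_sections A E P x i U
      \<subseteq> subsheaf_tensor A E (dual_bundle V) (fil_sections A E P x i) U"
    and v: "v \<in> fil P x i"
  shows "S_map A V \<phi> E D x v \<in> sub_tensor (fib E x) (Q_fiber A V \<phi> x) (fil P x i)"
proof -
  have "v \<in> carrier (fib E x)" using v fil by blast
  then obtain U s where s: "open U" "x \<in> U" "s \<in> sections A E U" "s x = v"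
    by (rule E.section_extend)
  have "s \<in> fil_sections A E P x i U" using s v by (simp add: fil_sections_def)
  then have "D U s \<in> subsheaf_tensor A E (dual_bundle V) (fil_sections A E P x i) U"
    using pres[OF s(1)] by blast
  then obtain n u l where u: "\<And>k. k < n \<Longrightarrow> u k \<in> fil P x i" "\<And>k. k < n \<Longrightarrow> u k \<in> carrier (fib E x)"
    "\<And>k. k < n \<Longrightarrow> l k \<in> carrier (dual (fib V x))"
    "D U s x = finsum (TF x) (\<lambda>k. pure (fib E x) (dual (fib V x)) (u k) (l k)) {..<(n::nat)}"
    using subsheaf_tensor_value[OF _ s(2)] by blast
  interpret T: Module.module CC "QF x" by (rule vspace_QF)
  have "S_map A V \<phi> E D x v = id_q x (D U s x)"
    using S_map_section[OF s(1-3)] s(4) by simp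
  also have "\<dots> = finsum (QF x) (\<lambda>k. id_q x (pure (fib E x) (dual (fib V x)) (u k) (l k))) {..<n}"
    unfolding u(4)
    by (rule linear_finsum[OF id_q_linear vspace_TF vspace_QF])
      (auto intro!: pure_closed[OF E.fib vspace_dual_V] u)
  also have "\<dots> \<in> sub_tensor (fib E x) (Q_fiber A V \<phi> x) (fil P x i)"
  proof (rule submodule_finsum[OF sub_tensor_submodule[OF E.fib vspace_Q_fiber fil] vspace_QF])
    fix k assume "k \<in> {..<n}"
    then have k: "k < n" by simp
    show "id_q x (pure (fib E x) (dual (fib V x)) (u k) (l k)) \<in> sub_tensor (fib E x) (Q_fiber A V \<phi> x) (fil P x i)"
      unfolding id_q_pure[OF u(2,3)[OF k]]
      by (rule pure_sub_tensor[OF u(1)[OF k] linear_closed[OF q_fiber_linear u(3)[OF k]]])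
  qed simp
  finally show ?thesis .
qed

text \<open>The Leibniz rule only yields the vanishing of a pure tensor. Since its first factor is a
  basis vector of the fiber, which exists by positivity of the rank, contraction shows that the
  second factor is 0; and the differential of a coordinate spans the cotangent line.\<close>

lemma dual_anchor_zero:
  assumes rk: "rk E > 0" and fil: "fil P x i = {\<zero>\<^bsub>fib E x\<^esub>}"
    and pres: "\<And>U. open U \<Longrightarrow> D U ` fil_sections A E P x i U
      \<subseteq> subsheaf_tensor A E (dual_bundle V) (fil_sections A E P x i) U"
    and \<omega>: "\<omega> \<in> carrier (dual (tangent_space A x))"
  shows "dual_anchor V \<phi> x \<omega> = (\<lambda>_. 0)"
proof -
  interpret T: Module.module CC "TF x" by (rule vspace_TF)
  interpret M: Module.module CC "fib E x" by (rule E.fib)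
  obtain a where a: "a \<in> A" "x \<in> fst a" using charts_cover by blast
  then have ax: "a \<in> charts_at A x" by (simp add: charts_at_def)
  obtain W e where W: "open W" "x \<in> W" "W \<subseteq> fst a" "\<And>i. i < rk E \<Longrightarrow> e i \<in> sections A E W"
    "\<And>y. y \<in> W \<Longrightarrow> is_basis (fib E y) (rk E) (\<lambda>i. e i y)"
    by (rule E.local_frame[OF chart_open[OF a(1)] a(2)]) auto
  \<comment> \<open>A coordinate centred at x. It makes the multiple of the frame member vanish at
    x, so that this lies in the subsheaf, while its differential there is nonzero.\<close>
  define z where "z y = snd a y + - snd a x" for y
  have z: "hol_fun A W z"
    unfolding z_def[abs_def] by (intro hol_fun_add hol_fun_const hol_fun_mono[OF hol_fun_chart[OF a(1)] W(3)])
  let ?e = "e 0" and ?d = "dual_anchor V \<phi> x (differential A z x)"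
  have e: "?e \<in> sections A E W" using W(4) rk by simp
  have ex: "?e x \<in> carrier (fib E x)" by (rule E.section_closed[OF e W(2)])
  have d: "?d \<in> carrier (dual (fib V x))" by (rule dual_anchor_closed[OF differential_closed])
  have "sec_smult E W z ?e x = \<zero>\<^bsub>fib E x\<^esub>"
    using W(2) by (simp add: sec_smult_def z_def vspace_null[OF E.fib ex])
  then have "sec_smult E W z ?e \<in> fil_sections A E P x i W"
    using E.section_smult[OF e z] fil by (simp add: fil_sections_def)
  then have "D W (sec_smult E W z ?e) \<in> subsheaf_tensor A E (dual_bundle V) (fil_sections A E P x i) W"
    using pres[OF W(1)] by blast
  then obtain n u l where u: "\<And>k. k < n \<Longrightarrow> u k \<in> fil P x i"
    "\<And>k. k < n \<Longrightarrow> u k \<in> carrier (fib E x)"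
    "\<And>k. k < n \<Longrightarrow> l k \<in> carrier (dual (fib V x))"
    "D W (sec_smult E W z ?e) x = finsum (TF x) (\<lambda>k. pure (fib E x) (dual (fib V x)) (u k) (l k)) {..<(n::nat)}"
    using subsheaf_tensor_value[OF _ W(2)] by blast
  \<comment> \<open>All first factors lie in the zero filtration step, so each term of the
    decomposition vanishes at x.\<close>
  have "finsum (TF x) (\<lambda>k. pure (fib E x) (dual (fib V x)) (u k) (l k)) {..<n} = finsum (TF x) (\<lambda>_. \<zero>\<^bsub>TF x\<^esub>) {..<n}"
  proof (rule T.finsum_cong')
    fix k assume "k \<in> {..<n}"
    then have "u k = \<zero>\<^bsub>fib E x\<^esub>" "l k \<in> carrier (dual (fib V x))" using u(1,3) fil by auto
    then show "pure (fib E x) (dual (fib V x)) (u k) (l k) = \<zero>\<^bsub>TF x\<^esub>"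
      by (simp only: pure_zero_left[OF E.fib vspace_dual_V])
  qed simp_all
  then have "D W (sec_smult E W z ?e) x = \<zero>\<^bsub>TF x\<^esub>" unfolding u(4) T.finsum_zero .
  moreover have "D W (sec_smult E W z ?e) x = pure (fib E x) (dual (fib V x)) (?e x) ?d"
  proof -
    have "z x = 0" by (simp add: z_def)
    then show ?thesis
      unfolding Leibniz[OF W(1) e z W(2)]
      by (simp only: vspace_null[OF vspace_TF D_closed[OF W(1) e W(2)]] T.l_zero[OF pure_closed[OF E.fib vspace_dual_V ex d]])
  qed
  ultimately have pure0: "pure (fib E x) (dual (fib V x)) (?e x) ?d = \<zero>\<^bsub>TF x\<^esub>" by simp
  \<comment> \<open>Contracting with evaluation at v turns the vanishing pure tensor into a scalar
    multiple of e 0 x that is 0.\<close>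
  have d0: "?d v = 0" for v
  proof -
    have "?d v \<odot>\<^bsub>fib E x\<^esub> ?e x = \<zero>\<^bsub>fib E x\<^esub>"
      using contract_pure[OF E.fib vspace_dual_V dual_eval_linear[of v] ex d]
        linear_zero[OF contract_linear[OF E.fib vspace_dual_V dual_eval_linear[of v]] vspace_TF E.fib]
      unfolding pure0 by simp
    also have "\<dots> = 0 \<odot>\<^bsub>fib E x\<^esub> ?e x" using vspace_null[OF E.fib ex] by simp
    \<comment> \<open>The 0-th coordinate of e 0 x in its own frame is 1, which isolates the
      scalar.\<close>
    finally have "coord (fib E x) (rk E) (\<lambda>i. e i x) (?d v \<odot>\<^bsub>fib E x\<^esub> ?e x) 0 =
      coord (fib E x) (rk E) (\<lambda>i. e i x) (0 \<odot>\<^bsub>fib E x\<^esub> ?e x) 0" by simp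
    then show ?thesis
      unfolding coord_smult[OF E.fib W(5)[OF W(2)] ex rk] coord_basis[OF E.fib W(5)[OF W(2)] rk rk] by simp
  qed
  show ?thesis
  proof
    fix v
    show "dual_anchor V \<phi> x \<omega> v = 0"
    proof (cases "v \<in> carrier (fib V x)")
      case True
      have \<phi>v: "\<phi> x v \<in> carrier (tangent_space A x)" by (rule linear_closed[OF anchor_linear True])
      \<comment> \<open>Pairing with dz reads off the component in the chart a. The tangent space is
        one-dimensional, so a vanishing component means \<phi> x v = 0, and the claim follows for
        every \<omega>.\<close>
      have "differential A z x (\<phi> x v) = \<phi> x v a"
        using differential_chart[OF ax \<phi>v] by (simp add: z_def[abs_def])
      then have va: "\<phi> x v a = 0" using d0[of v] True by (simp add: dual_anchor_def)
      have "\<phi> x v = 0 \<odot>\<^bsub>tangent_space A x\<^esub> coord_field A a x"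
        using tangent_expand[OF \<phi>v ax] unfolding va .
      then have "\<omega> (\<phi> x v) = 0"
        using dual_smult[OF \<omega> coord_field_closed[OF ax], of 0] by simp
      then show ?thesis by (simp add: dual_anchor_def)
    qed (simp add: dual_anchor_def)
  qed
qed

section \<open>Sufficiency of the two conditions\<close>

lemma D_preserves:
  assumes x: "submodule (fil P x i) CC (fib E x)"
    and S: "S_map A V \<phi> E D x ` fil P x i \<subseteq> sub_tensor (fib E x) (Q_fiber A V \<phi> x) (fil P x i)"
    and zero: "\<And>\<omega>. \<omega> \<in> carrier (dual (tangent_space A x)) \<Longrightarrow> dual_anchor V \<phi> x \<omega> = (\<lambda>_. 0)"
    and U: "open U" and s: "s \<in> fil_sections A E P x i U"
  shows "D U s \<in> subsheaf_tensor A E (dual_bundle V) (fil_sections A E P x i) U"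
  unfolding subsheaf_tensor_def
proof (intro CollectI conjI ballI)
  have sU: "s \<in> sections A E U" using s by (simp add: fil_sections_def)
  show DU: "D U s \<in> sections A TB U" by (rule D_section[OF U sU])
  fix y assume y: "y \<in> U"
  obtain W u l v where W: "open W" "y \<in> W" "W \<subseteq> U"
    "\<And>j. j < rk V \<Longrightarrow> u j \<in> sections A E W" "\<And>j. j < rk V \<Longrightarrow> l j \<in> sections A (dual_bundle V) W"
    "\<And>z. z \<in> W \<Longrightarrow> D U s z = finsum (TF z) (\<lambda>j. pure (fib E z) (dual (fib V z)) (u j z) (l j z)) {..<rk V}"
    "\<And>j. j < rk V \<Longrightarrow> v j \<in> carrier (fib V y)"
    "\<And>i j. i < rk V \<Longrightarrow> j < rk V \<Longrightarrow> l i y (v j) = (if i = j then 1 else 0)"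
    using tensor_section_split[OF U y DU] by blast
  show "\<exists>W n s' l. open W \<and> y \<in> W \<and> W \<subseteq> U \<and>
      (\<forall>k<n. s' k \<in> fil_sections A E P x i W \<and> l k \<in> sections A (dual_bundle V) W) \<and>
      (\<forall>z\<in>W. D U s z = finsum (tensor (fib E z) (fib (dual_bundle V) z))
          (\<lambda>k. pure (fib E z) (fib (dual_bundle V) z) (s' k z) (l k z)) {..<(n::nat)})"
  \<comment> \<open>Membership is local, and the subsheaf differs from E only at x. At y = x the
    decomposition already found is shown to have its first factors in the subsheaf; it is not
    replaced by another.\<close>
  proof (cases "y = x")
    case False
    \<comment> \<open>W may contain x even though y is different from x; once x is removed, the
      filtration condition is vacuous.\<close>
    let ?W = "W - {x}"
    show ?thesis
    proof (intro exI[of _ ?W] exI[of _ "rk V"] exI[of _ "\<lambda>j. restrict (u j) ?W"] exI[of _ "\<lambda>j. restrict (l j) ?W"]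
        conjI allI impI ballI)
      show "open ?W" using W(1) by (simp add: open_delete)
      show "y \<in> ?W" "?W \<subseteq> U" using W(2,3) False by auto
      show "restrict (u k) ?W \<in> fil_sections A E P x i ?W" if "k < rk V" for k
        using E.section_restrict[OF W(4)[OF that], of ?W] by (simp add: fil_sections_def)
      show "restrict (l k) ?W \<in> sections A (dual_bundle V) ?W" if "k < rk V" for k
        by (rule D.section_restrict[OF W(5)[OF that]]) blast
      show "D U s z = finsum (tensor (fib E z) (fib (dual_bundle V) z))
          (\<lambda>k. pure (fib E z) (fib (dual_bundle V) z) (restrict (u k) ?W z) (restrict (l k) ?W z)) {..<rk V}"
        if z: "z \<in> ?W" for z
      proof -
        have "z \<in> W" using z by blast
        with z show ?thesis by (simp add: W(6))
      qed
    qed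
  next
    case True
    have ux: "u j x \<in> carrier (fib E x)" "l j x \<in> carrier (dual (fib V x))" if "j < rk V" for j
      using E.section_closed[OF W(4)[OF that] W(2)] D.section_closed[OF W(5)[OF that] W(2)] True by simp_all
    interpret T: Module.module CC "QF x" by (rule vspace_QF)
    interpret M: Module.module CC "fib E x" by (rule E.fib)
    have "s x \<in> fil P x i" using s y True by (simp add: fil_sections_def)
    then have mem: "id_q x (D U s x) \<in> sub_tensor (fib E x) (Q_fiber A V \<phi> x) (fil P x i)"
      using S S_map_section[OF U _ sU, of x] y True by auto
    have expand: "id_q x (D U s x) = finsum (QF x)
        (\<lambda>j. pure (fib E x) (Q_fiber A V \<phi> x) (u j x) (q_fiber A V \<phi> x (l j x))) {..<rk V}"
    proof -
      have "id_q x (D U s x) = finsum (QF x) (\<lambda>j. id_q x (pure (fib E x) (dual (fib V x)) (u j x) (l j x))) {..<rk V}"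
        unfolding W(6)[OF W(2), unfolded True]
        by (rule linear_finsum[OF id_q_linear vspace_TF vspace_QF])
          (auto intro!: pure_closed[OF E.fib vspace_dual_V] ux)
      also have "\<dots> = finsum (QF x) (\<lambda>j. pure (fib E x) (Q_fiber A V \<phi> x) (u j x) (q_fiber A V \<phi> x (l j x))) {..<rk V}"
        by (rule T.finsum_cong')
          (auto simp: id_q_pure ux intro!: pure_closed[OF E.fib vspace_Q_fiber] linear_closed[OF q_fiber_linear] ux)
      finally show ?thesis .
    qed
    \<comment> \<open>The functional \<Lambda> attached to v j takes the value 1 on the class of l j
      x and 0 on those of the other l k x. Contraction therefore sends the tensor to u j x, and
      condition (1) places the result in the filtration step.\<close>
    have fil: "u j x \<in> fil P x i" if j: "j < rk V" for j
    proof -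
      have "v j \<in> carrier (fib V x)" using W(7)[OF j] True by simp
      then obtain \<Lambda> where \<Lambda>: "\<Lambda> \<in> linear_maps (Q_fiber A V \<phi> x) complex_line"
        "\<And>l. l \<in> carrier (dual (fib V x)) \<Longrightarrow> \<Lambda> (q_fiber A V \<phi> x l) = l (v j)"
        using Q_fiber_eval[OF zero] by blast
      note q = linear_closed[OF q_fiber_linear]
      have "contract (fib E x) \<Lambda> (id_q x (D U s x)) = finsum (fib E x) (\<lambda>k. contract (fib E x) \<Lambda>
          (pure (fib E x) (Q_fiber A V \<phi> x) (u k x) (q_fiber A V \<phi> x (l k x)))) {..<rk V}"
        unfolding expand
        by (rule linear_finsum[OF contract_linear[OF E.fib vspace_Q_fiber \<Lambda>(1)] vspace_QF E.fib])
          (auto intro!: pure_closed[OF E.fib vspace_Q_fiber] q ux)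
      also have "\<dots> = finsum (fib E x) (\<lambda>k. if j = k then u k x else \<zero>\<^bsub>fib E x\<^esub>) {..<rk V}"
      proof (rule M.finsum_cong')
        fix k assume "k \<in> {..<rk V}"
        then have k: "k < rk V" by simp
        have "contract (fib E x) \<Lambda> (pure (fib E x) (Q_fiber A V \<phi> x) (u k x) (q_fiber A V \<phi> x (l k x)))
            = l k x (v j) \<odot>\<^bsub>fib E x\<^esub> u k x"
          by (simp add: contract_pure[OF E.fib vspace_Q_fiber \<Lambda>(1)] ux[OF k] q \<Lambda>(2))
        then show "contract (fib E x) \<Lambda> (pure (fib E x) (Q_fiber A V \<phi> x) (u k x) (q_fiber A V \<phi> x (l k x)))
            = (if j = k then u k x else \<zero>\<^bsub>fib E x\<^esub>)"
          using W(8)[OF k j] True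
          by (simp add: vspace_one[OF E.fib ux(1)[OF k]] vspace_null[OF E.fib ux(1)[OF k]])
      qed (auto simp: ux)
      also have "\<dots> = u j x"
        by (rule M.finsum_singleton) (use j ux in auto)
      finally show ?thesis
        using contract_sub_tensor[OF E.fib vspace_Q_fiber \<Lambda>(1) x mem] by simp
    qed
    show ?thesis
      by (intro exI[of _ W] exI[of _ "rk V"] exI[of _ u] exI[of _ l] conjI allI impI ballI)
        (use W fil True in \<open>simp_all add: fil_sections_def\<close>)
  qed
qed

end

theorem proposition1p1:
  fixes A :: "'x::t2_space chart set"
    and S :: "'x set"
    and V :: "('x, 'v) vbundle"
    and br :: "('x, 'v) pairing"
    and \<phi> :: "('x, 'v) anchor"
    and E :: "('x, 'e) vbundle"
    and P :: "('x, 'e) parabolic"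
    and D :: "('x, 'e, ('e, 'v \<Rightarrow> complex) tens) sheaf_map"
  assumes "compact_riemann_surface A"
    and "finite S" and "S \<noteq> {}"
    and "lie_algebroid A V br \<phi>"
    and "hol_bundle A E" and "rk E > 0"
    and "parabolic_structure S E P"
    and "lie_algebroid_connection A V \<phi> E D"
  shows "quasi_parabolic_connection A S V \<phi> E P D \<longleftrightarrow>
    (\<forall>x\<in>S. \<forall>i\<in>{1..len P x + 1}.
        S_map A V \<phi> E D x ` fil P x i \<subseteq> sub_tensor (fib E x) (Q_fiber A V \<phi> x) (fil P x i)) \<and>
    (\<forall>x\<in>S. \<forall>\<omega>\<in>carrier (fib (KX A) x).
        dual_anchor V \<phi> x \<omega> = \<zero>\<^bsub>fib (dual_bundle V) x\<^esub>)"
proof -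
  have A: "riemann_surface A" using assms(1) by (simp add: compact_riemann_surface_def)
  have V: "hol_vb A V" "bundle_hom A V (TX A) \<phi>"
    using assms(4) by (auto simp: lie_algebroid_def intro: hol_vbI[OF A])
  interpret connection A V \<phi> E D
    by (intro connection.intro anchored_vb.intro anchored_vb_axioms.intro connection_axioms.intro
        V hol_vbI[OF A assms(5)] assms(8))
  have fil: "submodule (fil P x i) CC (fib E x)" if "x \<in> S" "i \<in> {1..len P x + 1}" for x i
    using assms(7) that unfolding parabolic_structure_def by blast
  have last: "fil P x (len P x + 1) = {\<zero>\<^bsub>fib E x\<^esub>}" if "x \<in> S" for x
    using assms(7) that unfolding parabolic_structure_def by blast
  show ?thesis
  proof (intro iffI conjI ballI)
    assume q: "quasi_parabolic_connection A S V \<phi> E P D"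
    have pres: "D U ` fil_sections A E P x i U
        \<subseteq> subsheaf_tensor A E (dual_bundle V) (fil_sections A E P x i) U"
      if "x \<in> S" "i \<in> {1..len P x + 1}" "open U" for x i U
      using q that unfolding quasi_parabolic_connection_def by blast
    show "S_map A V \<phi> E D x ` fil P x i \<subseteq> sub_tensor (fib E x) (Q_fiber A V \<phi> x) (fil P x i)"
      if x: "x \<in> S" "i \<in> {1..len P x + 1}" for x i
      using S_map_preserves[OF submodule_subset[OF fil[OF x] E.fib] pres[OF x]] by blast
    show "dual_anchor V \<phi> x \<omega> = \<zero>\<^bsub>fib (dual_bundle V) x\<^esub>"
      if x: "x \<in> S" and \<omega>: "\<omega> \<in> carrier (fib (KX A) x)" for x \<omega>
    proof -
      \<comment> \<open>The range of indices includes the step after the last nonzero one, whose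
        subsheaf consists of the sections vanishing at x; condition (2) comes from this
        index.\<close>
      have "len P x + 1 \<in> {1..len P x + 1}" by simp
      from dual_anchor_zero[OF assms(6) last[OF x] pres[OF x this]] \<omega>
      show ?thesis by (simp add: dual_simps)
    qed
  next
    assume r: "(\<forall>x\<in>S. \<forall>i\<in>{1..len P x + 1}.
        S_map A V \<phi> E D x ` fil P x i \<subseteq> sub_tensor (fib E x) (Q_fiber A V \<phi> x) (fil P x i)) \<and>
      (\<forall>x\<in>S. \<forall>\<omega>\<in>carrier (fib (KX A) x).
        dual_anchor V \<phi> x \<omega> = \<zero>\<^bsub>fib (dual_bundle V) x\<^esub>)"
    have zero: "dual_anchor V \<phi> x \<omega> = (\<lambda>_. 0)" if "x \<in> S" "\<omega> \<in> carrier (dual (tangent_space A x))" for x \<omega>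
      using r that by (simp add: dual_simps)
    show "quasi_parabolic_connection A S V \<phi> E P D"
      unfolding quasi_parabolic_connection_def
    proof (intro conjI ballI allI impI image_subsetI assms(8))
      fix x i U s assume x: "x \<in> S" "i \<in> {1..len P x + 1}" and "open U" "s \<in> fil_sections A E P x i U"
      then show "D U s \<in> subsheaf_tensor A E (dual_bundle V) (fil_sections A E P x i) U"
        using r by (intro D_preserves[OF fil[OF x] _ zero[OF x(1)]]) blast+
    qed
  qed
qed

end
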